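(* Assume the resolution condition $$C_{I_H}\sqrt{C_{\mathrm{ol}}}\,H\kappa\le 1/\sqrt2,$$ assume that $h$ is such that, for a constant $C_{\mathrm{FEM}}$, $$\big(C_{\mathrm{FEM}}\,\gamma(\kappa,\Omega)\big)^{-1}\le \inf_{v\in V_h\setminus\{0\}}\ \sup_{w\in V_h\setminus\{0\}}\frac{\Re a(v,w)}{\|v\|_V\|w\|_V},$$ and assume the two oversampling conditions $$m\ge \Big|\log\big(\sqrt6\,C_a\sqrt{C_{\mathrm{ol}}}\,C_{I_H}C_{I_H,V}\,C_2\sqrt{C_{\mathrm{ol},m}}\,C_{\mathrm{FEM}}\,\gamma(\kappa,\Omega)\big)\Big|\Big/|\log\beta|$$ and $$m\ge \Big|\log\big(2\,C_2\sqrt{C_{\mathrm{ol},m}}\,C_a^2\,C_{\mathrm{PG}}\,\gamma(\kappa,\Omega)\sqrt{3/2}\big)\Big|\Big/|\log\beta|,\qquad C_{\mathrm{PG}}:=2\,C_{I_H,V}\,C_{\mathcal C}\,C_{\mathrm{FEM}}.$$ Let $u_H\in V_H$ be the solution of the Petrov-Galerkin problem $$a(u_H,\tilde v_H)=(f,\tilde v_H)_{L^2(\Omega)}+(g,\tilde v_H)_{L^2(\Gamma_R)}\quad\text{for all }\tilde v_H\in\widetilde V_H$$ with parameters $H$, $h$, $m$, and let $u_h\in V_h$ be the solution of the standard Galerkin finite element method on $\mathcal G_h$, i.e. $a(u_h,v_h)=(f,v_h)_{L^2(\Omega)}+(g,v_h)_{L^2(\Gamma_R)}$ for all $v_h\in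 V_h$. Then $$\|u_h-u_H\|_V\lesssim\|(1-I_H)u_h\|_V\approx\min_{v_H\in V_H}\|u_h-v_H\|_V .$$
   Context: $A\lesssim B$ means $A\le CB$ with a constant $C$ independent of $H$, $h$, $m$ and $\kappa$; $A\approx B$ means $A\lesssim B\lesssim A$. Continuous problem. $\Omega\subseteq\mathbb R^d$, $d\in\{1,2,3\}$, is an open bounded domain with polyhedral Lipschitz boundary, $\partial\Omega=\Gamma_D\cup\Gamma_R$ disjointly with $\Gamma_D$ closed (either part may be empty), and $\kappa>0$ is real. All functions are complex valued, $(v,w)_{L^2(\omega)}=\int_\omega v\bar w$. $V:=\{v\in W^{1,2}(\Omega;\mathbb C): v|_{\Gamma_D}=0\}$ with norm $\|v\|_{V,\omega}^2:=\kappa^2\|v\|_{L^2(\omega)}^2+\|\nabla v\|_{L^2(\omega)}^2$, $\|v\|_V:=\|v\|_{V,\Omega}$. The sesquilinear form is $a(v,w):=(\nabla v,\nabla w)_{L^2(\Omega)}-\kappa^2(v,w)_{L^2(\Omega)}-i\kappa(v,w)_{L^2(\Gamma_R)}$, with continuity constant $C_a$ (independent of $\kappa$): $|a(v,w)|\le C_a\|v\|_V\|w\|_V$ for all $v,w\in V$. Data: $f\in L^2(\Omega;\mathbb C)$, $g\in L^2(\Gamma_R;\mathbb C)$. Standing assumption: there is $\gamma(\kappa,\Omega)>0$, depending polynomially on $\kappa$, with $\gamma(\kappa,\Omega)^{-1}\le\inf_{v\in V\setminus\{0\}}\sup_{w\in V\setminus\{0\}}\Re a(v,w)/(\|v\|_V\|w\|_V)$.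 Meshes. $\mathcal G_H$ is a regular (conforming), shape-regular, quasi-uniform partition of $\Omega$ into closed intervals/parallelograms/parallelepipeds ($d=1,2,3$), $H:=\max_{T\in\mathcal G_H}\operatorname{diam}T$. For $S\subseteq\overline\Omega$ let $\mathsf N(S):=\operatorname{int}\bigcup\{T\in\mathcal G_H:T\cap\overline S\ne\emptyset\}$, $\mathsf N^1(S):=\mathsf N(S)$, $\mathsf N^m(S):=\mathsf N(\mathsf N^{m-1}(S))$. $C_{\mathrm{ol},m}$ is a bound (polynomial in $m$) with $\max_{T}\operatorname{card}\{K\in\mathcal G_H:K\subseteq\overline{\mathsf N^m(T)}\}\le C_{\mathrm{ol},m}$, and $C_{\mathrm{ol}}:=C_{\mathrm{ol},1}$. $Q_1(\mathcal G)$ denotes piecewise polynomials of partial degree $\le1$; $\mathcal S^1(\mathcal G):=C^0(\Omega)\cap Q_1(\mathcal G)$; $V_H:=\mathcal S^1(\mathcal G_H)\cap V$. $\mathcal N_H$ is the set of vertices of $\mathcal G_H$ not on $\Gamma_D$, and $\Lambda_z\in V_H$, $z\in\mathcal N_H$, are the nodal basis functions. $\mathcal G_h$ is a global uniform refinement of $\mathcal G_H$ with mesh-size $h$, and $V_h:=\mathcal S^1(\mathcal G_h)\cap V$. Quasi-interpolation. $I_H:V\to V_H$ is a fixed surjective linear projection ($I_H\circ I_H=I_H$) with $H^{-1}\|v-I_Hv\|_{L^2(T)}+\|\nabla I_Hv\|_{L^2(T)}\le C_{I_H}\|\nabla v\|_{L^2(\mathsf N(T))}$ for all $T\in\mathcal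 G_H$, $v\in V$. For $\kappa H\lesssim1$ it is stable: $\|I_Hv\|_V\le C_{I_H,V}\|v\|_V$ for all $v\in V$, with $C_{I_H,V}$ independent of $\kappa$. Correctors. $W_h:=\{v\in V_h:I_Hv=0\}$. For a positive integer $m$ (oversampling parameter) and $T\in\mathcal G_H$ put $\Omega_T:=\mathsf N^m(T)$ and $W_h(\Omega_T):=\{v\in W_h: v=0\text{ outside }\Omega_T\}$. The forms $a_{\Omega_T}$ and $a_T$ are defined like $a$ with $\Omega$ replaced by $\Omega_T$, resp. $T$, and $\Gamma_R$ by $\Gamma_R\cap\partial\Omega_T$, resp. $\Gamma_R\cap\partial T$. For $v\in V_H$, $\mathcal C_{T,m}v\in W_h(\Omega_T)$ solves $a_{\Omega_T}(w,\mathcal C_{T,m}v)=a_T(w,v)$ for all $w\in W_h(\Omega_T)$; for $v\in V$, $\mathcal C_{T,\infty}v\in W_h$ solves $a(w,\mathcal C_{T,\infty}v)=a_T(w,v)$ for all $w\in W_h$ (these problems are uniquely solvable under the resolution condition). $\mathcal C_m:=\sum_{T\in\mathcal G_H}\mathcal C_{T,m}$, $\mathcal C_\infty:=\sum_{T\in\mathcal G_H}\mathcal C_{T,\infty}$. $C_{\mathcal C}\approx1$ is a constant with $\|\mathcal C_\infty v_H\|_V\le C_{\mathcal C}\|v_H\|_V$ for all $v_H\in V_H$. The test space is $\widetilde V_H:=\operatorname{span}\{\Lambda_z-\mathcal C_m\Lambda_z:z\in\mathcal N_H\}$. The constants $C_2\approx 1$ and $0<\beta<1$, independent of $H,h,m,\kappa$,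 are such that, under the resolution condition, $\|\nabla(\mathcal C_\infty v-\mathcal C_mv)\|_{L^2(\Omega)}\le C_2\sqrt{C_{\mathrm{ol},m}}\,\beta^m\|\nabla v\|_{L^2(\Omega)}$ for all $v\in V_H$ and $m\in\mathbb N$. *)

theory Defs
  imports "HOL-Analysis.Analysis"
begin

section \<open>Lebesgue and Hausdorff measure, \<open>L\<^sup>2\<close>\<close>

definition hausdorff_pre :: "nat \<Rightarrow> real \<Rightarrow> 'a::euclidean_space set \<Rightarrow> ennreal" where
  "hausdorff_pre s \<delta> A =
     (INF E\<in>{E :: nat \<Rightarrow> 'a set. A \<subseteq> (\<Union>i. E i) \<and> (\<forall>i. bounded (E i) \<and> diameter (E i) \<le> \<delta>)}.
        \<Sum>i. ennreal (if E i = {} then 0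
                     else unit_ball_vol (real s) * (diameter (E i) / 2) ^ s))"

text \<open>The factor \<open>unit_ball_vol s / 2 ^ s\<close> makes the \<open>s\<close>-dimensional measure agree with the usual
  surface area; for \<open>s = 0\<close> the measure is counting measure (\<open>0 ^ 0 = 1\<close>, empty sets have weight
  \<open>0\<close>).\<close>

definition hausdorff_measure :: "nat \<Rightarrow> 'a::euclidean_space measure" where
  "hausdorff_measure s =
     measure_of UNIV (sets borel) (\<lambda>A. SUP \<delta>\<in>{0<..}. hausdorff_pre s \<delta> A)"

definition surface :: "'a::euclidean_space set \<Rightarrow> 'a measure" where
  "surface \<Gamma> = restrict_space (hausdorff_measure (DIM('a) - 1)) \<Gamma>"

definition L2 :: "'a measure \<Rightarrow> ('a \<Rightarrow> complex) set" where
  "L2 M = {f \<in> borel_measurable M. integrable M (\<lambda>x. (cmod (f x))\<^sup>2)}"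

definition L2_inner :: "'a measure \<Rightarrow> ('a \<Rightarrow> complex) \<Rightarrow> ('a \<Rightarrow> complex) \<Rightarrow> complex" where
  "L2_inner M f g = (\<integral>x. f x * cnj (g x) \<partial>M)"

definition L2_norm :: "'a measure \<Rightarrow> ('a \<Rightarrow> complex) \<Rightarrow> real" where
  "L2_norm M f = sqrt (\<integral>x. (cmod (f x))\<^sup>2 \<partial>M)"


section \<open>Weak derivatives and the Sobolev space \<open>W\<^sup>1\<^sup>,\<^sup>2(\<Omega>; \<complex>)\<close>\<close>

fun C_k :: "nat \<Rightarrow> ('a::euclidean_space \<Rightarrow> real) \<Rightarrow> bool" where
  "C_k 0 f \<longleftrightarrow> continuous_on UNIV f"
| "C_k (Suc n) f \<longleftrightarrow>
     (\<forall>x. f differentiable (at x)) \<and> (\<forall>b\<in>Basis. C_k n (\<lambda>x. frechet_derivative f (at x) b))"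

definition test_function :: "'a::euclidean_space set \<Rightarrow> ('a \<Rightarrow> real) \<Rightarrow> bool" where
  "test_function \<Omega> \<phi> \<longleftrightarrow>
     (\<forall>n. C_k n \<phi>) \<and> compact (closure {x. \<phi> x \<noteq> 0}) \<and> closure {x. \<phi> x \<noteq> 0} \<subseteq> \<Omega>"

definition weak_partial ::
    "'a::euclidean_space set \<Rightarrow> 'a \<Rightarrow> ('a \<Rightarrow> complex) \<Rightarrow> ('a \<Rightarrow> complex) \<Rightarrow> bool" where
  "weak_partial \<Omega> b v g \<longleftrightarrow>
     (\<forall>\<phi>. test_function \<Omega> \<phi> \<longrightarrow>
        (\<integral>x. v x * of_real (frechet_derivative \<phi> (at x) b) \<partial>lebesgue_on \<Omega>) =
        - (\<integral>x. g x * of_real (\<phi> x) \<partial>lebesgue_on \<Omega>))"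

text \<open>Sobolev functions are represented by functions on the whole space; only their values almost
  everywhere in \<open>\<Omega>\<close> matter. Accordingly, equality in the space is equality almost everywhere in
  \<open>\<Omega>\<close> (\<open>eq_on_dom\<close>), and the norms below are seminorms on representatives.\<close>

definition W12 :: "'a::euclidean_space set \<Rightarrow> ('a \<Rightarrow> complex) set" where
  "W12 \<Omega> = {v \<in> L2 (lebesgue_on \<Omega>).
     \<forall>b\<in>Basis. \<exists>g\<in>L2 (lebesgue_on \<Omega>). weak_partial \<Omega> b v g}"

definition eq_on_dom :: "'a::euclidean_space set \<Rightarrow> ('a \<Rightarrow> complex) \<Rightarrow> ('a \<Rightarrow> complex) \<Rightarrow> bool" where
  "eq_on_dom \<Omega> v w \<longleftrightarrow> (AE x in lebesgue_on \<Omega>. v x = w x)"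

text \<open>Component \<open>b\<close> of the weak gradient, unique up to null sets.\<close>

definition wgrad :: "'a::euclidean_space set \<Rightarrow> ('a \<Rightarrow> complex) \<Rightarrow> 'a \<Rightarrow> 'a \<Rightarrow> complex" where
  "wgrad \<Omega> v b = (SOME g. g \<in> L2 (lebesgue_on \<Omega>) \<and> weak_partial \<Omega> b v g)"

definition grad_inner ::
    "'a::euclidean_space set \<Rightarrow> 'a set \<Rightarrow> ('a \<Rightarrow> complex) \<Rightarrow> ('a \<Rightarrow> complex) \<Rightarrow> complex" where
  "grad_inner \<Omega> \<omega> v w = (\<Sum>b\<in>Basis. L2_inner (lebesgue_on \<omega>) (wgrad \<Omega> v b) (wgrad \<Omega> w b))"

definition grad_norm :: "'a::euclidean_space set \<Rightarrow> 'a set \<Rightarrow> ('a \<Rightarrow> complex) \<Rightarrow> real" where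
  "grad_norm \<Omega> \<omega> v = sqrt (\<Sum>b\<in>Basis. (L2_norm (lebesgue_on \<omega>) (wgrad \<Omega> v b))\<^sup>2)"

text \<open>The trace operator of \<open>\<Omega>\<close>: the bounded linear operator from \<open>W\<^sup>1\<^sup>,\<^sup>2(\<Omega>)\<close> to \<open>L\<^sup>2(\<partial>\<Omega>)\<close> that
  is the restriction to the boundary for functions continuous up to the boundary. On a bounded
  Lipschitz domain it exists and is unique (up to null sets).\<close>

definition trace_operator ::
    "'a::euclidean_space set \<Rightarrow> (('a \<Rightarrow> complex) \<Rightarrow> ('a \<Rightarrow> complex)) \<Rightarrow> bool" where
  "trace_operator \<Omega> tr \<longleftrightarrow>
     (\<forall>v\<in>W12 \<Omega>. tr v \<in> L2 (surface (frontier \<Omega>))) \<and>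
     (\<forall>u\<in>W12 \<Omega>. \<forall>v\<in>W12 \<Omega>. \<forall>c::complex.
        AE x in surface (frontier \<Omega>). tr (\<lambda>y. u y + c * v y) x = tr u x + c * tr v x) \<and>
     (\<exists>K. \<forall>v\<in>W12 \<Omega>. L2_norm (surface (frontier \<Omega>)) (tr v) \<le>
        K * sqrt ((L2_norm (lebesgue_on \<Omega>) v)\<^sup>2 + (grad_norm \<Omega> \<Omega> v)\<^sup>2)) \<and>
     (\<forall>v\<in>W12 \<Omega>. continuous_on (closure \<Omega>) v \<longrightarrow>
        (AE x in surface (frontier \<Omega>). tr v x = v x))"


section \<open>The domain and the Helmholtz problem\<close>

text \<open>Near each boundary point the domain is the strict epigraph, in some direction \<open>e\<close>, of a
  Lipschitz function of the component orthogonal to \<open>e\<close>.\<close>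

definition lipschitz_domain :: "'a::euclidean_space set \<Rightarrow> bool" where
  "lipschitz_domain \<Omega> \<longleftrightarrow> open \<Omega> \<and> connected \<Omega> \<and> bounded \<Omega> \<and> \<Omega> \<noteq> {} \<and>
     (\<forall>p\<in>frontier \<Omega>. \<exists>U e L. \<exists>\<phi>::'a \<Rightarrow> real.
        open U \<and> p \<in> U \<and> norm e = 1 \<and> L-lipschitz_on UNIV \<phi> \<and>
        \<Omega> \<inter> U = {x\<in>U. \<phi> (x - (x \<bullet> e) *\<^sub>R e) < x \<bullet> e})"

definition polyhedral :: "'a::euclidean_space set \<Rightarrow> bool" where
  "polyhedral \<Omega> \<longleftrightarrow> (\<exists>\<P>. finite \<P> \<and> (\<forall>P\<in>\<P>. polytope P) \<and> closure \<Omega> = \<Union>\<P>)"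

definition V_space ::
    "'a::euclidean_space set \<Rightarrow> 'a set \<Rightarrow> (('a \<Rightarrow> complex) \<Rightarrow> ('a \<Rightarrow> complex)) \<Rightarrow>
     ('a \<Rightarrow> complex) set" where
  "V_space \<Omega> \<Gamma>D tr = {v \<in> W12 \<Omega>. AE x in surface \<Gamma>D. tr v x = 0}"

definition V_norm :: "'a::euclidean_space set \<Rightarrow> real \<Rightarrow> ('a \<Rightarrow> complex) \<Rightarrow> real" where
  "V_norm \<Omega> \<kappa> v = sqrt (\<kappa>\<^sup>2 * (L2_norm (lebesgue_on \<Omega>) v)\<^sup>2 + (grad_norm \<Omega> \<Omega> v)\<^sup>2)"

text \<open>The form on a subdomain \<open>\<omega>\<close> with boundary part \<open>\<Gamma>R \<inter> \<partial>\<omega>\<close>; \<open>\<omega> = \<Omega>\<close> gives the form of the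
  Helmholtz problem.\<close>

definition a_form ::
    "'a::euclidean_space set \<Rightarrow> 'a set \<Rightarrow> (('a \<Rightarrow> complex) \<Rightarrow> ('a \<Rightarrow> complex)) \<Rightarrow> real \<Rightarrow> 'a set \<Rightarrow>
     ('a \<Rightarrow> complex) \<Rightarrow> ('a \<Rightarrow> complex) \<Rightarrow> complex" where
  "a_form \<Omega> \<Gamma>R tr \<kappa> \<omega> v w =
     grad_inner \<Omega> \<omega> v w - of_real (\<kappa>\<^sup>2) * L2_inner (lebesgue_on \<omega>) v w
     - \<i> * of_real \<kappa> * L2_inner (surface (\<Gamma>R \<inter> frontier \<omega>)) (tr v) (tr w)"

definition load ::
    "'a::euclidean_space set \<Rightarrow> 'a set \<Rightarrow> (('a \<Rightarrow> complex) \<Rightarrow> ('a \<Rightarrow> complex)) \<Rightarrow>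
     ('a \<Rightarrow> complex) \<Rightarrow> ('a \<Rightarrow> complex) \<Rightarrow> ('a \<Rightarrow> complex) \<Rightarrow> complex" where
  "load \<Omega> \<Gamma>R tr f g v = L2_inner (lebesgue_on \<Omega>) f v + L2_inner (surface \<Gamma>R) g (tr v)"

text \<open>Extended reals give the infimum over the empty set, which occurs for \<open>X = {0}\<close>, its usual
  value.\<close>

definition inf_sup ::
    "'a::euclidean_space set \<Rightarrow> 'a set \<Rightarrow> (('a \<Rightarrow> complex) \<Rightarrow> ('a \<Rightarrow> complex)) \<Rightarrow> real \<Rightarrow>
     ('a \<Rightarrow> complex) set \<Rightarrow> ereal" where
  "inf_sup \<Omega> \<Gamma>R tr \<kappa> X =
     (INF v\<in>{v\<in>X. \<not> eq_on_dom \<Omega> v (\<lambda>_. 0)}. SUP w\<in>{w\<in>X. \<not> eq_on_dom \<Omega> w (\<lambda>_. 0)}.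
        ereal (Re (a_form \<Omega> \<Gamma>R tr \<kappa> \<Omega> v w) / (V_norm \<Omega> \<kappa> v * V_norm \<Omega> \<kappa> w)))"


section \<open>Meshes and finite element spaces\<close>

text \<open>A parallelepiped (interval, parallelogram) is described by a reference map
  \<open>x \<mapsto> p + F x\<close> from the unit cube onto it.\<close>

definition ref_map :: "'a::euclidean_space \<Rightarrow> ('a \<Rightarrow> 'a) \<Rightarrow> 'a set \<Rightarrow> bool" where
  "ref_map p F T \<longleftrightarrow> linear F \<and> inj F \<and> T = (\<lambda>x. p + F x) ` cbox 0 One"

definition mesh_size :: "'a::euclidean_space set set \<Rightarrow> real" where
  "mesh_size \<G> = Max (diameter ` \<G>)"

text \<open>Conforming partition of \<open>\<Omega>\<close> with shape-regularity constant \<open>\<rho>\<close> and quasi-uniformity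
  constant \<open>\<theta>\<close>.\<close>

definition mesh :: "'a::euclidean_space set \<Rightarrow> real \<Rightarrow> real \<Rightarrow> 'a set set \<Rightarrow> bool" where
  "mesh \<Omega> \<rho> \<theta> \<G> \<longleftrightarrow>
     finite \<G> \<and> (\<forall>T\<in>\<G>. \<exists>p F. ref_map p F T) \<and> \<Union>\<G> = closure \<Omega> \<and>
     (\<forall>T\<in>\<G>. \<forall>K\<in>\<G>. (T \<inter> K) face_of T \<and> (T \<inter> K) face_of K) \<and>
     (\<forall>T\<in>\<G>. \<exists>x. ball x (diameter T / \<rho>) \<subseteq> T) \<and>
     (\<forall>T\<in>\<G>. mesh_size \<G> \<le> \<theta> * diameter T)"

text \<open>Every cell is divided into \<open>n ^ d\<close> congruent cells.\<close>

definition uniform_refinement :: "nat \<Rightarrow> 'a::euclidean_space set set \<Rightarrow> 'a set set" where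
  "uniform_refinement n \<G> =
     {(\<lambda>x. p + F x) ` cbox (\<Sum>b\<in>Basis. (real (k b) / real n) *\<^sub>R b)
                           (\<Sum>b\<in>Basis. (real (k b + 1) / real n) *\<^sub>R b) | p F k T.
        T \<in> \<G> \<and> ref_map p F T \<and> (\<forall>b\<in>Basis. k b < n)}"

definition nbhd :: "'a::euclidean_space set set \<Rightarrow> 'a set \<Rightarrow> 'a set" where
  "nbhd \<G> S = interior (\<Union>{T\<in>\<G>. T \<inter> closure S \<noteq> {}})"

definition patch :: "'a::euclidean_space set set \<Rightarrow> nat \<Rightarrow> 'a set \<Rightarrow> 'a set" where
  "patch \<G> m S = (nbhd \<G> ^^ m) S"

definition overlap_bound :: "'a::euclidean_space set set \<Rightarrow> (nat \<Rightarrow> real) \<Rightarrow> bool" where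
  "overlap_bound \<G> Col \<longleftrightarrow>
     (\<forall>m\<ge>1. \<forall>T\<in>\<G>. real (card {K\<in>\<G>. K \<subseteq> closure (patch \<G> m T)}) \<le> Col m)"

text \<open>On a parallelepiped, partial degrees refer to the coordinates along its edges, i.e. to the
  reference coordinates. The choice of the reference map does not matter, as two of them differ by
  a symmetry of the cube.\<close>

definition Q1_on :: "'a::euclidean_space set \<Rightarrow> ('a \<Rightarrow> complex) \<Rightarrow> bool" where
  "Q1_on T v \<longleftrightarrow>
     (\<exists>p F. \<exists>c :: 'a set \<Rightarrow> complex. ref_map p F T \<and>
        (\<forall>x\<in>cbox 0 One. v (p + F x) = (\<Sum>S\<in>Pow Basis. c S * of_real (\<Prod>b\<in>S. x \<bullet> b))))"

text \<open>Continuous piecewise \<open>Q\<^sub>1\<close> functions are represented by their continuous extension to the closed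
  domain, so that nodal values at boundary vertices make sense.\<close>

definition S1 :: "'a::euclidean_space set \<Rightarrow> 'a set set \<Rightarrow> ('a \<Rightarrow> complex) set" where
  "S1 \<Omega> \<G> = {v. continuous_on (closure \<Omega>) v \<and> (\<forall>T\<in>\<G>. Q1_on T v)}"

definition fe_space ::
    "'a::euclidean_space set \<Rightarrow> 'a set \<Rightarrow> (('a \<Rightarrow> complex) \<Rightarrow> ('a \<Rightarrow> complex)) \<Rightarrow> 'a set set \<Rightarrow>
     ('a \<Rightarrow> complex) set" where
  "fe_space \<Omega> \<Gamma>D tr \<G> = S1 \<Omega> \<G> \<inter> V_space \<Omega> \<Gamma>D tr"

definition vertices :: "'a::euclidean_space set set \<Rightarrow> 'a set" where
  "vertices \<G> = {z. \<exists>T\<in>\<G>. z extreme_point_of T}"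

text \<open>\<open>\<Lambda> z\<close>, for the vertices \<open>z\<close> not on \<open>\<Gamma>D\<close>, is the basis of the finite element space consisting of
  the nodal (hat) functions. Linear independence is implied by the nodal values.\<close>

definition nodal_basis ::
    "'a::euclidean_space set \<Rightarrow> 'a set \<Rightarrow> (('a \<Rightarrow> complex) \<Rightarrow> ('a \<Rightarrow> complex)) \<Rightarrow> 'a set set \<Rightarrow>
     ('a \<Rightarrow> 'a \<Rightarrow> complex) \<Rightarrow> bool" where
  "nodal_basis \<Omega> \<Gamma>D tr \<G> \<Lambda> \<longleftrightarrow>
     (\<forall>z\<in>vertices \<G> - \<Gamma>D. \<Lambda> z \<in> fe_space \<Omega> \<Gamma>D tr \<G> \<and>
        (\<forall>y\<in>vertices \<G>. \<Lambda> z y = (if y = z then 1 else 0))) \<and>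
     (\<forall>v\<in>fe_space \<Omega> \<Gamma>D tr \<G>. \<exists>c. eq_on_dom \<Omega> v (\<lambda>x. \<Sum>z\<in>vertices \<G> - \<Gamma>D. c z * \<Lambda> z x))"

definition quasi_interpolation ::
    "'a::euclidean_space set \<Rightarrow> 'a set \<Rightarrow> (('a \<Rightarrow> complex) \<Rightarrow> ('a \<Rightarrow> complex)) \<Rightarrow> 'a set set \<Rightarrow> real \<Rightarrow>
     (('a \<Rightarrow> complex) \<Rightarrow> ('a \<Rightarrow> complex)) \<Rightarrow> bool" where
  "quasi_interpolation \<Omega> \<Gamma>D tr \<G> CIH I \<longleftrightarrow>
     (\<forall>v\<in>V_space \<Omega> \<Gamma>D tr. I v \<in> fe_space \<Omega> \<Gamma>D tr \<G>) \<and>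
     (\<forall>u\<in>V_space \<Omega> \<Gamma>D tr. \<forall>v\<in>V_space \<Omega> \<Gamma>D tr. \<forall>c::complex.
        eq_on_dom \<Omega> (I (\<lambda>x. u x + c * v x)) (\<lambda>x. I u x + c * I v x)) \<and>
     (\<forall>v\<in>fe_space \<Omega> \<Gamma>D tr \<G>. \<exists>u\<in>V_space \<Omega> \<Gamma>D tr. eq_on_dom \<Omega> (I u) v) \<and>
     (\<forall>v\<in>V_space \<Omega> \<Gamma>D tr. eq_on_dom \<Omega> (I (I v)) (I v)) \<and>
     (\<forall>T\<in>\<G>. \<forall>v\<in>V_space \<Omega> \<Gamma>D tr.
        L2_norm (lebesgue_on T) (\<lambda>x. v x - I v x) / mesh_size \<G> + grad_norm \<Omega> T (I v)
          \<le> CIH * grad_norm \<Omega> (nbhd \<G> T) v)"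


section \<open>Correctors and test space\<close>

text \<open>Here \<open>\<G>\<close> and \<open>\<G>h\<close> are the coarse and the fine mesh.\<close>

definition W_fine ::
    "'a::euclidean_space set \<Rightarrow> 'a set \<Rightarrow> (('a \<Rightarrow> complex) \<Rightarrow> ('a \<Rightarrow> complex)) \<Rightarrow> 'a set set \<Rightarrow>
     (('a \<Rightarrow> complex) \<Rightarrow> ('a \<Rightarrow> complex)) \<Rightarrow> ('a \<Rightarrow> complex) set" where
  "W_fine \<Omega> \<Gamma>D tr \<G>h I = {v \<in> fe_space \<Omega> \<Gamma>D tr \<G>h. eq_on_dom \<Omega> (I v) (\<lambda>_. 0)}"

definition W_fine_on ::
    "'a::euclidean_space set \<Rightarrow> 'a set \<Rightarrow> (('a \<Rightarrow> complex) \<Rightarrow> ('a \<Rightarrow> complex)) \<Rightarrow> 'a set set \<Rightarrow>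
     (('a \<Rightarrow> complex) \<Rightarrow> ('a \<Rightarrow> complex)) \<Rightarrow> 'a set \<Rightarrow> ('a \<Rightarrow> complex) set" where
  "W_fine_on \<Omega> \<Gamma>D tr \<G>h I \<omega> = {v \<in> W_fine \<Omega> \<Gamma>D tr \<G>h I. \<forall>x\<in>\<Omega> - \<omega>. v x = 0}"

definition local_correctors ::
    "'a::euclidean_space set \<Rightarrow> 'a set \<Rightarrow> 'a set \<Rightarrow> (('a \<Rightarrow> complex) \<Rightarrow> ('a \<Rightarrow> complex)) \<Rightarrow> real \<Rightarrow>
     'a set set \<Rightarrow> 'a set set \<Rightarrow> (('a \<Rightarrow> complex) \<Rightarrow> ('a \<Rightarrow> complex)) \<Rightarrow> nat \<Rightarrow>
     ('a set \<Rightarrow> ('a \<Rightarrow> complex) \<Rightarrow> ('a \<Rightarrow> complex)) \<Rightarrow> bool" where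
  "local_correctors \<Omega> \<Gamma>D \<Gamma>R tr \<kappa> \<G> \<G>h I m CT \<longleftrightarrow>
     (\<forall>T\<in>\<G>. \<forall>v\<in>fe_space \<Omega> \<Gamma>D tr \<G>.
        CT T v \<in> W_fine_on \<Omega> \<Gamma>D tr \<G>h I (patch \<G> m T) \<and>
        (\<forall>w\<in>W_fine_on \<Omega> \<Gamma>D tr \<G>h I (patch \<G> m T).
           a_form \<Omega> \<Gamma>R tr \<kappa> (patch \<G> m T) w (CT T v) = a_form \<Omega> \<Gamma>R tr \<kappa> T w v))"

definition ideal_correctors ::
    "'a::euclidean_space set \<Rightarrow> 'a set \<Rightarrow> 'a set \<Rightarrow> (('a \<Rightarrow> complex) \<Rightarrow> ('a \<Rightarrow> complex)) \<Rightarrow> real \<Rightarrow>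
     'a set set \<Rightarrow> 'a set set \<Rightarrow> (('a \<Rightarrow> complex) \<Rightarrow> ('a \<Rightarrow> complex)) \<Rightarrow>
     ('a set \<Rightarrow> ('a \<Rightarrow> complex) \<Rightarrow> ('a \<Rightarrow> complex)) \<Rightarrow> bool" where
  "ideal_correctors \<Omega> \<Gamma>D \<Gamma>R tr \<kappa> \<G> \<G>h I CT \<longleftrightarrow>
     (\<forall>T\<in>\<G>. \<forall>v\<in>V_space \<Omega> \<Gamma>D tr.
        CT T v \<in> W_fine \<Omega> \<Gamma>D tr \<G>h I \<and>
        (\<forall>w\<in>W_fine \<Omega> \<Gamma>D tr \<G>h I.
           a_form \<Omega> \<Gamma>R tr \<kappa> \<Omega> w (CT T v) = a_form \<Omega> \<Gamma>R tr \<kappa> T w v))"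

definition corrector_sum ::
    "'a set set \<Rightarrow> ('a set \<Rightarrow> ('a \<Rightarrow> complex) \<Rightarrow> ('a \<Rightarrow> complex)) \<Rightarrow>
     ('a \<Rightarrow> complex) \<Rightarrow> ('a \<Rightarrow> complex)" where
  "corrector_sum \<G> CT v = (\<lambda>x. \<Sum>T\<in>\<G>. CT T v x)"

text \<open>The complex span of \<open>\<Lambda> z - C (\<Lambda> z)\<close> over the (finitely many) vertices \<open>z\<close> not on \<open>\<Gamma>D\<close>.\<close>

definition test_space ::
    "'a::euclidean_space set \<Rightarrow> 'a set set \<Rightarrow> ('a \<Rightarrow> 'a \<Rightarrow> complex) \<Rightarrow>
     (('a \<Rightarrow> complex) \<Rightarrow> ('a \<Rightarrow> complex)) \<Rightarrow> ('a \<Rightarrow> complex) set" where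
  "test_space \<Gamma>D \<G> \<Lambda> C =
     {(\<lambda>x. \<Sum>z\<in>vertices \<G> - \<Gamma>D. c z * (\<Lambda> z x - C (\<Lambda> z) x)) | c. True}"

end

theory Submission
  imports Defs "HOL-Real_Asymp.Real_Asymp"
begin

text \<open>
  The fine part \<open>w\<^sub>0 = u\<^sub>h - I\<^sub>H u\<^sub>h\<close> of the Galerkin solution lies in the kernel \<open>W\<^sub>h\<close> of the quasi-interpolation,
  on which the form is coercive by the resolution condition. Subtract from \<open>e\<^sub>H = I\<^sub>H u\<^sub>h - u\<^sub>H\<close> the element
  \<open>z\<close> of \<open>W\<^sub>h\<close> that makes \<open>e\<^sub>H - z\<close> orthogonal to \<open>W\<^sub>h\<close>. Since \<open>v - C\<^sub>\<infinity> v\<close> is orthogonal to \<open>W\<^sub>h\<close> on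
  the other side, \<open>a (e\<^sub>H - z) v = - a (w\<^sub>0 + e\<^sub>H) (C\<^sub>\<infinity> I\<^sub>H v - C\<^sub>m I\<^sub>H v)\<close> for all \<open>v\<close> of the fine space, which is
  exponentially small in \<open>m\<close>. The discrete inf-sup condition and the first oversampling condition
  give \<open>\<parallel>e\<^sub>H\<parallel> \<le> (\<parallel>w\<^sub>0\<parallel> + \<parallel>e\<^sub>H\<parallel>) / 2\<close>.
\<close>

section \<open>Sesquilinear forms on spaces of functions\<close>

text \<open>Why \<open>z\<close> is subtracted: the inf-sup condition tests with every fine
  function, whereas the Petrov-Galerkin equation controls only corrected coarse ones. Against e_H -
  z the uncontrolled kernel part of a test function contributes nothing, and the interpolation
  recovers e_H from e_H - z at the price of the factor \<open>CIHV\<close>. All functions are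
  representatives. \<open>V_norm\<close> is therefore a seminorm, and \<open>wgrad\<close>,
  \<open>tr\<close>, \<open>I\<close> and the correctors are linear at best almost everywhere;
  uniqueness means uniqueness up to functions of norm 0, and each operator must first be shown not
  to see those. Existence of \<open>z\<close> and of the best approximation rests on finitely many
  nodal values that determine a fine function. Most of the geometry serves one identity: adding up
  the ideal corrector problems requires the form to be the sum of its cell contributions. For the
  boundary term this means that two cells meet on the boundary of the domain only in a null set of
  the surface measure.\<close>

definition fun_subspace :: "('a \<Rightarrow> complex) set \<Rightarrow> bool" where
  "fun_subspace W \<longleftrightarrow> (\<lambda>_. 0) \<in> W \<and> (\<forall>u\<in>W. \<forall>v\<in>W. \<forall>c. (\<lambda>x. u x + c * v x) \<in> W)"

definition sesquilinear_on ::
    "('a \<Rightarrow> complex) set \<Rightarrow> (('a \<Rightarrow> complex) \<Rightarrow> ('a \<Rightarrow> complex) \<Rightarrow> complex) \<Rightarrow> bool" where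
  "sesquilinear_on W B \<longleftrightarrow> (\<forall>u\<in>W. \<forall>v\<in>W. \<forall>w\<in>W. \<forall>c.
     B (\<lambda>x. u x + c * v x) w = B u w + c * B v w \<and>
     B w (\<lambda>x. u x + c * v x) = B w u + cnj c * B w v)"

definition seminorm_on :: "('a \<Rightarrow> complex) set \<Rightarrow> (('a \<Rightarrow> complex) \<Rightarrow> real) \<Rightarrow> bool" where
  "seminorm_on W N \<longleftrightarrow> (\<forall>u\<in>W. 0 \<le> N u) \<and>
     (\<forall>u\<in>W. \<forall>v\<in>W. \<forall>c. N (\<lambda>x. u x + c * v x) \<le> N u + cmod c * N v)"

lemma
  assumes "fun_subspace W"
  shows fun_subspace_zero: "(\<lambda>_. 0) \<in> W"
    and fun_subspace_lin: "u \<in> W \<Longrightarrow> v \<in> W \<Longrightarrow> (\<lambda>x. u x + c * v x) \<in> W"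
    and fun_subspace_add: "u \<in> W \<Longrightarrow> v \<in> W \<Longrightarrow> (\<lambda>x. u x + v x) \<in> W"
    and fun_subspace_diff: "u \<in> W \<Longrightarrow> v \<in> W \<Longrightarrow> (\<lambda>x. u x - v x) \<in> W"
proof -
  show z: "(\<lambda>_. 0) \<in> W" and l: "\<And>u v c. u \<in> W \<Longrightarrow> v \<in> W \<Longrightarrow> (\<lambda>x. u x + c * v x) \<in> W"
    using assms unfolding fun_subspace_def by blast+
  show "u \<in> W \<Longrightarrow> v \<in> W \<Longrightarrow> (\<lambda>x. u x + v x) \<in> W" using l[of u v 1] by simp
  show "u \<in> W \<Longrightarrow> v \<in> W \<Longrightarrow> (\<lambda>x. u x - v x) \<in> W" using l[of u v "-1"] by simp
qed

lemma fun_subspace_sum: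
  assumes "fun_subspace W" "\<And>i. i \<in> J \<Longrightarrow> u i \<in> W"
  shows "(\<lambda>x. \<Sum>i\<in>J. c i * u i x) \<in> W"
  using assms(2)
proof (induction J rule: infinite_finite_induct)
  case (insert j J)
  then show ?case
    using fun_subspace_lin[OF assms(1), of "\<lambda>x. \<Sum>i\<in>J. c i * u i x" "u j" "c j"]
    by (simp add: add.commute)
qed (use fun_subspace_zero[OF assms(1)] in auto)

lemma
  assumes "sesquilinear_on W B"
  shows sesquilinear_on_left: "u \<in> W \<Longrightarrow> v \<in> W \<Longrightarrow> w \<in> W \<Longrightarrow>
      B (\<lambda>x. u x + c * v x) w = B u w + c * B v w"
    and sesquilinear_on_right: "u \<in> W \<Longrightarrow> v \<in> W \<Longrightarrow> w \<in> W \<Longrightarrow>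
      B w (\<lambda>x. u x + c * v x) = B w u + cnj c * B w v"
    and sesquilinear_on_add_left: "u \<in> W \<Longrightarrow> v \<in> W \<Longrightarrow> w \<in> W \<Longrightarrow>
      B (\<lambda>x. u x + v x) w = B u w + B v w"
    and sesquilinear_on_add_right: "u \<in> W \<Longrightarrow> v \<in> W \<Longrightarrow> w \<in> W \<Longrightarrow>
      B w (\<lambda>x. u x + v x) = B w u + B w v"
    and sesquilinear_on_diff_left: "u \<in> W \<Longrightarrow> v \<in> W \<Longrightarrow> w \<in> W \<Longrightarrow>
      B (\<lambda>x. u x - v x) w = B u w - B v w"
    and sesquilinear_on_diff_right: "u \<in> W \<Longrightarrow> v \<in> W \<Longrightarrow> w \<in> W \<Longrightarrow>
      B w (\<lambda>x. u x - v x) = B w u - B w v"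
proof -
  show l: "\<And>u v w c. u \<in> W \<Longrightarrow> v \<in> W \<Longrightarrow> w \<in> W \<Longrightarrow> B (\<lambda>x. u x + c * v x) w = B u w + c * B v w"
    and r: "\<And>u v w c. u \<in> W \<Longrightarrow> v \<in> W \<Longrightarrow> w \<in> W \<Longrightarrow>
      B w (\<lambda>x. u x + c * v x) = B w u + cnj c * B w v"
    using assms unfolding sesquilinear_on_def by blast+
  assume "u \<in> W" "v \<in> W" "w \<in> W"
  from l[OF this, of 1] l[OF this, of "-1"] r[OF this, of 1] r[OF this, of "-1"]
  show "B (\<lambda>x. u x + v x) w = B u w + B v w" "B (\<lambda>x. u x - v x) w = B u w - B v w"
    "B w (\<lambda>x. u x + v x) = B w u + B w v" "B w (\<lambda>x. u x - v x) = B w u - B w v"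
    by simp_all
qed

lemma sesquilinear_on_zero:
  assumes "sesquilinear_on W B" "fun_subspace W" "w \<in> W"
  shows "B (\<lambda>_. 0) w = 0" "B w (\<lambda>_. 0) = 0"
  using sesquilinear_on_diff_left[OF assms(1,3,3,3)] sesquilinear_on_diff_right[OF assms(1,3,3,3)]
  by simp_all

lemma sesquilinear_on_sum_right:
  assumes "sesquilinear_on W B" "fun_subspace W" "\<And>i. i \<in> J \<Longrightarrow> u i \<in> W" "w \<in> W"
  shows "B w (\<lambda>x. \<Sum>i\<in>J. c i * u i x) = (\<Sum>i\<in>J. cnj (c i) * B w (u i))"
  using assms(3)
proof (induction J rule: infinite_finite_induct)
  case (insert j J)
  have "B w (\<lambda>x. (\<Sum>i\<in>J. c i * u i x) + c j * u j x) =
      B w (\<lambda>x. \<Sum>i\<in>J. c i * u i x) + cnj (c j) * B w (u j)"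
  proof (rule sesquilinear_on_right[OF assms(1)])
    show "(\<lambda>x. \<Sum>i\<in>J. c i * u i x) \<in> W"
      using insert.prems by (intro fun_subspace_sum[OF assms(2)]) auto
  qed (use insert.prems assms(4) in auto)
  then show ?case using insert by (simp add: add.commute)
qed (use sesquilinear_on_zero[OF assms(1,2,4)] in auto)

lemma sesquilinear_on_subset: "sesquilinear_on V B \<Longrightarrow> W \<subseteq> V \<Longrightarrow> sesquilinear_on W B"
  unfolding sesquilinear_on_def by blast

lemma
  assumes "seminorm_on W N"
  shows seminorm_on_nonneg: "u \<in> W \<Longrightarrow> 0 \<le> N u"
    and seminorm_on_add: "u \<in> W \<Longrightarrow> v \<in> W \<Longrightarrow> N (\<lambda>x. u x + v x) \<le> N u + N v"
    and seminorm_on_diff: "u \<in> W \<Longrightarrow> v \<in> W \<Longrightarrow> N (\<lambda>x. u x - v x) \<le> N u + N v"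
proof -
  show "u \<in> W \<Longrightarrow> 0 \<le> N u"  using assms unfolding seminorm_on_def by blast
  assume "u \<in> W" "v \<in> W"
  then have "\<And>c. N (\<lambda>x. u x + c * v x) \<le> N u + cmod c * N v"
    using assms unfolding seminorm_on_def by blast
  from this[of 1] this[of "-1"]
  show "N (\<lambda>x. u x + v x) \<le> N u + N v" "N (\<lambda>x. u x - v x) \<le> N u + N v" by simp_all
qed

text \<open>Functions determined by their values on a finite set form a space of finite dimension.
  Elimination of one point at a time solves the linear system.\<close>

lemma galerkin_solvable:
  assumes "finite P" "fun_subspace W" "sesquilinear_on W B"
    and "\<And>w. w \<in> W \<Longrightarrow> \<forall>p\<in>P. w p = 0 \<Longrightarrow> B w w = 0"
    and "\<And>w v. w \<in> W \<Longrightarrow> v \<in> W \<Longrightarrow> B w w = 0 \<Longrightarrow> B w v = 0 \<and> B v w = 0"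
    and "\<And>w. w \<in> W \<Longrightarrow> B w w = 0 \<Longrightarrow> l w = 0"
    and "\<And>u v c. u \<in> W \<Longrightarrow> v \<in> W \<Longrightarrow> l (\<lambda>x. u x + c * v x) = l u + cnj c * l v"
  shows "\<exists>z\<in>W. \<forall>w\<in>W. B z w = l w"
  using assms
proof (induction P arbitrary: W l rule: finite_induct)
  case empty
  then show ?case using fun_subspace_zero sesquilinear_on_zero(1) by (metis empty_iff)
next
  case (insert p P W l)
  define W0 where "W0 = {w \<in> W. w p = 0}"
  have sub: "W0 \<subseteq> W" by (auto simp: W0_def)
  note fW = insert.prems(1) and sW = insert.prems(2)
  have f0: "fun_subspace W0"
    using fun_subspace_zero[OF fW] fun_subspace_lin[OF fW] by (simp add: fun_subspace_def W0_def)
  have s0: "sesquilinear_on W0 B" by (rule sesquilinear_on_subset[OF sW sub])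
  \<comment> \<open>The induction hypothesis is needed for two right-hand sides, \<open>l\<close>
    itself and \<open>B w1\<close>, hence the general \<open>l'\<close>.\<close>
  have solve: "\<exists>z\<in>W0. \<forall>w\<in>W0. B z w = l' w"
    if "\<And>w. w \<in> W \<Longrightarrow> B w w = 0 \<Longrightarrow> l' w = 0"
      "\<And>u v c. u \<in> W \<Longrightarrow> v \<in> W \<Longrightarrow> l' (\<lambda>x. u x + c * v x) = l' u + cnj c * l' v" for l'
  proof (rule insert.IH[OF f0 s0])
    show "B w w = 0" if "w \<in> W0" "\<forall>p\<in>P. w p = 0" for w
      using insert.prems(3)[of w] that by (simp add: W0_def)
    show "B w v = 0 \<and> B v w = 0" if "w \<in> W0" "v \<in> W0" "B w w = 0" for w v
      using insert.prems(4)[of w v] that by (simp add: W0_def)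
  qed (use that sub in blast)+
  obtain y where y: "y \<in> W0" "\<forall>w\<in>W0. B y w = l w" using solve[of l] insert.prems(5,6) by blast
  show ?case
  proof (cases "W0 = W")
    case True then show ?thesis using y by blast
  next
    case False
    then obtain w1 where w1: "w1 \<in> W" "w1 p \<noteq> 0" unfolding W0_def by blast
    \<comment> \<open>\<open>z\<close> is the Galerkin projection of \<open>w1\<close> to the
      functions vanishing at \<open>p\<close>. The difference \<open>q\<close> is orthogonal to all
      of these and, as \<open>q p = w1 p\<close> is nonzero, spans \<open>W\<close> together with
      \<open>W0\<close>.\<close>
    obtain z where z: "z \<in> W0" "\<forall>w\<in>W0. B z w = B w1 w"
      using solve[of "B w1"] insert.prems(4) w1 sesquilinear_on_right[OF sW] by blast
    define q where "q = (\<lambda>x. w1 x - z x)"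
    have q: "q \<in> W" unfolding q_def using w1 z sub fun_subspace_diff[OF fW] by blast
    have q0: "B q w = 0" if "w \<in> W0" for w
      unfolding q_def using sesquilinear_on_diff_left[OF sW] w1 z that sub by (metis right_minus_eq subsetD)
    \<comment> \<open>If \<open>B q q = 0\<close>, the quotient is 0 by convention. This is the
      right value: \<open>l q\<close> and \<open>B y q\<close> then vanish by the degeneracy
      assumptions.\<close>
    define t where "t = (l q - B y q) / B q q"
    have t: "l q = B y q + t * B q q"
      using insert.prems(4,5)[OF q] y sub unfolding t_def by (cases "B q q = 0") auto
    have "B (\<lambda>x. y x + t * q x) w = l w" if w: "w \<in> W" for w
    proof -
      define c where "c = w p / w1 p"
      define w' where "w' = (\<lambda>x. w x + (- c) * q x)"
      have w': "w' \<in> W" unfolding w'_def using fun_subspace_lin[OF fW w q] .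
      have "w' p = 0" using w1 z by (simp add: w'_def c_def q_def W0_def)
      then have w0: "w' \<in> W0" using w' by (simp add: W0_def)
      have w_eq: "w = (\<lambda>x. w' x + c * q x)" by (simp add: w'_def)
      have "B (\<lambda>x. y x + t * q x) w = B y w + t * B q w"
        by (rule sesquilinear_on_left[OF sW]) (use y q w sub in auto)
      also have "B y w = l w' + cnj c * B y q"
        by (subst w_eq, subst sesquilinear_on_right[OF sW]) (use y w' q sub w0 in auto)
      also have "B q w = cnj c * B q q"
        by (subst w_eq, subst sesquilinear_on_right[OF sW]) (use w' q w0 q0 in auto)
      also have "l w' + cnj c * B y q + t * (cnj c * B q q) = l w' + cnj c * l q"
        by (simp add: t algebra_simps)
      also have "\<dots> = l w" by (subst w_eq, subst insert.prems(6)) (use w' q in auto)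
      finally show ?thesis .
    qed
    moreover have "(\<lambda>x. y x + t * q x) \<in> W" using fun_subspace_lin[OF fW] y q sub by blast
    ultimately show ?thesis by blast
  qed
qed

text \<open>The error argument for an arbitrary form and seminorm. Coercivity on the kernel enters
  only qualitatively, to make the projection \<open>z\<close> exist; its quantitative part sits in
  \<open>\<eta>\<close>, the size of the truncation error of the correctors. \<open>split\<close> is
  the stability of the interpolation, which extracts the coarse part from the difference of a coarse
  and a kernel function. The inf-sup condition is stated for each \<open>c < \<alpha>\<close>
  because the supremum need not be attained.\<close>

lemma petrov_galerkin_quasi_optimal:
  fixes a :: "('a \<Rightarrow> complex) \<Rightarrow> ('a \<Rightarrow> complex) \<Rightarrow> complex" and N :: "('a \<Rightarrow> complex) \<Rightarrow> real"
  assumes V: "fun_subspace V" and Vh: "fun_subspace Vh" "Vh \<subseteq> V"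
    and VH: "fun_subspace VH" "VH \<subseteq> Vh"
    and a: "sesquilinear_on V a" "\<And>v w. v \<in> V \<Longrightarrow> w \<in> V \<Longrightarrow> cmod (a v w) \<le> Ca * N v * N w"
    and Ca: "Ca \<ge> 0"
    and N: "seminorm_on V N"
    and W: "fun_subspace W" "W \<subseteq> Vh"
    and I_in: "\<And>v. v \<in> Vh \<Longrightarrow> I v \<in> VH" and kern: "\<And>v. v \<in> Vh \<Longrightarrow> (\<lambda>x. v x - I v x) \<in> W"
    and split: "\<And>v w. v \<in> VH \<Longrightarrow> w \<in> W \<Longrightarrow> N v \<le> CI * N (\<lambda>x. v x - w x)" and CI: "CI \<ge> 0"
    and coercive: "\<And>w. w \<in> W \<Longrightarrow> a w w = 0 \<Longrightarrow> N w = 0"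
    and inf_sup: "\<And>v c. v \<in> Vh \<Longrightarrow> N v \<noteq> 0 \<Longrightarrow> c < \<alpha> \<Longrightarrow>
        \<exists>w\<in>Vh. N w \<noteq> 0 \<and> c * (N v * N w) \<le> Re (a v w)"
    and \<alpha>: "\<alpha> > 0"
    and P: "finite P" "\<And>w. w \<in> Vh \<Longrightarrow> \<forall>p\<in>P. w p = 0 \<Longrightarrow> N w = 0"
    and Cinf: "\<And>v. v \<in> VH \<Longrightarrow> Cinf v \<in> W" "\<And>v w. v \<in> VH \<Longrightarrow> w \<in> W \<Longrightarrow> a w (Cinf v) = a w v"
    and Cm: "\<And>v. v \<in> VH \<Longrightarrow> Cm v \<in> W"
        "\<And>v. v \<in> Vh \<Longrightarrow> N (\<lambda>x. Cinf (I v) x - Cm (I v) x) \<le> \<eta> * N v"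
    and small: "Ca * \<eta> * CI \<le> \<alpha> / 2" and \<eta>: "\<eta> \<ge> 0"
    and uH: "uH \<in> VH" and uh: "uh \<in> Vh"
    and orth: "\<And>v. v \<in> VH \<Longrightarrow> a (\<lambda>x. uh x - uH x) (\<lambda>x. v x - Cm v x) = 0"
  shows "N (\<lambda>x. uh x - uH x) \<le> 2 * N (\<lambda>x. uh x - I uh x)"
proof -
  have N0: "0 \<le> N u" if "u \<in> V" for u using seminorm_on_nonneg[OF N that] .
  have VHV: "v \<in> V" if "v \<in> VH" for v using that Vh VH by blast
  have WV: "w \<in> V" if "w \<in> W" for w using that Vh W by blast
  have aW: "sesquilinear_on W a" using a(1) WV by (meson sesquilinear_on_subset subsetI)
  have null: "a v w = 0 \<and> a w v = 0" if "v \<in> V" "w \<in> V" "N w = 0" for v w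
    using a(2)[OF that(1,2)] a(2)[OF that(2,1)] that(3) by simp
  define w0 where "w0 = (\<lambda>x. uh x - I uh x)"
  define eH where "eH = (\<lambda>x. I uh x - uH x)"
  have w0: "w0 \<in> W" unfolding w0_def using kern uh by blast
  have eH: "eH \<in> VH" unfolding eH_def using fun_subspace_diff[OF VH(1)] I_in uh uH by blast
  have "\<exists>z\<in>W. \<forall>w\<in>W. a z w = a eH w"
  proof (rule galerkin_solvable[OF P(1) W(1) aW])
    show "a w w = 0" if "w \<in> W" "\<forall>p\<in>P. w p = 0" for w
      using null[of w w] P(2) that WV W by blast
    show "a w v = 0 \<and> a v w = 0" if "w \<in> W" "v \<in> W" "a w w = 0" for w v
      using null[of v w] coercive that WV by blast
    show "a eH w = 0" if "w \<in> W" "a w w = 0" for w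
      using null[of eH w] coercive that WV VHV eH by blast
    show "a eH (\<lambda>x. u x + c * v x) = a eH u + cnj c * a eH v" if "u \<in> W" "v \<in> W" for u v c
      using sesquilinear_on_right[OF a(1)] that WV VHV eH by blast
  qed
  then obtain z where z: "z \<in> W" "\<And>w. w \<in> W \<Longrightarrow> a z w = a eH w" by blast
  define e where "e = (\<lambda>x. eH x - z x)"
  have eVh: "e \<in> Vh" unfolding e_def using fun_subspace_diff[OF Vh(1)] eH z VH W by blast
  have NeH: "N eH \<le> CI * N e" unfolding e_def by (rule split[OF eH z(1)])
  have key: "cmod (a e v) \<le> Ca * (N w0 + N eH) * (\<eta> * N v)" if v: "v \<in> Vh" for v
  proof -
    define vH where "vH = I v"
    have vH: "vH \<in> VH" unfolding vH_def using I_in v by blast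
    define d where "d = (\<lambda>x. Cinf vH x - Cm vH x)"
    define s where "s = (\<lambda>x. vH x - Cinf vH x)"
    have C: "Cinf vH \<in> W" "Cm vH \<in> W" using Cinf Cm vH by auto
    have CV: "Cinf vH \<in> V" "Cm vH \<in> V" "vH \<in> V" "v \<in> V" "w0 \<in> V" "eH \<in> V" "z \<in> V"
      using C WV vH VHV v Vh w0 eH z by auto
    have dV: "d \<in> V" "s \<in> V" "e \<in> V" using CV eVh Vh fun_subspace_diff[OF V] by (auto simp: d_def s_def)
    have sW: "a w s = 0" if "w \<in> W" for w
      unfolding s_def using sesquilinear_on_diff_right[OF a(1)] Cinf vH that WV CV by simp
    have "(\<lambda>x. (v x - I v x) + Cinf vH x) \<in> W" using kern[OF v] C fun_subspace_add[OF W(1)] by blast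
    \<comment> \<open>\<open>v - s\<close> is the kernel part of \<open>v\<close> plus a corrector.
      Since \<open>e\<close> is orthogonal to the kernel, \<open>v\<close> may be replaced by
      \<open>s\<close>. As \<open>s\<close> is orthogonal to the kernel in the other argument,
      \<open>z\<close> can then be dropped and \<open>w0\<close> added.\<close>
    then have r: "(\<lambda>x. v x - s x) \<in> W" by (simp add: s_def vH_def algebra_simps)
    have "a e (\<lambda>x. v x - s x) = 0"
      unfolding e_def using sesquilinear_on_diff_left[OF a(1)] z(2)[OF r] CV WV[OF r] by simp
    then have "a e v = a e s" using sesquilinear_on_diff_right[OF a(1)] CV dV by simp
    also have "\<dots> = a eH s"
      unfolding e_def using sesquilinear_on_diff_left[OF a(1)] sW z CV dV by simp
    also have "\<dots> = a (\<lambda>x. w0 x + eH x) s"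
      using sesquilinear_on_add_left[OF a(1)] sW w0 CV dV by simp
    \<comment> \<open>The first argument has become the full error \<open>uh - uH\<close>. Splitting
      \<open>s\<close> into an admissible test function and the truncation error \<open>d\<close>
      leaves only \<open>d\<close>, by Galerkin orthogonality.\<close>
    also have "\<dots> = a (\<lambda>x. w0 x + eH x) (\<lambda>x. vH x - Cm vH x) - a (\<lambda>x. w0 x + eH x) d"
    proof -
      have "s = (\<lambda>x. (vH x - Cm vH x) - d x)" by (simp add: s_def d_def)
      then show ?thesis
        using sesquilinear_on_diff_right[OF a(1), of "\<lambda>x. vH x - Cm vH x" d] CV dV
          fun_subspace_diff[OF V CV(3,2)] fun_subspace_add[OF V CV(5,6)] by simp
    qed
    also have "a (\<lambda>x. w0 x + eH x) (\<lambda>x. vH x - Cm vH x) = 0"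
      using orth[OF vH] by (simp add: w0_def eH_def)
    finally have "cmod (a e v) = cmod (a (\<lambda>x. w0 x + eH x) d)" by simp
    also have "\<dots> \<le> Ca * N (\<lambda>x. w0 x + eH x) * N d"
      using a(2) fun_subspace_add[OF V CV(5,6)] dV by blast
    also have "\<dots> \<le> Ca * (N w0 + N eH) * (\<eta> * N v)"
    proof (intro mult_mono)
      show "N (\<lambda>x. w0 x + eH x) \<le> N w0 + N eH" using seminorm_on_add[OF N] CV by blast
      show "N d \<le> \<eta> * N v" unfolding d_def vH_def using Cm(2) v by blast
    qed (use Ca N0 CV dV fun_subspace_add[OF V] in auto)
    finally show ?thesis .
  qed
  have "N eH \<le> N w0"
  proof (cases "N e = 0")
    case True
    then show ?thesis using NeH N0[OF WV[OF w0]] by simp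
  next
    case False
    then have Ne: "N e > 0" using N0 eVh Vh by (metis less_eq_real_def subsetD)
    define R where "R = Ca * (N w0 + N eH) * \<eta>"
    have "c * N e \<le> R" if c: "c < \<alpha>" for c
    proof -
      obtain v where v: "v \<in> Vh" "N v \<noteq> 0" "c * (N e * N v) \<le> Re (a e v)"
        using inf_sup[OF eVh False c] by blast
      have "N v > 0" using v(1,2) N0 Vh by (metis less_eq_real_def subsetD)
      moreover have "c * N e * N v \<le> R * N v"
        using v(3) key[OF v(1)] complex_Re_le_cmod[of "a e v"] by (simp add: R_def algebra_simps)
      ultimately show ?thesis by simp
    qed
    then have "c \<le> R / N e" if "c < \<alpha>" for c using that Ne by (simp add: field_simps)
    then have "\<alpha> \<le> R / N e" by (rule dense_le)
    then have "\<alpha> * N e \<le> R" using Ne by (simp add: field_simps)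
    have "\<alpha> * N eH \<le> \<alpha> * (CI * N e)" using NeH \<alpha> by simp
    also have "\<dots> = CI * (\<alpha> * N e)" by simp
    also have "\<dots> \<le> CI * R" using \<open>\<alpha> * N e \<le> R\<close> CI by (rule mult_left_mono)
    also have "\<dots> = (Ca * \<eta> * CI) * (N w0 + N eH)" by (simp add: R_def)
    \<comment> \<open>The half in \<open>small\<close> gives \<open>N eH\<close> the weight 1/2 on
      the right, so that it can be absorbed.\<close>
    also have "\<dots> \<le> \<alpha> / 2 * (N w0 + N eH)"
      using small N0[OF WV[OF w0]] N0[OF VHV[OF eH]] by (intro mult_right_mono) auto
    finally show ?thesis using \<alpha> by (simp add: field_simps)
  qed
  moreover have "N (\<lambda>x. w0 x + eH x) \<le> N w0 + N eH"
    using seminorm_on_add[OF N] WV w0 VHV eH by blast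
  ultimately show ?thesis by (simp add: w0_def eH_def)
qed

section \<open>Test functions\<close>

text \<open>The factor \<open>inverse t ^ k\<close> makes a family around exp (- 1 / t) whose linear
  span is closed under differentiation, so that one derivative formula yields smoothness of every
  order.\<close>

definition flat_exp :: "nat \<Rightarrow> real \<Rightarrow> real" where
  "flat_exp k t = (if t > 0 then exp (- inverse t) * inverse t ^ k else 0)"

text \<open>Only t = 0 is delicate: the exponential beats every power of \<open>inverse t\<close>,
  so the difference quotient tends to 0 from the right, and it is 0 on the left.\<close>

lemma flat_exp_has_derivative:
  "(flat_exp k has_real_derivative flat_exp (k + 2) t - real k * flat_exp (k + 1) t) (at t)"
proof (cases t "0::real" rule: linorder_cases)
  case less
  have "((\<lambda>_. 0) has_real_derivative 0) (at t)" by simp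
  then have "(flat_exp k has_real_derivative 0) (at t)"
    by (rule has_field_derivative_transform_within_open[where S = "{..<0}"])
       (use less in \<open>auto simp: flat_exp_def\<close>)
  then show ?thesis using less by (simp add: flat_exp_def)
next
  case greater
  have "((\<lambda>t. exp (- inverse t) * inverse t ^ k) has_real_derivative
      flat_exp (k + 2) t - real k * flat_exp (k + 1) t) (at t)"
  proof -
    have "((\<lambda>t. exp (- inverse t) * inverse t ^ k) has_real_derivative
        exp (- inverse t) * inverse t ^ 2 * inverse t ^ k
        + exp (- inverse t) * (real k * inverse t ^ (k - 1) * - (inverse t ^ 2))) (at t)"
      using greater by (auto intro!: derivative_eq_intros simp: power2_eq_square algebra_simps)
    then show ?thesis
      using greater by (cases k) (simp_all add: flat_exp_def power2_eq_square algebra_simps)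
  qed
  then show ?thesis
    by (rule has_field_derivative_transform_within_open[where S = "{0<..}"])
       (use greater in \<open>auto simp: flat_exp_def\<close>)
next
  case equal
  have "((\<lambda>h. exp (- inverse h) * inverse h ^ k / h) \<longlongrightarrow> 0) (at_right (0::real))"
    by real_asymp
  then have "((\<lambda>h. flat_exp k h / h) \<longlongrightarrow> 0) (at_right 0)"
    by (rule Lim_transform_eventually)
       (auto simp: eventually_at_filter flat_exp_def)
  moreover have "((\<lambda>h. flat_exp k h / h) \<longlongrightarrow> 0) (at_left 0)"
    by (rule tendsto_eventually) (auto simp: eventually_at_filter flat_exp_def)
  ultimately have "((\<lambda>h. flat_exp k h / h) \<longlongrightarrow> 0) (at 0)" by (simp add: filterlim_at_split)
  then show ?thesis using equal by (simp add: DERIV_def flat_exp_def)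
qed

text \<open>\<open>C_k\<close> recurses through directional derivatives, so a set of differentiable
  functions that is closed under them consists of smooth functions. The generators and operations
  are chosen for this closure; \<open>exp\<close> is there for the cutoffs 1 - exp (- n
  \<psi>).\<close>

inductive_set bump_algebra :: "('a::euclidean_space \<Rightarrow> real) set" where
  const: "(\<lambda>_. c) \<in> bump_algebra"
| ridge: "(\<lambda>x. flat_exp k (x \<bullet> l + c)) \<in> bump_algebra"
| add: "f \<in> bump_algebra \<Longrightarrow> g \<in> bump_algebra \<Longrightarrow> (\<lambda>x. f x + g x) \<in> bump_algebra"
| mult: "f \<in> bump_algebra \<Longrightarrow> g \<in> bump_algebra \<Longrightarrow> (\<lambda>x. f x * g x) \<in> bump_algebra"
| exp: "f \<in> bump_algebra \<Longrightarrow> (\<lambda>x. exp (f x)) \<in> bump_algebra"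

lemma bump_algebra_derivative:
  assumes "f \<in> bump_algebra"
  shows "\<exists>D. (\<forall>x. (f has_derivative D x) (at x)) \<and> (\<forall>b. (\<lambda>x. D x b) \<in> bump_algebra)"
  using assms
proof induction
  case (const c)
  then show ?case by (intro exI[of _ "\<lambda>_ _. 0"]) (auto intro: bump_algebra.const)
next
  case (ridge k l c)
  let ?D = "\<lambda>x b. (b \<bullet> l) * (flat_exp (k + 2) (x \<bullet> l + c) + (- real k) * flat_exp (k + 1) (x \<bullet> l + c))"
  have "((\<lambda>x. flat_exp k (x \<bullet> l + c)) has_derivative ?D x) (at x)" for x
  proof -
    have "((\<lambda>x. x \<bullet> l + c) has_derivative (\<lambda>b. b \<bullet> l)) (at x)"
      by (auto intro!: derivative_eq_intros)
    from has_derivative_compose[OF this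
        flat_exp_has_derivative[of k "x \<bullet> l + c", unfolded has_field_derivative_def]]
    show ?thesis by (simp add: mult.commute)
  qed
  moreover have "(\<lambda>x. ?D x b) \<in> bump_algebra" for b
    by (intro bump_algebra.intros)
  ultimately show ?case by (intro exI[of _ ?D]) blast
next
  case (add f g)
  then obtain D E where "\<forall>x. (f has_derivative D x) (at x)" "\<forall>b. (\<lambda>x. D x b) \<in> bump_algebra"
    "\<forall>x. (g has_derivative E x) (at x)" "\<forall>b. (\<lambda>x. E x b) \<in> bump_algebra" by blast
  then show ?case
    by (intro exI[of _ "\<lambda>x b. D x b + E x b"])
       (auto intro!: derivative_eq_intros bump_algebra.intros)
next
  case (mult f g)
  then obtain D E where "\<forall>x. (f has_derivative D x) (at x)" "\<forall>b. (\<lambda>x. D x b) \<in> bump_algebra"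
    "\<forall>x. (g has_derivative E x) (at x)" "\<forall>b. (\<lambda>x. E x b) \<in> bump_algebra" by blast
  then show ?case using mult.hyps
    by (intro exI[of _ "\<lambda>x b. f x * E x b + D x b * g x"])
       (auto intro!: derivative_eq_intros bump_algebra.intros)
next
  case (exp f)
  then obtain D where "\<forall>x. (f has_derivative D x) (at x)" "\<forall>b. (\<lambda>x. D x b) \<in> bump_algebra" by blast
  then show ?case using exp.hyps
    by (intro exI[of _ "\<lambda>x b. exp (f x) * D x b"])
       (auto intro!: derivative_eq_intros bump_algebra.intros)
qed

lemma bump_algebra_C_k: "f \<in> bump_algebra \<Longrightarrow> C_k n f"
proof (induction n arbitrary: f)
  case 0
  then show ?case
    using bump_algebra_derivative[OF 0] has_derivative_continuous
    by (metis C_k.simps(1) continuous_at_imp_continuous_on)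
next
  case (Suc n)
  obtain D where D: "\<forall>x. (f has_derivative D x) (at x)" "\<forall>b. (\<lambda>x. D x b) \<in> bump_algebra"
    using bump_algebra_derivative[OF Suc.prems] by blast
  have "frechet_derivative f (at x) = D x" for x
    using D(1) frechet_derivative_at by metis
  then show ?case using D Suc.IH by (auto simp: differentiable_def)
qed

lemma bump_algebra_prod:
  "(\<And>i. i \<in> J \<Longrightarrow> f i \<in> bump_algebra) \<Longrightarrow> (\<lambda>x. \<Prod>i\<in>J. f i x) \<in> bump_algebra"
proof (induction J rule: infinite_finite_induct)
  case (insert j J)
  then have "(\<lambda>x. f j x * (\<Prod>i\<in>J. f i x)) \<in> bump_algebra" by (intro bump_algebra.mult) auto
  then show ?case using insert by simp
qed (auto intro: bump_algebra.const)

text \<open>A product \<psi> of flat exponentials is positive exactly on the open box. Hence 1 - exp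
  (- n \<psi>) stays between 0 and 1, vanishes off the box and tends to 1 inside it.\<close>

lemma box_cutoff:
  fixes a b :: "'a::euclidean_space"
  shows "\<exists>\<phi> :: nat \<Rightarrow> 'a \<Rightarrow> real.
    (\<forall>\<Omega> n. cbox a b \<subseteq> \<Omega> \<longrightarrow> test_function \<Omega> (\<phi> n)) \<and> (\<forall>n x. 0 \<le> \<phi> n x \<and> \<phi> n x \<le> 1) \<and>
    (\<forall>x. (\<lambda>n. \<phi> n x) \<longlonglongrightarrow> indicator (box a b) x)"
proof -
  \<comment> \<open>Sums with negated terms take the place of differences, so that the introduction
    rules of \<open>bump_algebra\<close> match.\<close>
  define \<psi> where "\<psi> x = (\<Prod>i\<in>Basis. flat_exp 0 (x \<bullet> i + - (a \<bullet> i)) * flat_exp 0 (x \<bullet> (- i) + b \<bullet> i))" for x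
  define \<phi> where "\<phi> n x = 1 + (-1) * exp ((- real n) * \<psi> x)" for n x
  have flat: "flat_exp 0 t \<ge> 0" "flat_exp 0 t = 0 \<longleftrightarrow> t \<le> 0" for t by (auto simp: flat_exp_def)
  have \<psi>0: "\<psi> x \<ge> 0" for x unfolding \<psi>_def by (intro prod_nonneg mult_nonneg_nonneg flat ballI)
  have \<psi>: "\<psi> x = 0 \<longleftrightarrow> x \<notin> box a b" for x
    by (auto simp: \<psi>_def flat mem_box not_less)
  have "\<psi> \<in> bump_algebra"
    unfolding \<psi>_def by (intro bump_algebra_prod bump_algebra.intros)
  then have smooth: "\<phi> n \<in> bump_algebra" for n
    unfolding \<phi>_def by (intro bump_algebra.intros)
  have supp: "closure {x. \<phi> n x \<noteq> 0} \<subseteq> cbox a b" for n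
    by (rule closure_minimal) (use box_subset_cbox \<psi> in \<open>auto simp: \<phi>_def\<close>)
  have "test_function \<Omega> (\<phi> n)" if "cbox a b \<subseteq> \<Omega>" for \<Omega> n
    using supp[of n] that smooth bump_algebra_C_k
    unfolding test_function_def compact_eq_bounded_closed by (meson bounded_cbox bounded_subset closed_closure subset_trans)
  moreover have "0 \<le> \<phi> n x \<and> \<phi> n x \<le> 1" for n x using \<psi>0[of x] by (simp add: \<phi>_def)
  moreover have "(\<lambda>n. \<phi> n x) \<longlonglongrightarrow> indicator (box a b) x" for x
  proof (cases "x \<in> box a b")
    case True
    then have p: "\<psi> x > 0" using \<psi> \<psi>0[of x] by (simp add: order_less_le)
    have "(\<lambda>n. 1 + (-1) * exp ((- real n) * \<psi> x)) \<longlonglongrightarrow> 1" using p by real_asymp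
    then show ?thesis using True by (simp add: \<phi>_def)
  next
    case False
    then show ?thesis using \<psi>[of x] by (simp add: \<phi>_def)
  qed
  ultimately show ?thesis by blast
qed

lemma test_function_derivative:
  assumes "test_function \<Omega> \<phi>" "b \<in> Basis"
  shows "continuous_on UNIV (\<lambda>x. frechet_derivative \<phi> (at x) b)"
    and "continuous_on UNIV \<phi>"
    and "x \<notin> closure {x. \<phi> x \<noteq> 0} \<Longrightarrow> frechet_derivative \<phi> (at x) b = 0"
proof -
  have "C_k (Suc 0) \<phi>" "C_k 0 \<phi>" using assms unfolding test_function_def by blast+
  then show "continuous_on UNIV (\<lambda>x. frechet_derivative \<phi> (at x) b)" "continuous_on UNIV \<phi>"
    using assms(2) by auto
  assume x: "x \<notin> closure {x. \<phi> x \<noteq> 0}"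
  have "(\<phi> has_derivative (\<lambda>_. 0)) (at x)"
    by (rule has_derivative_transform_within_open[where f = "\<lambda>_. 0" and s = "- closure {x. \<phi> x \<noteq> 0}"])
       (use x closure_subset[of "{x. \<phi> x \<noteq> 0}"] in auto)
  then show "frechet_derivative \<phi> (at x) b = 0" by (metis frechet_derivative_at)
qed

lemma test_function_mono: "test_function U \<phi> \<Longrightarrow> U \<subseteq> \<Omega> \<Longrightarrow> test_function \<Omega> \<phi>"
  unfolding test_function_def by blast

text \<open>Cutoffs and dominated convergence turn the hypothesis into vanishing integrals over all
  closed boxes in U; Lebesgue differentiation then gives the value 0 almost everywhere.\<close>

lemma fundamental_lemma:
  fixes g :: "'a::euclidean_space \<Rightarrow> complex"
  assumes "open U" "integrable (lebesgue_on U) g"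
    and zero: "\<And>\<phi>. test_function U \<phi> \<Longrightarrow> (\<integral>x. g x * of_real (\<phi> x) \<partial>lebesgue_on U) = 0"
  shows "AE x in lebesgue_on U. g x = 0"
proof -
  define G where "G x = indicator U x *\<^sub>R g x" for x
  have U: "U \<in> sets lebesgue" using assms(1) by (simp add: lborelD)
  have Gint: "integrable lebesgue G" using assms(2) U unfolding G_def by (simp add: integrable_restrict_space)
  have box0: "integral (cbox a b) G = 0" if ab: "cbox a b \<subseteq> U" for a b
  proof -
    obtain \<phi> :: "nat \<Rightarrow> 'a \<Rightarrow> real" where \<phi>: "\<And>\<Omega> n. cbox a b \<subseteq> \<Omega> \<Longrightarrow> test_function \<Omega> (\<phi> n)"
      "\<And>n x. 0 \<le> \<phi> n x \<and> \<phi> n x \<le> 1" "\<And>x. (\<lambda>n. \<phi> n x) \<longlonglongrightarrow> indicator (box a b) x"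
      using box_cutoff[of a b] by blast
    have cont: "continuous_on UNIV (\<phi> n)" for n
      using \<phi>(1)[OF ab, of n] unfolding test_function_def by (metis C_k.simps(1))
    have "(\<lambda>n. \<integral>x. G x * of_real (\<phi> n x) \<partial>lebesgue) \<longlonglongrightarrow>
        (\<integral>x. G x * of_real (indicator (box a b) x) \<partial>lebesgue)"
    proof (rule integral_dominated_convergence[where w = "\<lambda>x. norm (G x)"])
      have "(\<lambda>x. complex_of_real (\<phi> n x)) \<in> borel_measurable lebesgue" for n
        using cont[of n] by (intro measurable_completion) (auto intro!: borel_measurable_continuous_onI continuous_intros)
      then show "(\<lambda>x. G x * of_real (\<phi> n x)) \<in> borel_measurable lebesgue" for n
        using Gint by (intro borel_measurable_times) auto
      have "(\<lambda>x. complex_of_real (indicator (box a b) x)) \<in> borel_measurable lebesgue"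
        by (intro measurable_completion) simp
      then show "(\<lambda>x. G x * of_real (indicator (box a b) x)) \<in> borel_measurable lebesgue"
        using Gint by (intro borel_measurable_times) auto
      show "AE x in lebesgue. (\<lambda>n. G x * of_real (\<phi> n x)) \<longlonglongrightarrow> G x * of_real (indicator (box a b) x)"
        using \<phi>(3) by (intro AE_I2 tendsto_mult_left tendsto_of_real) auto
      show "AE x in lebesgue. norm (G x * of_real (\<phi> n x)) \<le> norm (G x)" for n
        using \<phi>(2)[of n] by (intro AE_I2) (auto simp: norm_mult intro!: mult_left_le)
    qed (use Gint in auto)
    moreover have "(\<integral>x. G x * of_real (\<phi> n x) \<partial>lebesgue) = 0" for n
      using zero[OF \<phi>(1)[OF ab]] U by (simp add: integral_restrict_space G_def)
    ultimately have "(\<integral>x. G x * of_real (indicator (box a b) x) \<partial>lebesgue) = 0"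
      by (simp add: LIMSEQ_const_iff)
    moreover have "(\<lambda>x. G x * of_real (indicator (box a b) x)) = (\<lambda>x. indicator (box a b) x *\<^sub>R G x)"
      by (auto simp: fun_eq_iff indicator_def)
    ultimately have "(\<integral>x. G x \<partial>lebesgue_on (box a b)) = 0"
      by (simp add: integral_restrict_space)
    moreover have "integrable (lebesgue_on (box a b)) G"
      using Gint by (simp add: integrable_restrict_space integrable_mult_indicator)
    ultimately have "integral (box a b) G = 0" by (simp add: lebesgue_integral_eq_integral)
    then show ?thesis by (simp add: integral_open_interval)
  qed
  \<comment> \<open>Lebesgue differentiation with cubes that have x as their lower corner.\<close>
  obtain N where N: "negligible N" "\<And>x e. \<lbrakk>x \<notin> N; 0 < e\<rbrakk> \<Longrightarrow> \<exists>d>0. \<forall>h. 0 < h \<and> h < d \<longrightarrow>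
      norm (integral (cbox x (x + h *\<^sub>R One)) G /\<^sub>R h ^ DIM('a) - G x) < e"
  proof (rule integrable_ccontinuous_explicit[of G])
    show "G integrable_on cbox a b" for a b
      using Gint integrable_on_lebesgue integrable_on_subcbox by blast
  qed blast
  have "G x = 0" if x: "x \<in> U" "x \<notin> N" for x
  proof (rule ccontr)
    assume "G x \<noteq> 0"
    then obtain d where d: "d > 0" "\<And>h. 0 < h \<Longrightarrow> h < d \<Longrightarrow>
        norm (integral (cbox x (x + h *\<^sub>R One)) G /\<^sub>R h ^ DIM('a) - G x) < norm (G x)"
      using N(2)[OF x(2), of "norm (G x)"] by auto
    obtain e where e: "e > 0" "ball x e \<subseteq> U"
      using assms(1) x(1) by (meson open_contains_ball)
    \<comment> \<open>In a cube of side h the l1-distance from the corner is at most h times the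
      dimension, so this h keeps the cube inside the ball.\<close>
    define h where "h = min (d / 2) (e / (2 * real DIM('a)))"
    have h: "0 < h" "h < d" "h * real DIM('a) < e"
      using d(1) e(1) by (auto simp: h_def min_def field_simps split: if_splits)
    have "cbox x (x + h *\<^sub>R One) \<subseteq> ball x e"
    proof
      fix y assume y: "y \<in> cbox x (x + h *\<^sub>R One)"
      have "norm (y - x) \<le> (\<Sum>i\<in>Basis. \<bar>(y - x) \<bullet> i\<bar>)" by (rule norm_le_l1)
      also have "\<dots> \<le> (\<Sum>i\<in>(Basis::'a set). h)"
        using y by (intro sum_mono) (auto simp: mem_box inner_diff_left inner_add_left)
      also have "\<dots> < e" using h by (simp add: mult.commute)
      finally show "y \<in> ball x e" by (simp add: dist_norm norm_minus_commute)
    qed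
    then have "integral (cbox x (x + h *\<^sub>R One)) G = 0" using box0 e(2) by blast
    then show False using d(2)[OF h(1,2)] by simp
  qed
  then have "AE x in lebesgue. x \<in> U \<longrightarrow> g x = 0"
    using N(1) by (intro AE_I'[of N]) (auto simp: negligible_iff_null_sets G_def)
  then show ?thesis using U by (simp add: AE_restrict_space_iff)
qed

section \<open>Sobolev functions\<close>

text \<open>Supplies the triangle inequality for \<open>V_norm\<close>, the root of a Hermitian
  form. On representatives the form is only semidefinite, so Cauchy-Schwarz has to cope with
  isotropic vectors.\<close>

lemma seminorm_on_form:
  assumes W: "fun_subspace W" and B: "sesquilinear_on W B"
    and sym: "\<And>u v. u \<in> W \<Longrightarrow> v \<in> W \<Longrightarrow> B v u = cnj (B u v)"
    and pos: "\<And>u. u \<in> W \<Longrightarrow> 0 \<le> Re (B u u)"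
  shows "seminorm_on W (\<lambda>v. sqrt (Re (B v v)))"
proof -
  have expand: "Re (B (\<lambda>x. u x + c * v x) (\<lambda>x. u x + c * v x)) =
      Re (B u u) + 2 * Re (cnj c * B u v) + (cmod c)\<^sup>2 * Re (B v v)"
    if uv: "u \<in> W" "v \<in> W" for u v c
  proof -
    have w: "(\<lambda>x. u x + c * v x) \<in> W" using W uv unfolding fun_subspace_def by blast
    have "B (\<lambda>x. u x + c * v x) (\<lambda>x. u x + c * v x) =
        B u u + cnj c * B u v + c * (B v u + cnj c * B v v)"
      using sesquilinear_on_left[OF B uv w, of c] sesquilinear_on_right[OF B uv uv(1), of c]
        sesquilinear_on_right[OF B uv uv(2), of c] by simp
    moreover have "Re (c * B v u) = Re (cnj c * B u v)"
      using sym[OF uv] by simp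
    moreover have "Re (c * (cnj c * B v v)) = (cmod c)\<^sup>2 * Re (B v v)"
      using complex_norm_square[of c]
      by (simp add: mult.assoc[symmetric] flip: complex_norm_square of_real_power)
    ultimately show ?thesis by (simp add: distrib_left)
  qed
  have CS: "cmod (B u v) \<le> sqrt (Re (B u u)) * sqrt (Re (B v v))" if uv: "u \<in> W" "v \<in> W" for u v
  proof -
    define b where "b = B u v"
    \<comment> \<open>The coefficient - s b carries the phase of b. This makes the cross term real
      and leaves a quadratic polynomial in the real number s.\<close>
    have "0 \<le> Re (B u u) - 2 * s * (cmod b)\<^sup>2 + s\<^sup>2 * (cmod b)\<^sup>2 * Re (B v v)" for s
    proof -
      have "(\<lambda>x. u x + (- of_real s * b) * v x) \<in> W" using W uv unfolding fun_subspace_def by blast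
      note pos[OF this]
      moreover have "cnj (- of_real s * b) * b = of_real (- s * (cmod b)\<^sup>2)"
        using complex_norm_square[of b] by (simp add: mult.commute)
      then have "Re (cnj (- of_real s * b) * b) = - s * (cmod b)\<^sup>2" by (metis Re_complex_of_real)
      moreover have "(cmod (- of_real s * b))\<^sup>2 = s\<^sup>2 * (cmod b)\<^sup>2"
        by (simp add: norm_mult power_mult_distrib)
      ultimately show ?thesis using expand[OF uv, of "- of_real s * b"] unfolding b_def[symmetric] by simp
    qed note ineq = this
    have "(cmod b)\<^sup>2 \<le> Re (B u u) * Re (B v v)"
    proof (cases "Re (B v v) = 0")
      case True
      have "cmod b = 0"
      proof (rule ccontr)
        assume "cmod b \<noteq> 0"
        then have "(cmod b)\<^sup>2 > 0" by simp
        \<comment> \<open>If \<open>B v v\<close> has real part 0, the polynomial is affine in s;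
          for this s its value is - Re (B u u) - 2, which is negative.\<close>
        then have "2 * ((Re (B u u) + 1) / (cmod b)\<^sup>2) * (cmod b)\<^sup>2 = 2 * (Re (B u u) + 1)" by simp
        then show False
          using ineq[of "(Re (B u u) + 1) / (cmod b)\<^sup>2"] True pos[OF uv(1)] by simp
      qed
      then show ?thesis using True by simp
    next
      case False
      then have p: "Re (B v v) > 0" using pos[OF uv(2)] by simp
      \<comment> \<open>The minimizer of the quadratic polynomial in s.\<close>
      show ?thesis using ineq[of "1 / Re (B v v)"] p by (simp add: field_simps power2_eq_square)
    qed
    then have "cmod b \<le> sqrt (Re (B u u) * Re (B v v))" by (rule real_le_rsqrt)
    then show ?thesis by (simp add: b_def real_sqrt_mult)
  qed
  show ?thesis unfolding seminorm_on_def
  proof (intro conjI ballI allI)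
    fix u v c assume uv: "u \<in> W" "v \<in> W"
    let ?u = "sqrt (Re (B u u))" and ?v = "sqrt (Re (B v v))"
    have "Re (cnj c * B u v) \<le> cmod c * (?u * ?v)"
      using complex_Re_le_cmod[of "cnj c * B u v"] mult_left_mono[OF CS[OF uv], of "cmod c"]
      by (simp add: norm_mult)
    then have "Re (B (\<lambda>x. u x + c * v x) (\<lambda>x. u x + c * v x)) \<le> (?u + cmod c * ?v)\<^sup>2"
      using expand[OF uv, of c] pos uv by (simp add: power2_sum power_mult_distrib algebra_simps)
    then show "sqrt (Re (B (\<lambda>x. u x + c * v x) (\<lambda>x. u x + c * v x))) \<le> ?u + cmod c * ?v"
      using pos uv by (intro real_le_lsqrt) auto
  qed (use pos in auto)
qed

section \<open>Square integrable functions\<close>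

lemma borel_measurable_cnj [measurable (raw)]:
  "g \<in> borel_measurable M \<Longrightarrow> (\<lambda>x. cnj (g x)) \<in> borel_measurable M"
  by (intro borel_measurable_continuous_on[of cnj] continuous_intros) auto

lemma L2_integrable_product:
  assumes "f \<in> L2 M" "g \<in> L2 M"
  shows "integrable M (\<lambda>x. f x * cnj (g x))"
proof (rule Bochner_Integration.integrable_bound)
  show "integrable M (\<lambda>x. (cmod (f x))\<^sup>2 + (cmod (g x))\<^sup>2)" using assms by (simp add: L2_def)
  have [measurable]: "f \<in> borel_measurable M" "g \<in> borel_measurable M" using assms by (auto simp: L2_def)
  show "(\<lambda>x. f x * cnj (g x)) \<in> borel_measurable M" by measurable
  have "cmod (f x) * cmod (g x) \<le> (cmod (f x))\<^sup>2 + (cmod (g x))\<^sup>2" for x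
    using sum_squares_bound[of "cmod (f x)" "cmod (g x)"]
      mult_nonneg_nonneg[OF norm_ge_zero[of "f x"] norm_ge_zero[of "g x"]] by linarith
  then show "AE x in M. norm (f x * cnj (g x)) \<le> norm ((cmod (f x))\<^sup>2 + (cmod (g x))\<^sup>2)"
    by (auto simp: norm_mult)
qed

lemma fun_subspace_L2: "fun_subspace (L2 M)"
  unfolding fun_subspace_def
proof (intro conjI ballI allI)
  show "(\<lambda>_. 0) \<in> L2 M" by (simp add: L2_def)
  fix u v c assume uv: "u \<in> L2 M" "v \<in> L2 M"
  have [measurable]: "u \<in> borel_measurable M" "v \<in> borel_measurable M" using uv by (auto simp: L2_def)
  have "integrable M (\<lambda>x. (cmod (u x + c * v x))\<^sup>2)"
  proof (rule Bochner_Integration.integrable_bound)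
    show "integrable M (\<lambda>x. 2 * (cmod (u x))\<^sup>2 + (2 * (cmod c)\<^sup>2) * (cmod (v x))\<^sup>2)"
      using uv by (simp add: L2_def)
    have "(cmod (u x + c * v x))\<^sup>2 \<le> 2 * (cmod (u x))\<^sup>2 + (2 * (cmod c)\<^sup>2) * (cmod (v x))\<^sup>2" for x
    proof -
      have "(cmod (u x + c * v x))\<^sup>2 \<le> (cmod (u x) + cmod (c * v x))\<^sup>2"
        by (intro power_mono norm_triangle_ineq) auto
      also have "\<dots> \<le> 2 * (cmod (u x))\<^sup>2 + 2 * (cmod (c * v x))\<^sup>2"
        using sum_squares_bound[of "cmod (u x)" "cmod (c * v x)"] by (simp add: power2_sum)
      finally show ?thesis by (simp add: norm_mult power_mult_distrib)
    qed
    then show "AE x in M. norm ((cmod (u x + c * v x))\<^sup>2) \<le>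
        norm (2 * (cmod (u x))\<^sup>2 + (2 * (cmod c)\<^sup>2) * (cmod (v x))\<^sup>2)" by auto
  qed simp
  then show "(\<lambda>x. u x + c * v x) \<in> L2 M" by (simp add: L2_def)
qed

lemma sesquilinear_on_L2_inner: "sesquilinear_on (L2 M) (L2_inner M)"
  unfolding sesquilinear_on_def L2_inner_def
proof (intro ballI allI conjI)
  fix u v w c assume uvw: "u \<in> L2 M" "v \<in> L2 M" "w \<in> L2 M"
  have "(\<integral>x. (u x + c * v x) * cnj (w x) \<partial>M) = (\<integral>x. u x * cnj (w x) + c * (v x * cnj (w x)) \<partial>M)"
    by (simp add: algebra_simps)
  then show "(\<integral>x. (u x + c * v x) * cnj (w x) \<partial>M) = (\<integral>x. u x * cnj (w x) \<partial>M) + c * (\<integral>x. v x * cnj (w x) \<partial>M)"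
    using uvw by (simp add: L2_integrable_product)
  have "(\<integral>x. w x * cnj (u x + c * v x) \<partial>M) = (\<integral>x. w x * cnj (u x) + cnj c * (w x * cnj (v x)) \<partial>M)"
    by (simp add: algebra_simps)
  then show "(\<integral>x. w x * cnj (u x + c * v x) \<partial>M) = (\<integral>x. w x * cnj (u x) \<partial>M) + cnj c * (\<integral>x. w x * cnj (v x) \<partial>M)"
    using uvw by (simp add: L2_integrable_product)
qed

lemma L2_inner_commute: "L2_inner M g f = cnj (L2_inner M f g)"
  unfolding L2_inner_def by (subst Bochner_Integration.integral_cnj[symmetric]) (simp add: mult.commute)

lemma L2_inner_self: "L2_inner M f f = of_real ((L2_norm M f)\<^sup>2)"
proof -
  have "(L2_norm M f)\<^sup>2 = (\<integral>x. (cmod (f x))\<^sup>2 \<partial>M)" by (simp add: L2_norm_def)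
  moreover have "L2_inner M f f = (\<integral>x. complex_of_real ((cmod (f x))\<^sup>2) \<partial>M)"
    unfolding L2_inner_def by (simp only: complex_norm_square)
  ultimately show ?thesis by (simp only: integral_complex_of_real)
qed

lemma L2_inner_cong_AE:
  assumes "AE x in M. f x = f' x" "AE x in M. g x = g' x"
    and "f \<in> borel_measurable M" "f' \<in> borel_measurable M" "g \<in> borel_measurable M" "g' \<in> borel_measurable M"
  shows "L2_inner M f g = L2_inner M f' g'"
  unfolding L2_inner_def
proof (rule integral_cong_AE)
  show "AE x in M. f x * cnj (g x) = f' x * cnj (g' x)" using assms(1,2) by eventually_elim simp
qed (use assms(3-) in measurable)

lemma L2_norm_nonneg: "L2_norm M f \<ge> 0"
  by (simp add: L2_norm_def)

lemma L2_norm_zero_iff: "f \<in> L2 M \<Longrightarrow> L2_norm M f = 0 \<longleftrightarrow> (AE x in M. f x = 0)"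
  by (simp add: L2_norm_def L2_def integral_nonneg_eq_0_iff_AE)

lemma L2_restrict_space:
  assumes "A \<inter> space M \<in> sets M"
  shows "f \<in> L2 (restrict_space M A) \<longleftrightarrow> (\<lambda>x. indicator A x *\<^sub>R f x) \<in> L2 M"
proof -
  have "(cmod (indicator A x *\<^sub>R f x))\<^sup>2 = indicator A x *\<^sub>R (cmod (f x))\<^sup>2" for x
    by (simp add: indicator_def)
  then show ?thesis
    using assms by (simp add: L2_def borel_measurable_restrict_space_iff integrable_restrict_space)
qed

lemma L2_restrict_subset:
  assumes "f \<in> L2 (restrict_space M A)" "A \<inter> space M \<in> sets M" "B \<inter> space M \<in> sets M" "B \<subseteq> A"
  shows "f \<in> L2 (restrict_space M B)"
proof -
  have "(\<lambda>x. indicator A x *\<^sub>R f x) \<in> L2 M" using assms(1) by (simp only: L2_restrict_space[OF assms(2)])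
  then have f: "(\<lambda>x. indicator A x *\<^sub>R f x) \<in> borel_measurable M"
    "integrable M (\<lambda>x. (cmod (indicator A x *\<^sub>R f x))\<^sup>2)" by (simp_all only: L2_def mem_Collect_eq)
  have B: "B \<inter> space M \<in> sets M" by fact
  have e: "indicator B x *\<^sub>R f x = indicator (B \<inter> space M) x *\<^sub>R (indicator A x *\<^sub>R f x)" if "x \<in> space M" for x
    using assms(4) that by (auto simp: indicator_def)
  have e2: "(cmod (indicator B x *\<^sub>R f x))\<^sup>2 = indicator (B \<inter> space M) x *\<^sub>R (cmod (indicator A x *\<^sub>R f x))\<^sup>2" 
    if "x \<in> space M" for x
    using assms(4) that by (auto simp: indicator_def)
  have "(\<lambda>x. indicator (B \<inter> space M) x *\<^sub>R (indicator A x *\<^sub>R f x)) \<in> borel_measurable M"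
    using B f(1) by (rule borel_measurable_scaleR[OF borel_measurable_indicator])
  moreover have "integrable M (\<lambda>x. indicator (B \<inter> space M) x *\<^sub>R (cmod (indicator A x *\<^sub>R f x))\<^sup>2)"
    using B f(2) by (rule integrable_mult_indicator)
  ultimately have "(\<lambda>x. indicator B x *\<^sub>R f x) \<in> borel_measurable M \<and>
    integrable M (\<lambda>x. (cmod (indicator B x *\<^sub>R f x))\<^sup>2)"
    using iffD2[OF measurable_cong[OF e]] iffD2[OF Bochner_Integration.integrable_cong[OF refl e2]] by fast
  then have "(\<lambda>x. indicator B x *\<^sub>R f x) \<in> L2 M" by (simp only: L2_def mem_Collect_eq simp_thms)
  then show ?thesis by (simp only: L2_restrict_space[OF B])
qed

text \<open>Closed cells stick out of the open domain, but only by a null set. Completeness of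
  Lebesgue measure carries square integrability over to them, whatever values the representative
  takes outside.\<close>

lemma L2_lebesgue_almost_subset:
  fixes f :: "'a::euclidean_space \<Rightarrow> complex"
  assumes f: "f \<in> L2 (lebesgue_on A)" and A: "A \<in> sets lebesgue" and B: "B \<in> sets lebesgue"
    and null: "negligible (B - A)"
  shows "f \<in> L2 (lebesgue_on B)"
proof -
  have BA: "f \<in> L2 (lebesgue_on (B \<inter> A))" by (rule L2_restrict_subset[OF f]) (use A B in auto)
  have ae: "AE x in lebesgue. indicator (B \<inter> A) x *\<^sub>R f x = indicator B x *\<^sub>R f x"
    using null by (intro AE_I'[of "B - A"]) (auto simp: negligible_iff_null_sets indicator_def)
  have m: "(\<lambda>x. indicator (B \<inter> A) x *\<^sub>R f x) \<in> L2 lebesgue" using BA A B L2_restrict_space[of "B \<inter> A"] by simp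
  have m': "(\<lambda>x. indicator B x *\<^sub>R f x) \<in> borel_measurable lebesgue"
    by (rule borel_measurable_AE[OF _ ae]) (use m in \<open>simp add: L2_def\<close>)
  have "integrable lebesgue (\<lambda>x. (cmod (indicator B x *\<^sub>R f x))\<^sup>2)"
  proof (rule integrable_cong_AE_imp)
    show "integrable lebesgue (\<lambda>x. (cmod (indicator (B \<inter> A) x *\<^sub>R f x))\<^sup>2)" using m by (simp only: L2_def mem_Collect_eq)
    show "(\<lambda>x. (cmod (indicator B x *\<^sub>R f x))\<^sup>2) \<in> borel_measurable lebesgue" using m' by measurable
    show "AE x in lebesgue. (cmod (indicator (B \<inter> A) x *\<^sub>R f x))\<^sup>2 = (cmod (indicator B x *\<^sub>R f x))\<^sup>2"
      using ae by (auto elim: eventually_mono)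
  qed
  then have "(\<lambda>x. indicator B x *\<^sub>R f x) \<in> L2 lebesgue" using m' by (simp only: L2_def mem_Collect_eq simp_thms)
  then show ?thesis using B L2_restrict_space[of B lebesgue] by simp
qed

lemma L2_integrable_bounded_domain:
  assumes "f \<in> L2 (lebesgue_on A)" "bounded A" "A \<in> sets lebesgue"
  shows "integrable (lebesgue_on A) f"
proof -
  have "A \<in> lmeasurable" using assms bounded_set_imp_lmeasurable by blast
  then have "(\<lambda>_. 1) \<in> L2 (lebesgue_on A)"
    using assms(3) by (simp add: L2_def integrable_restrict_space integrable_real_indicator fmeasurable_def)
  then show ?thesis using L2_integrable_product[OF assms(1), of "\<lambda>_. 1"] by simp
qed

lemma L2_continuous:
  fixes \<phi> :: "'a::euclidean_space \<Rightarrow> real"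
  assumes "continuous_on UNIV \<phi>" "bounded A" "A \<in> sets lebesgue"
  shows "(\<lambda>x. of_real (\<phi> x)) \<in> L2 (lebesgue_on A)"
proof -
  have A: "A \<in> lmeasurable" using assms bounded_set_imp_lmeasurable by blast
  have "compact (closure A)" using assms(2) by simp
  then have "bounded ((\<lambda>x. of_real (\<phi> x) :: complex) ` closure A)"
    using assms(1) by (intro compact_imp_bounded compact_continuous_image continuous_intros) (auto intro: continuous_on_subset)
  then obtain K where K: "\<And>x. x \<in> A \<Longrightarrow> cmod (of_real (\<phi> x)) \<le> K"
    unfolding bounded_iff using closure_subset by blast
  have m: "(\<lambda>x. complex_of_real (\<phi> x)) \<in> borel_measurable (lebesgue_on A)"
    using assms by (intro continuous_imp_measurable_on_sets_lebesgue continuous_intros) (auto intro: continuous_on_subset)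
  have "integrable (lebesgue_on A) (\<lambda>x. (cmod (of_real (\<phi> x)))\<^sup>2)"
  proof (rule Bochner_Integration.integrable_bound)
    show "integrable (lebesgue_on A) (\<lambda>_. K\<^sup>2)" using A assms(3)
      by (simp add: integrable_restrict_space integrable_real_indicator fmeasurable_def)
    show "AE x in lebesgue_on A. norm ((cmod (complex_of_real (\<phi> x)))\<^sup>2) \<le> norm (K\<^sup>2)"
    proof (intro AE_I2)
      fix x assume "x \<in> space (lebesgue_on A)"
      then have "(cmod (complex_of_real (\<phi> x)))\<^sup>2 \<le> K\<^sup>2" by (intro power_mono K) auto
      then show "norm ((cmod (complex_of_real (\<phi> x)))\<^sup>2) \<le> norm (K\<^sup>2)" by simp
    qed
  qed (use m in measurable)
  then show ?thesis using m by (simp only: L2_def mem_Collect_eq simp_thms)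
qed

section \<open>Weak derivatives\<close>

lemma L2_weak_product_integrable:
  assumes "test_function \<Omega> \<phi>" "bounded \<Omega>" "\<Omega> \<in> sets lebesgue" "b \<in> Basis" "v \<in> L2 (lebesgue_on \<Omega>)"
  shows "integrable (lebesgue_on \<Omega>) (\<lambda>x. v x * of_real (\<phi> x))"
    and "integrable (lebesgue_on \<Omega>) (\<lambda>x. v x * of_real (frechet_derivative \<phi> (at x) b))"
  using L2_integrable_product[OF assms(5) L2_continuous[OF test_function_derivative(2)[OF assms(1,4)] assms(2,3)]]
    L2_integrable_product[OF assms(5) L2_continuous[OF test_function_derivative(1)[OF assms(1,4)] assms(2,3)]]
  by simp_all

lemma weak_partial_lin:
  assumes dom: "bounded \<Omega>" "\<Omega> \<in> sets lebesgue" "b \<in> Basis"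
    and L2: "u \<in> L2 (lebesgue_on \<Omega>)" "v \<in> L2 (lebesgue_on \<Omega>)" "g \<in> L2 (lebesgue_on \<Omega>)" "h \<in> L2 (lebesgue_on \<Omega>)"
    and "weak_partial \<Omega> b u g" "weak_partial \<Omega> b v h"
  shows "weak_partial \<Omega> b (\<lambda>x. u x + c * v x) (\<lambda>x. g x + c * h x)"
  unfolding weak_partial_def
proof (intro allI impI)
  fix \<phi> assume \<phi>: "test_function \<Omega> \<phi>"
  note int = L2_weak_product_integrable[OF \<phi> dom]
  have "(\<integral>x. (u x + c * v x) * of_real (frechet_derivative \<phi> (at x) b) \<partial>lebesgue_on \<Omega>) =
      (\<integral>x. u x * of_real (frechet_derivative \<phi> (at x) b) + c * (v x * of_real (frechet_derivative \<phi> (at x) b)) \<partial>lebesgue_on \<Omega>)"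
    by (simp add: algebra_simps)
  also have "\<dots> = (\<integral>x. u x * of_real (frechet_derivative \<phi> (at x) b) \<partial>lebesgue_on \<Omega>)
      + c * (\<integral>x. v x * of_real (frechet_derivative \<phi> (at x) b) \<partial>lebesgue_on \<Omega>)"
    using int(2)[OF L2(1)] int(2)[OF L2(2)] by simp
  also have "\<dots> = - (\<integral>x. g x * of_real (\<phi> x) \<partial>lebesgue_on \<Omega>) + c * (- (\<integral>x. h x * of_real (\<phi> x) \<partial>lebesgue_on \<Omega>))"
    using assms(8,9) \<phi> unfolding weak_partial_def by simp
  also have "\<dots> = - (\<integral>x. g x * of_real (\<phi> x) + c * (h x * of_real (\<phi> x)) \<partial>lebesgue_on \<Omega>)"
    using int(1)[OF L2(3)] int(1)[OF L2(4)] by simp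
  finally show "(\<integral>x. (u x + c * v x) * of_real (frechet_derivative \<phi> (at x) b) \<partial>lebesgue_on \<Omega>) =
      - (\<integral>x. (g x + c * h x) * of_real (\<phi> x) \<partial>lebesgue_on \<Omega>)"
    by (simp add: algebra_simps)
qed

text \<open>Weak derivatives are local: a test function for U is one for \<Omega>, and it vanishes
  together with its derivative off U. With U = \<Omega> this gives uniqueness; with U the part of
  \<Omega> outside a closed patch it confines the gradient of a locally supported function.\<close>

lemma weak_partial_zero_on:
  assumes \<Omega>: "open \<Omega>" "bounded \<Omega>" and U: "open U" "U \<subseteq> \<Omega>" and b: "b \<in> Basis"
    and g: "g \<in> L2 (lebesgue_on \<Omega>)" "weak_partial \<Omega> b v g"
    and v: "v \<in> L2 (lebesgue_on \<Omega>)" "AE x in lebesgue_on \<Omega>. x \<in> U \<longrightarrow> v x = 0"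
  shows "AE x in lebesgue_on \<Omega>. x \<in> U \<longrightarrow> g x = 0"
proof -
  have sets: "\<Omega> \<in> sets lebesgue" "U \<in> sets lebesgue" using \<Omega> U by (auto simp: lborelD)
  have gU: "g \<in> L2 (lebesgue_on U)" by (rule L2_restrict_subset[OF g(1)]) (use sets U in auto)
  have "AE x in lebesgue_on U. g x = 0"
  proof (rule fundamental_lemma[OF U(1)])
    show "integrable (lebesgue_on U) g"
      using L2_integrable_bounded_domain[OF gU _ sets(2)] \<Omega> U bounded_subset by blast
    fix \<phi> assume \<phi>U: "test_function U \<phi>"
    then have \<phi>: "test_function \<Omega> \<phi>" using test_function_mono U by blast
    have off: "\<phi> x = 0" "frechet_derivative \<phi> (at x) b = 0" if "x \<notin> U" for x
    proof -
      have "x \<notin> closure {x. \<phi> x \<noteq> 0}" using \<phi>U that unfolding test_function_def by blast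
      then show "\<phi> x = 0" "frechet_derivative \<phi> (at x) b = 0"
        using closure_subset[of "{x. \<phi> x \<noteq> 0}"] test_function_derivative(3)[OF \<phi> b] by auto
    qed
    have "(\<integral>x. g x * of_real (\<phi> x) \<partial>lebesgue_on U) = (\<integral>x. g x * of_real (\<phi> x) \<partial>lebesgue_on \<Omega>)"
      using sets U off by (simp add: integral_restrict_space)
        (intro Bochner_Integration.integral_cong refl, auto simp: indicator_def)
    also have "\<dots> = - (\<integral>x. v x * of_real (frechet_derivative \<phi> (at x) b) \<partial>lebesgue_on \<Omega>)"
      using g(2) \<phi> unfolding weak_partial_def by simp
    also have "(\<integral>x. v x * of_real (frechet_derivative \<phi> (at x) b) \<partial>lebesgue_on \<Omega>) = 0"
    proof (rule integral_eq_zero_AE)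
      show "AE x in lebesgue_on \<Omega>. v x * complex_of_real (frechet_derivative \<phi> (at x) b) = 0"
        using v(2) by eventually_elim (use off in auto)
    qed
    finally show "(\<integral>x. g x * of_real (\<phi> x) \<partial>lebesgue_on U) = 0" by simp
  qed
  then have "AE x in lebesgue. x \<in> U \<longrightarrow> g x = 0" using sets by (simp add: AE_restrict_space_iff)
  then have "AE x in lebesgue. x \<in> \<Omega> \<longrightarrow> x \<in> U \<longrightarrow> g x = 0" by eventually_elim blast
  then show ?thesis using sets by (simp add: AE_restrict_space_iff)
qed

lemma
  assumes "v \<in> W12 \<Omega>" "b \<in> Basis"
  shows wgrad_L2: "wgrad \<Omega> v b \<in> L2 (lebesgue_on \<Omega>)"
    and wgrad_weak_partial: "weak_partial \<Omega> b v (wgrad \<Omega> v b)"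
proof -
  have "\<exists>g. g \<in> L2 (lebesgue_on \<Omega>) \<and> weak_partial \<Omega> b v g"
    using assms unfolding W12_def by blast
  from someI_ex[OF this] show "wgrad \<Omega> v b \<in> L2 (lebesgue_on \<Omega>)" "weak_partial \<Omega> b v (wgrad \<Omega> v b)"
    unfolding wgrad_def by blast+
qed

lemma W12_L2: "v \<in> W12 \<Omega> \<Longrightarrow> v \<in> L2 (lebesgue_on \<Omega>)"
  by (simp add: W12_def)

lemma W12I:
  assumes "v \<in> L2 (lebesgue_on \<Omega>)"
    and "\<And>b. b \<in> Basis \<Longrightarrow> g b \<in> L2 (lebesgue_on \<Omega>)" "\<And>b. b \<in> Basis \<Longrightarrow> weak_partial \<Omega> b v (g b)"
  shows "v \<in> W12 \<Omega>"
  using assms unfolding W12_def by blast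

lemma fun_subspace_W12:
  assumes "bounded \<Omega>" "\<Omega> \<in> sets lebesgue"
  shows "fun_subspace (W12 \<Omega>)"
  unfolding fun_subspace_def
proof (intro conjI ballI allI)
  show "(\<lambda>_. 0) \<in> W12 \<Omega>"
    by (rule W12I[where g = "\<lambda>_ _. 0"])
       (simp_all add: fun_subspace_zero[OF fun_subspace_L2] weak_partial_def)
  fix u v c assume uv: "u \<in> W12 \<Omega>" "v \<in> W12 \<Omega>"
  show "(\<lambda>x. u x + c * v x) \<in> W12 \<Omega>"
  proof (rule W12I[where g = "\<lambda>b x. wgrad \<Omega> u b x + c * wgrad \<Omega> v b x"])
    show "(\<lambda>x. u x + c * v x) \<in> L2 (lebesgue_on \<Omega>)"
      by (rule fun_subspace_lin[OF fun_subspace_L2 W12_L2[OF uv(1)] W12_L2[OF uv(2)]])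
    fix b :: 'a assume b: "b \<in> Basis"
    show "(\<lambda>x. wgrad \<Omega> u b x + c * wgrad \<Omega> v b x) \<in> L2 (lebesgue_on \<Omega>)"
      by (rule fun_subspace_lin[OF fun_subspace_L2 wgrad_L2[OF uv(1) b] wgrad_L2[OF uv(2) b]])
    show "weak_partial \<Omega> b (\<lambda>x. u x + c * v x) (\<lambda>x. wgrad \<Omega> u b x + c * wgrad \<Omega> v b x)"
      by (rule weak_partial_lin[OF assms b W12_L2[OF uv(1)] W12_L2[OF uv(2)] wgrad_L2[OF uv(1) b]
            wgrad_L2[OF uv(2) b] wgrad_weak_partial[OF uv(1) b] wgrad_weak_partial[OF uv(2) b]])
  qed
qed

text \<open>\<open>wgrad\<close> is an arbitrary choice, so linearity has to come from uniqueness: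
  the difference of the two sides is a weak derivative of 0.\<close>

lemma wgrad_lin:
  assumes \<Omega>: "open \<Omega>" "bounded \<Omega>" and uv: "u \<in> W12 \<Omega>" "v \<in> W12 \<Omega>" and b: "b \<in> Basis"
  shows "AE x in lebesgue_on \<Omega>. wgrad \<Omega> (\<lambda>x. u x + c * v x) b x = wgrad \<Omega> u b x + c * wgrad \<Omega> v b x"
proof -
  have sets: "\<Omega> \<in> sets lebesgue" using \<Omega> by (simp add: lborelD)
  let ?w = "\<lambda>x. u x + c * v x" and ?g = "\<lambda>x. wgrad \<Omega> u b x + c * wgrad \<Omega> v b x"
  have w: "?w \<in> W12 \<Omega>" using fun_subspace_lin[OF fun_subspace_W12[OF \<Omega>(2) sets] uv] .
  have g: "?g \<in> L2 (lebesgue_on \<Omega>)"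
    by (rule fun_subspace_lin[OF fun_subspace_L2 wgrad_L2[OF uv(1) b] wgrad_L2[OF uv(2) b]])
  have wp: "weak_partial \<Omega> b ?w ?g"
    by (rule weak_partial_lin[OF \<Omega>(2) sets b W12_L2[OF uv(1)] W12_L2[OF uv(2)] wgrad_L2[OF uv(1) b]
          wgrad_L2[OF uv(2) b] wgrad_weak_partial[OF uv(1) b] wgrad_weak_partial[OF uv(2) b]])
  let ?d = "\<lambda>x. wgrad \<Omega> ?w b x + (-1) * ?g x"
  have 1: "weak_partial \<Omega> b (\<lambda>x. ?w x + (-1) * ?w x) ?d"
    by (rule weak_partial_lin[OF \<Omega>(2) sets b W12_L2[OF w] W12_L2[OF w] wgrad_L2[OF w b] g wgrad_weak_partial[OF w b] wp])
  have 2: "?d \<in> L2 (lebesgue_on \<Omega>)" by (rule fun_subspace_lin[OF fun_subspace_L2 wgrad_L2[OF w b] g])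
  have 3: "(\<lambda>x. ?w x + (-1) * ?w x) \<in> L2 (lebesgue_on \<Omega>)"
    by (rule fun_subspace_lin[OF fun_subspace_L2 W12_L2[OF w] W12_L2[OF w]])
  have eq: "r = s" if "r + (-1) * s = 0" for r s :: complex using that by simp
  have 4: "AE x in lebesgue_on \<Omega>. x \<in> \<Omega> \<longrightarrow> ?w x + (-1) * ?w x = 0" by simp
  have "AE x in lebesgue_on \<Omega>. x \<in> \<Omega> \<longrightarrow> ?d x = 0"
    by (rule weak_partial_zero_on[OF \<Omega> \<Omega>(1) order_refl b 2 1 3 4])
  moreover note AE_space[of "lebesgue_on \<Omega>"]
  ultimately show ?thesis by eventually_elim (rule eq, simp)
qed

section \<open>Lipschitz domains and meshes\<close>

text \<open>The points strictly below the graph form an open set that misses \<Omega>. So closure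
  points lie on or above the graph, and boundary points lie on it.\<close>

lemma lipschitz_domain_graph:
  fixes \<Omega> :: "'a::euclidean_space set"
  assumes "lipschitz_domain \<Omega>" "p \<in> frontier \<Omega>"
  obtains U e L and \<phi> :: "'a \<Rightarrow> real"
  where "open U" "p \<in> U" "norm e = 1" "L-lipschitz_on UNIV \<phi>"
    "\<Omega> \<inter> U = {x\<in>U. \<phi> (x - (x \<bullet> e) *\<^sub>R e) < x \<bullet> e}"
    "\<And>x. x \<in> U \<Longrightarrow> x \<in> frontier \<Omega> \<Longrightarrow> \<phi> (x - (x \<bullet> e) *\<^sub>R e) = x \<bullet> e"
    "\<And>x. x \<in> U \<Longrightarrow> x \<in> closure \<Omega> \<Longrightarrow> \<phi> (x - (x \<bullet> e) *\<^sub>R e) \<le> x \<bullet> e"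
proof -
  obtain U e L and \<phi> :: "'a \<Rightarrow> real" where U: "open U" "p \<in> U" "norm e = 1" "L-lipschitz_on UNIV \<phi>"
    and eq: "\<Omega> \<inter> U = {x\<in>U. \<phi> (x - (x \<bullet> e) *\<^sub>R e) < x \<bullet> e}"
    using assms unfolding lipschitz_domain_def by meson
  have cont: "continuous_on UNIV (\<lambda>x. \<phi> (x - (x \<bullet> e) *\<^sub>R e))"
    by (intro continuous_on_compose2[OF lipschitz_on_continuous_on[OF U(4)]] continuous_intros) auto
  have cl: "\<phi> (x - (x \<bullet> e) *\<^sub>R e) \<le> x \<bullet> e" if x: "x \<in> U" "x \<in> closure \<Omega>" for x
  proof (rule ccontr)
    assume "\<not> \<phi> (x - (x \<bullet> e) *\<^sub>R e) \<le> x \<bullet> e"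
    moreover have "open {x. x \<bullet> e < \<phi> (x - (x \<bullet> e) *\<^sub>R e)}"
      by (rule open_Collect_less) (use cont in \<open>auto intro!: continuous_intros\<close>)
    ultimately have "open (U \<inter> {x. x \<bullet> e < \<phi> (x - (x \<bullet> e) *\<^sub>R e)})"
      "x \<in> U \<inter> {x. x \<bullet> e < \<phi> (x - (x \<bullet> e) *\<^sub>R e)}" using U(1) x(1) by auto
    then obtain y where "y \<in> \<Omega>" "y \<in> U" "y \<bullet> e < \<phi> (y - (y \<bullet> e) *\<^sub>R e)"
      using x(2) open_Int_closure_eq_empty[of "U \<inter> {x. x \<bullet> e < \<phi> (x - (x \<bullet> e) *\<^sub>R e)}" \<Omega>] by blast
    moreover from this have "y \<in> {x\<in>U. \<phi> (x - (x \<bullet> e) *\<^sub>R e) < x \<bullet> e}" using eq by blast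
    ultimately show False by simp
  qed
  have fr: "\<phi> (x - (x \<bullet> e) *\<^sub>R e) = x \<bullet> e" if x: "x \<in> U" "x \<in> frontier \<Omega>" for x
  proof -
    have "x \<notin> \<Omega>" using x assms(1) unfolding lipschitz_domain_def frontier_def by (auto simp: interior_open)
    then have "\<not> \<phi> (x - (x \<bullet> e) *\<^sub>R e) < x \<bullet> e" using eq x(1) by blast
    then show ?thesis using cl[OF x(1)] x(2) unfolding frontier_def by force
  qed
  show ?thesis by (rule that[OF U eq fr cl])
qed

text \<open>A domain that lies locally above a graph has no slits: a small step from a boundary
  point against the direction e leaves the closure. Consequently every cell has its interior in
  \<Omega>.\<close>

lemma interior_closure_lipschitz_domain:
  assumes "lipschitz_domain \<Omega>"
  shows "interior (closure \<Omega>) = \<Omega>"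
proof
  have "open \<Omega>" using assms by (simp add: lipschitz_domain_def)
  then show "\<Omega> \<subseteq> interior (closure \<Omega>)" by (simp add: closure_subset interior_maximal)
  show "interior (closure \<Omega>) \<subseteq> \<Omega>"
  proof
    fix p assume p: "p \<in> interior (closure \<Omega>)"
    show "p \<in> \<Omega>"
    proof (rule ccontr)
      assume "p \<notin> \<Omega>"
      then have fr: "p \<in> frontier \<Omega>"
        using p interior_subset[of "closure \<Omega>"] \<open>open \<Omega>\<close> by (auto simp: frontier_def interior_open)
      from assms fr obtain U e L and \<phi> :: "'a \<Rightarrow> real"
        where U: "open U" "p \<in> U" "norm e = 1"
          "\<And>x. x \<in> U \<Longrightarrow> x \<in> frontier \<Omega> \<Longrightarrow> \<phi> (x - (x \<bullet> e) *\<^sub>R e) = x \<bullet> e"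
          "\<And>x. x \<in> U \<Longrightarrow> x \<in> closure \<Omega> \<Longrightarrow> \<phi> (x - (x \<bullet> e) *\<^sub>R e) \<le> x \<bullet> e"
        by (rule lipschitz_domain_graph) blast
      have "open (U \<inter> interior (closure \<Omega>))" "p \<in> U \<inter> interior (closure \<Omega>)" using U p by auto
      then obtain r where r: "r > 0" "ball p r \<subseteq> U \<inter> interior (closure \<Omega>)"
        by (meson open_contains_ball)
      define y where "y = p - (r / 2) *\<^sub>R e"
      have "y \<in> ball p r" using r U(3) by (simp add: y_def dist_norm)
      then have y: "y \<in> U" "y \<in> closure \<Omega>" using r interior_subset by blast+
      have ee: "e \<bullet> e = 1" using U(3) by (simp add: dot_square_norm)
      have "y - (y \<bullet> e) *\<^sub>R e = p - (p \<bullet> e) *\<^sub>R e"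
        by (simp add: y_def inner_diff_left ee scaleR_diff_left)
      moreover have "y \<bullet> e = p \<bullet> e - r / 2" by (simp add: y_def inner_diff_left ee)
      ultimately show False using U(5)[OF y] U(4)[OF U(2) fr] r(1) by simp
    qed
  qed
qed

text \<open>Locally the boundary is contained in the image of the hyperplane orthogonal to e under
  the Lipschitz map sending x to x + \<phi> x e.\<close>

lemma negligible_frontier_lipschitz_domain:
  fixes \<Omega> :: "'a::euclidean_space set"
  assumes "lipschitz_domain \<Omega>"
  shows "negligible (frontier \<Omega>)"
proof (rule iffD2[OF locally_negligible_alt], rule ballI)
  fix p assume fr: "p \<in> frontier \<Omega>"
  from assms fr obtain U e L and \<phi> :: "'a \<Rightarrow> real"
    where U: "open U" "p \<in> U" "norm e = 1" "L-lipschitz_on UNIV \<phi>"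
      "\<And>x. x \<in> U \<Longrightarrow> x \<in> frontier \<Omega> \<Longrightarrow> \<phi> (x - (x \<bullet> e) *\<^sub>R e) = x \<bullet> e"
    by (rule lipschitz_domain_graph) blast
  define f where "f x = x + \<phi> x *\<^sub>R e" for x
  have ne: "e \<noteq> 0" using U(3) by auto
  have ee: "e \<bullet> e = 1" using U(3) by (simp add: dot_square_norm)
  have "negligible (f ` {x. e \<bullet> x = 0})"
  proof (rule negligible_locally_Lipschitz_image)
    show "negligible {x. e \<bullet> x = 0}" using ne by (simp add: negligible_hyperplane)
    fix x assume "x \<in> {x. e \<bullet> x = 0}"
    have "norm (f y - f x) \<le> (1 + L) * norm (y - x)" for y
    proof -
      have "norm (f y - f x) \<le> norm (y - x) + norm ((\<phi> y - \<phi> x) *\<^sub>R e)"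
        using norm_triangle_ineq[of "y - x" "(\<phi> y - \<phi> x) *\<^sub>R e"] by (simp add: f_def algebra_simps)
      also have "norm ((\<phi> y - \<phi> x) *\<^sub>R e) \<le> L * norm (y - x)"
        using lipschitz_onD[OF U(4), of y x] U(3) by (simp add: dist_norm)
      finally show ?thesis by (simp add: algebra_simps)
    qed
    then show "\<exists>T B. open T \<and> x \<in> T \<and> (\<forall>y\<in>{x. e \<bullet> x = 0} \<inter> T. norm (f y - f x) \<le> B * norm (y - x))"
      by (intro exI[of _ UNIV] exI[of _ "1 + L"]) auto
  qed simp
  moreover have "frontier \<Omega> \<inter> U \<subseteq> f ` {x. e \<bullet> x = 0}"
  proof
    fix x assume x: "x \<in> frontier \<Omega> \<inter> U"
    have "x = f (x - (x \<bullet> e) *\<^sub>R e)" using U(5) x by (simp add: f_def)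
    moreover have "e \<bullet> (x - (x \<bullet> e) *\<^sub>R e) = 0" by (simp add: inner_diff_right ee inner_commute)
    ultimately show "x \<in> f ` {x. e \<bullet> x = 0}" by blast
  qed
  ultimately show "\<exists>V. openin (top_of_set (frontier \<Omega>)) V \<and> p \<in> V \<and> negligible V"
    using U(1,2) fr by (intro exI[of _ "frontier \<Omega> \<inter> U"]) (auto intro: negligible_subset openin_open_Int)
qed

section \<open>Parallelepipeds and common facets of convex bodies\<close>

lemma ref_map_bij:
  assumes "ref_map p F T"
  shows "linear F" "inj F" "surj F"
  using assms linear_injective_imp_surjective unfolding ref_map_def by blast+

lemma ref_map_geometry:
  fixes T :: "'a::euclidean_space set"
  assumes "ref_map p F T"
  shows "polytope T" "interior T \<noteq> {}"
proof -
  have T: "linear F" "inj F" "T = (\<lambda>x. p + x) ` F ` cbox 0 One"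
    using assms by (auto simp: ref_map_def image_image)
  show "polytope T" unfolding T(3)
    by (simp add: polytope_translation_eq polytope_linear_image[OF T(1)] polytope_interval)
  have "interior T = (\<lambda>x. p + x) ` F ` interior (cbox 0 One)"
    unfolding T(3) interior_translation using interior_injective_linear_image[OF T(1,2)] by simp
  moreover have "interior (cbox 0 (One::'a)) \<noteq> {}"
    using box_ne_empty(2)[of 0 "One::'a"] by (simp add: interior_cbox)
  ultimately show "interior T \<noteq> {}" by simp
qed

text \<open>The cone with apex p over F contains the half ball. Projecting y from p to the
  hyperplane is continuous near x and fixes x, so the image of a nearby y stays in F, and y lies on
  the segment between that image and p.\<close>

lemma half_ball_subset:
  fixes T :: "'a::euclidean_space set"
  assumes "convex T" "F \<subseteq> T" "p \<in> T" "x \<in> rel_interior F"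
    and hull: "affine hull F = {y. a \<bullet> y = b}" and p: "a \<bullet> p < b"
  obtains r where "r > 0" "\<And>y. dist y x < r \<Longrightarrow> a \<bullet> y \<le> b \<Longrightarrow> y \<in> T"
proof -
  obtain e where e: "e > 0" "ball x e \<inter> affine hull F \<subseteq> F" and xF: "x \<in> F"
    using assms(4) by (auto simp: mem_rel_interior_ball)
  have xb: "a \<bullet> x = b" using hull_inc[of x F affine] xF hull by simp
  \<comment> \<open>Chosen so that y = (1 - s y) q y + s y p with q y in the hyperplane.\<close>
  define s where "s y = (b - a \<bullet> y) / (b - a \<bullet> p)" for y
  define q where "q y = (1 / (1 - s y)) *\<^sub>R (y - s y *\<^sub>R p)" for y
  have s0: "s x = 0" by (simp add: s_def xb)
  have cs: "isCont s x" unfolding s_def using p by (intro continuous_intros) auto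
  have cq: "isCont q x" unfolding q_def using s0 by (intro continuous_intros cs) auto
  have qx: "q x = x" by (simp add: q_def s0)
  obtain r1 where r1: "r1 > 0" "\<And>y. dist y x < r1 \<Longrightarrow> dist (s y) (s x) < 1"
    using cs unfolding continuous_at_eps_delta by (metis zero_less_one)
  obtain r2 where r2: "r2 > 0" "\<And>y. dist y x < r2 \<Longrightarrow> dist (q y) (q x) < e"
    using cq e(1) unfolding continuous_at_eps_delta by metis
  show ?thesis
  proof (rule that)
    show "min r1 r2 > 0" using r1 r2 by simp
    fix y assume y: "dist y x < min r1 r2" "a \<bullet> y \<le> b"
    have sy: "0 \<le> s y" "s y < 1"
      using y(2) p r1(2)[of y] y(1) s0 by (auto simp: s_def dist_real_def)
    have b: "a \<bullet> y = b - s y * (b - a \<bullet> p)" using p by (simp add: s_def)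
    have "a \<bullet> q y = (a \<bullet> y - s y * (a \<bullet> p)) / (1 - s y)"
      by (simp add: q_def inner_diff_right)
    also have "\<dots> = b" using sy b by (simp add: field_simps)
    finally have "q y \<in> affine hull F" using hull by simp
    moreover have "q y \<in> ball x e" using r2(2)[of y] y(1) qx by (simp add: dist_commute)
    ultimately have "q y \<in> T" using e assms(2) by blast
    then have "(1 - s y) *\<^sub>R q y + s y *\<^sub>R p \<in> T"
      using assms(1,3) sy by (intro convexD) auto
    moreover have "(1 - s y) *\<^sub>R q y + s y *\<^sub>R p = y" using sy by (simp add: q_def)
    ultimately show "y \<in> T" by simp
  qed
qed

text \<open>The two bodies must lie on opposite sides of the hyperplane of their intersection: on
  the same side, a half ball would belong to both and leave the hyperplane. Two opposite half balls
  fill a ball.\<close>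

lemma rel_interior_common_facet:
  fixes T K :: "'a::euclidean_space set"
  assumes T: "convex T" "interior T \<noteq> {}" and K: "convex K" "interior K \<noteq> {}"
    and dim: "aff_dim (T \<inter> K) = DIM('a) - 1" and x: "x \<in> rel_interior (T \<inter> K)"
  shows "x \<in> interior (T \<union> K)"
proof -
  obtain a b where a: "a \<noteq> 0" "affine hull (T \<inter> K) = {y. a \<bullet> y = b}"
    using iffD1[OF aff_dim_eq_hyperplane dim] by blast
  have off: "\<exists>p\<in>S. a \<bullet> p \<noteq> b" if "interior S \<noteq> {}" for S
  proof (rule ccontr)
    assume "\<not> ?thesis"
    then have "S \<subseteq> {y. a \<bullet> y = b}" by blast
    then show False using that a(1) interior_hyperplane interior_mono by blast
  qed
  obtain p where p: "p \<in> T" "a \<bullet> p \<noteq> b" using off[OF T(2)] by blast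
  obtain q where q: "q \<in> K" "a \<bullet> q \<noteq> b" using off[OF K(2)] by blast
  have xb: "a \<bullet> x = b"
    using hull_inc[of x "T \<inter> K" affine] subsetD[OF rel_interior_subset x] a(2) by simp
  have a': "affine hull (T \<inter> K) = {y. (- a) \<bullet> y = - b}" using a(2) by simp
  have sub: "T \<inter> K \<subseteq> {y. a \<bullet> y = b}" using a(2) hull_subset by metis
  \<comment> \<open>The sign c selects the side on which the half ball is supposed to lie in both
    bodies.\<close>
  have one_side: False
    if "r > 0" "\<And>y. dist y x < r \<Longrightarrow> c * (a \<bullet> y) \<le> c * b \<Longrightarrow> y \<in> T \<inter> K" "c = 1 \<or> c = -1" for r c
  proof -
    define y where "y = x - (c * r / (2 * norm a)) *\<^sub>R a"
    have "dist y x < r" using that(1,3) a(1) by (auto simp: y_def dist_norm abs_mult)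
    moreover have "a \<bullet> y = b - c * r / (2 * norm a) * (a \<bullet> a)" by (simp add: y_def inner_diff_right xb)
    moreover have "r / (2 * norm a) * (a \<bullet> a) > 0" using that(1) a(1) by simp
    ultimately show False using that(2)[of y] that(3) sub by fastforce
  qed
  have lower: "\<exists>r>0. \<forall>y. dist y x < r \<longrightarrow> a \<bullet> y \<le> b \<longrightarrow> y \<in> S"
    if "convex S" "T \<inter> K \<subseteq> S" "p \<in> S" "a \<bullet> p < b" for S p
    using half_ball_subset[OF that(1-3) x a(2) that(4)] by metis
  have upper: "\<exists>r>0. \<forall>y. dist y x < r \<longrightarrow> b \<le> a \<bullet> y \<longrightarrow> y \<in> S"
    if "convex S" "T \<inter> K \<subseteq> S" "p \<in> S" "b < a \<bullet> p" for S p
    using half_ball_subset[OF that(1-3) x a'] that(4) by (metis inner_minus_left neg_le_iff_le neg_less_iff_less)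
  have both: ?thesis if S: "\<exists>r>0. \<forall>y. dist y x < r \<longrightarrow> a \<bullet> y \<le> b \<longrightarrow> y \<in> S"
    "\<exists>r>0. \<forall>y. dist y x < r \<longrightarrow> b \<le> a \<bullet> y \<longrightarrow> y \<in> S'" "S \<union> S' = T \<union> K" for S S'
  proof -
    obtain r1 r2 where r: "r1 > 0" "\<forall>y. dist y x < r1 \<longrightarrow> a \<bullet> y \<le> b \<longrightarrow> y \<in> S"
      "r2 > 0" "\<forall>y. dist y x < r2 \<longrightarrow> b \<le> a \<bullet> y \<longrightarrow> y \<in> S'" using S by blast
    have "ball x (min r1 r2) \<subseteq> T \<union> K"
    proof
      fix y assume "y \<in> ball x (min r1 r2)"
      then have "y \<in> S \<union> S'" using r linear[of "a \<bullet> y" b] by (auto simp: dist_commute)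
      then show "y \<in> T \<union> K" using S(3) by blast
    qed
    then show ?thesis unfolding mem_interior using r by (meson min_less_iff_conj)
  qed
  consider "a \<bullet> p < b" "a \<bullet> q < b" | "a \<bullet> p < b" "a \<bullet> q > b" | "a \<bullet> p > b" "a \<bullet> q < b" | "a \<bullet> p > b" "a \<bullet> q > b"
    using p(2) q(2) by linarith
  then show ?thesis
  proof cases
    case 1
    obtain r1 r2 where "r1 > 0" "\<forall>y. dist y x < r1 \<longrightarrow> a \<bullet> y \<le> b \<longrightarrow> y \<in> T"
      "r2 > 0" "\<forall>y. dist y x < r2 \<longrightarrow> a \<bullet> y \<le> b \<longrightarrow> y \<in> K"
      using lower[OF T(1) _ p(1) 1(1)] lower[OF K(1) _ q(1) 1(2)] by auto
    then show ?thesis using one_side[of "min r1 r2" 1] by simp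
  next
    case 4
    obtain r1 r2 where "r1 > 0" "\<forall>y. dist y x < r1 \<longrightarrow> b \<le> a \<bullet> y \<longrightarrow> y \<in> T"
      "r2 > 0" "\<forall>y. dist y x < r2 \<longrightarrow> b \<le> a \<bullet> y \<longrightarrow> y \<in> K"
      using upper[OF T(1) _ p(1) 4(1)] upper[OF K(1) _ q(1) 4(2)] by auto
    then show ?thesis using one_side[of "min r1 r2" "-1"] by simp
  next
    case 2
    show ?thesis by (rule both[OF lower[OF T(1) _ p(1) 2(1)] upper[OF K(1) _ q(1) 2(2)]]) auto
  next
    case 3
    show ?thesis by (rule both[OF lower[OF K(1) _ q(1) 3(2)] upper[OF T(1) _ p(1) 3(1)]]) auto
  qed
qed

section \<open>Null sets of the surface measure\<close>

lemma sets_hausdorff_measure: "sets (hausdorff_measure s) = sets borel"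
  and space_hausdorff_measure: "space (hausdorff_measure s) = UNIV"
  using sets.sigma_sets_eq[of borel] by (simp_all add: hausdorff_measure_def)

lemma hausdorff_null_setI:
  fixes S :: "'a::euclidean_space set"
  assumes "S \<in> sets borel" "\<And>\<delta>. \<delta> > 0 \<Longrightarrow> hausdorff_pre s \<delta> S = 0"
  shows "S \<in> null_sets (hausdorff_measure s)"
proof -
  have "(SUP \<delta>\<in>{0<..}. hausdorff_pre s \<delta> S) = 0" using assms(2) by simp
  then have "emeasure (hausdorff_measure s) S = 0"
    using assms(1) sets.sigma_sets_eq[of borel] by (simp add: hausdorff_measure_def emeasure_measure_of_conv)
  then show ?thesis using assms(1) by (simp add: null_sets_def sets_hausdorff_measure)
qed

lemma hausdorff_null_set_point:
  assumes "s > 0"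
  shows "{p} \<in> null_sets (hausdorff_measure s)"
proof (rule hausdorff_null_setI)
  fix \<delta> :: real assume "\<delta> > 0"
  define E where "E i = (if i = 0 then {p} else {})" for i :: nat
  have "hausdorff_pre s \<delta> {p} \<le> (\<Sum>i. ennreal (if E i = {} then 0
                     else unit_ball_vol (real s) * (diameter (E i) / 2) ^ s))"
    unfolding hausdorff_pre_def by (rule INF_lower) (use \<open>\<delta> > 0\<close> in \<open>auto simp: E_def\<close>)
  also have "\<dots> = (\<Sum>i. 0)"
    by (intro suminf_cong) (use assms in \<open>auto simp: E_def\<close>)
  finally show "hausdorff_pre s \<delta> {p} = 0" by simp
qed simp

text \<open>Capping the floor of u n at n - 1 puts the end point u = 1 into the last cell.\<close>

lemma unit_interval_cell:
  fixes u :: real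
  assumes "0 \<le> u" "u \<le> 1" "n > 0"
  shows "\<exists>i<n. real i \<le> u * real n \<and> u * real n \<le> real i + 1"
proof (intro exI[of _ "min (nat \<lfloor>u * real n\<rfloor>) (n - 1)"] conjI)
  have "real (nat \<lfloor>u * real n\<rfloor>) \<le> u * real n" using assms by simp
  then show "real (min (nat \<lfloor>u * real n\<rfloor>) (n - 1)) \<le> u * real n" by linarith
  have "u * real n \<le> real n" using assms by (simp add: mult_left_le_one_le)
  moreover have "u * real n \<le> real (nat \<lfloor>u * real n\<rfloor>) + 1" using assms by linarith
  ultimately show "u * real n \<le> real (min (nat \<lfloor>u * real n\<rfloor>) (n - 1)) + 1"
    using assms(3) by (auto simp: min_def of_nat_diff)
qed (use assms(3) in simp)

text \<open>N pieces of length l / N contribute a multiple of N (l / N) ^ s, which tends to 0 for s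
  at least 2.\<close>

lemma hausdorff_null_set_segment:
  fixes c d :: "'a::euclidean_space"
  assumes "s \<ge> 2"
  shows "closed_segment c d \<in> null_sets (hausdorff_measure s)"
proof (rule hausdorff_null_setI)
  fix \<delta> :: real assume \<delta>: "\<delta> > 0"
  define l where "l = norm (d - c)"
  define f where "f N = real N * (unit_ball_vol (real s) * (l / real N / 2) ^ s)" for N
  have bound: "hausdorff_pre s \<delta> (closed_segment c d) \<le> ennreal (f N)"
    if N: "N > 0" "l / real N \<le> \<delta>" for N
  proof -
    define g where "g i = c + (real i / real N) *\<^sub>R (d - c)" for i
    define E where "E i = (if i < N then closed_segment (g i) (g (Suc i)) else {})" for i
    have dg: "g (Suc i) - g i = (1 / real N) *\<^sub>R (d - c)" for i
      by (simp add: g_def diff_divide_distrib[symmetric] flip: scaleR_diff_left)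
    have diam: "diameter (E i) \<le> l / real N" for i
    proof (cases "i < N")
      case True
      have "diameter (closed_segment (g i) (g (Suc i))) \<le> norm (g (Suc i) - g i)"
      proof (rule diameter_le)
        fix x y assume "x \<in> closed_segment (g i) (g (Suc i))" "y \<in> closed_segment (g i) (g (Suc i))"
        then obtain s t where st: "0 \<le> s" "s \<le> 1" "0 \<le> t" "t \<le> 1"
          "x = (1 - s) *\<^sub>R g i + s *\<^sub>R g (Suc i)" "y = (1 - t) *\<^sub>R g i + t *\<^sub>R g (Suc i)"
          by (auto simp: in_segment)
        have "x - y = (s - t) *\<^sub>R (g (Suc i) - g i)" unfolding st(5,6) by (simp add: algebra_simps)
        then show "norm (x - y) \<le> norm (g (Suc i) - g i)"
          using st(1-4) by (simp add: mult_left_le_one_le abs_le_iff)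
      qed simp
      then show ?thesis using True by (simp add: E_def dg l_def)
    qed (simp add: E_def l_def)
    have cover: "closed_segment c d \<subseteq> (\<Union>i. E i)"
    proof
      fix x assume "x \<in> closed_segment c d"
      then obtain u where u: "0 \<le> u" "u \<le> 1" "x = (1 - u) *\<^sub>R c + u *\<^sub>R d"
        by (auto simp: in_segment)
      then have x: "x = c + u *\<^sub>R (d - c)" by (simp add: algebra_simps)
      obtain i where i: "i < N" "real i \<le> u * real N" "u * real N \<le> real i + 1"
        using unit_interval_cell[OF u(1,2) N(1)] by blast
      define t where "t = u * real N - real i"
      have t: "0 \<le> t" "t \<le> 1" using i by (auto simp: t_def)
      have "u = real i / real N + t / real N" using N by (simp add: t_def field_simps)
      then have "x = g i + t *\<^sub>R (g (Suc i) - g i)" unfolding dg x by (simp add: g_def scaleR_add_left)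
      then have "x = (1 - t) *\<^sub>R g i + t *\<^sub>R g (Suc i)" by (simp add: algebra_simps)
      then have "x \<in> E i" using t i(1) by (auto simp: E_def in_segment)
      then show "x \<in> (\<Union>i. E i)" by blast
    qed
    have "hausdorff_pre s \<delta> (closed_segment c d) \<le> (\<Sum>i. ennreal (if E i = {} then 0
                     else unit_ball_vol (real s) * (diameter (E i) / 2) ^ s))"
      unfolding hausdorff_pre_def
    proof (rule INF_lower, simp only: mem_Collect_eq, intro conjI allI cover)
      show bE: "bounded (E i)" for i by (simp add: E_def compact_imp_bounded)
      show "diameter (E i) \<le> \<delta>" for i using diam[of i] N(2) by linarith
    qed
    also have "\<dots> = (\<Sum>i<N. ennreal (if E i = {} then 0
                     else unit_ball_vol (real s) * (diameter (E i) / 2) ^ s))"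
      by (rule suminf_finite[of "{..<N}"]) (simp_all add: E_def)
    also have "\<dots> \<le> (\<Sum>i<N. ennreal (unit_ball_vol (real s) * (l / real N / 2) ^ s))"
    proof (intro sum_mono ennreal_leI)
      fix i
      have "(diameter (E i) / 2) ^ s \<le> (l / real N / 2) ^ s"
        using diam[of i] diameter_ge_0[of "E i"] by (intro power_mono) (simp_all add: E_def compact_imp_bounded)
      then have "unit_ball_vol (real s) * (diameter (E i) / 2) ^ s \<le> unit_ball_vol (real s) * (l / real N / 2) ^ s"
        by (intro mult_left_mono) simp_all
      moreover have "0 \<le> unit_ball_vol (real s) * (l / real N / 2) ^ s" by (simp add: l_def)
      ultimately show "(if E i = {} then 0 else unit_ball_vol (real s) * (diameter (E i) / 2) ^ s)
          \<le> unit_ball_vol (real s) * (l / real N / 2) ^ s" by (cases "E i = {}") simp_all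
    qed
    also have "\<dots> = ennreal (f N)"
      by (simp add: f_def l_def ennreal_mult ennreal_of_nat_eq_real_of_nat)
    finally show ?thesis .
  qed
  have f_eq: "f = (\<lambda>N. unit_ball_vol (real s) * (l / 2) ^ s * (real N / real N ^ s))"
    by (simp add: f_def power_divide fun_eq_iff mult.commute mult.left_commute)
  have "(\<lambda>N. real N / real N ^ s) \<longlonglongrightarrow> 0"
  proof (rule tendsto_sandwich[OF _ _ tendsto_const lim_1_over_n])
    show "\<forall>\<^sub>F N in sequentially. real N / real N ^ s \<le> 1 / real N"
      using eventually_gt_at_top[of 0]
    proof eventually_elim
      case (elim N)
      have "real N ^ 2 \<le> real N ^ s" using elim assms by (intro power_increasing) auto
      then have "real N / real N ^ s \<le> real N / real N ^ 2" using elim by (intro divide_left_mono) auto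
      also have "\<dots> = 1 / real N" using elim by (simp add: power2_eq_square)
      finally show ?case .
    qed
  qed auto
  from tendsto_mult_left[OF this, of "unit_ball_vol (real s) * (l / 2) ^ s"]
  have lim: "f \<longlonglongrightarrow> 0" unfolding f_eq by simp
  have "(\<lambda>N. l / real N) \<longlonglongrightarrow> 0" by (rule lim_const_over_n)
  then have "\<forall>\<^sub>F N in sequentially. l / real N < \<delta>" using \<delta> by (rule order_tendstoD(2))
  then have "\<forall>\<^sub>F N in sequentially. hausdorff_pre s \<delta> (closed_segment c d) \<le> ennreal (f N)"
    using eventually_gt_at_top[of 0] by eventually_elim (simp add: bound)
  moreover have "(\<lambda>N. ennreal (f N)) \<longlonglongrightarrow> ennreal 0" using lim by (intro tendsto_ennrealI)
  ultimately have "hausdorff_pre s \<delta> (closed_segment c d) \<le> ennreal 0"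
    by (intro tendsto_lowerbound) auto
  then show "hausdorff_pre s \<delta> (closed_segment c d) = 0" by simp
qed (rule borel_closed, rule closed_segment)

text \<open>The place where the dimension is restricted to at most 3: there a polytope of
  codimension at least two is empty, a point or a segment.\<close>

lemma hausdorff_null_set_polytope:
  fixes S :: "'a::euclidean_space set"
  assumes "polytope S" "aff_dim S \<le> int DIM('a) - 2" "DIM('a) \<le> 3"
  shows "S \<in> null_sets (hausdorff_measure (DIM('a) - 1))"
proof (cases "S = {}")
  case False
  then have "aff_dim S \<ge> 0" using aff_dim_negative_iff[of S] by linarith
  then consider "DIM('a) = 2" "aff_dim S = 0" | "DIM('a) = 3" "aff_dim S \<le> 1" using assms by linarith
  then show ?thesis
  proof cases
    case 1
    then obtain p where "S = {p}" by (auto simp: aff_dim_eq_0)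
    then show ?thesis using hausdorff_null_set_point[of 1 p] 1 by simp
  next
    case 2
    then have "collinear S" by (simp add: collinear_aff_dim)
    then obtain a b where "S = closed_segment a b"
      using compact_convex_collinear_segment False assms(1) polytope_imp_compact polytope_imp_convex by metis
    then show ?thesis using hausdorff_null_set_segment[of 2 a b] 2 by simp
  qed
qed simp

section \<open>Conforming meshes of a Lipschitz domain\<close>

locale conforming_mesh =
  fixes \<Omega> :: "'a::euclidean_space set" and \<G> \<rho> \<theta>
  assumes lip: "lipschitz_domain \<Omega>" and mesh: "mesh \<Omega> \<rho> \<theta> \<G>" and dim3: "DIM('a) \<le> 3"
begin

lemma finite_mesh: "finite \<G>"
  using mesh by (simp only: mesh_def)

lemma Union_mesh: "\<Union>\<G> = closure \<Omega>"
  using mesh by (simp only: mesh_def)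

lemma cell_ref:
  assumes "T \<in> \<G>"
  obtains p F where "ref_map p F T"
proof -
  have "\<forall>T\<in>\<G>. \<exists>p F. ref_map p F T" using mesh unfolding mesh_def by (elim conjE)
  then show ?thesis using assms that by blast
qed

lemma mesh_face: "T \<in> \<G> \<Longrightarrow> K \<in> \<G> \<Longrightarrow> (T \<inter> K) face_of T \<and> (T \<inter> K) face_of K"
proof -
  have "\<forall>T\<in>\<G>. \<forall>K\<in>\<G>. (T \<inter> K) face_of T \<and> (T \<inter> K) face_of K" using mesh unfolding mesh_def by (elim conjE)
  then show "T \<in> \<G> \<Longrightarrow> K \<in> \<G> \<Longrightarrow> (T \<inter> K) face_of T \<and> (T \<inter> K) face_of K" by blast
qed

lemma
  assumes "T \<in> \<G>"
  shows cell_polytope: "polytope T" and cell_interior: "interior T \<noteq> {}"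
proof -
  obtain p F where "ref_map p F T" using cell_ref[OF assms] .
  then show "polytope T" "interior T \<noteq> {}" by (rule ref_map_geometry)+
qed

lemma cell_convex: "T \<in> \<G> \<Longrightarrow> convex T"
  by (rule polytope_imp_convex[OF cell_polytope])

lemma cell_compact: "T \<in> \<G> \<Longrightarrow> compact T"
  by (rule polytope_imp_compact[OF cell_polytope])

lemma cell_closed: "T \<in> \<G> \<Longrightarrow> closed T"
  by (rule compact_imp_closed[OF cell_compact])

lemma cell_subset: "T \<in> \<G> \<Longrightarrow> T \<subseteq> closure \<Omega>"
  using Union_mesh by blast

lemma negligible_frontier_cell: "T \<in> \<G> \<Longrightarrow> negligible (frontier T)"
  by (simp add: cell_convex negligible_convex_frontier)

lemma mesh_nonempty: "\<G> \<noteq> {}"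
proof
  assume "\<G> = {}"
  then have "\<Omega> = {}" using Union_mesh closure_eq_empty[of \<Omega>] by simp
  then show False using lip by (simp add: lipschitz_domain_def)
qed

lemma mesh_size_pos: "mesh_size \<G> > 0"
proof -
  obtain T where T: "T \<in> \<G>" using mesh_nonempty by blast
  obtain x r where "r > 0" "ball x r \<subseteq> T" using cell_interior[OF T] mem_interior by blast
  moreover have "bounded T" using cell_compact[OF T] compact_imp_bounded by blast
  ultimately have "diameter T > 0"
    using diameter_subset[of "ball x r" T] by simp
  also have "diameter T \<le> mesh_size \<G>" unfolding mesh_size_def using T finite_mesh by simp
  finally show ?thesis .
qed

text \<open>The intersection of two distinct cells is a proper face of at least one of them.\<close>

lemma aff_dim_cell_inter:
  assumes "T \<in> \<G>" "K \<in> \<G>" "T \<noteq> K"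
  shows "aff_dim (T \<inter> K) < DIM('a)"
proof -
  have "T \<inter> K \<noteq> T \<or> T \<inter> K \<noteq> K" using assms(3) by blast
  then have "aff_dim (T \<inter> K) < aff_dim T \<or> aff_dim (T \<inter> K) < aff_dim K"
    using face_of_aff_dim_lt cell_convex mesh_face assms by metis
  then show ?thesis using aff_dim_le_DIM[of T] aff_dim_le_DIM[of K] by linarith
qed

lemma negligible_cell_inter:
  assumes "T \<in> \<G>" "K \<in> \<G>" "T \<noteq> K"
  shows "negligible (T \<inter> K)"
proof -
  have "interior (T \<inter> K) = {}"
    using aff_dim_cell_inter[OF assms] aff_dim_nonempty_interior[of "T \<inter> K"] by fastforce
  then show ?thesis
    using negligible_convex_interior[OF convex_Int[OF cell_convex[OF assms(1)] cell_convex[OF assms(2)]]] by simp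
qed

text \<open>A boundary point in the interior of a cell would be interior to the closure of \<Omega>
  and hence belong to \<Omega>.\<close>

lemma frontier_cell: "T \<in> \<G> \<Longrightarrow> frontier \<Omega> \<inter> T \<subseteq> frontier T"
proof -
  assume T: "T \<in> \<G>"
  have "interior T \<subseteq> \<Omega>"
    using interior_mono[OF cell_subset[OF T]] interior_closure_lipschitz_domain[OF lip] by simp
  moreover have "frontier \<Omega> \<inter> \<Omega> = {}" using lip by (auto simp: lipschitz_domain_def frontier_def interior_open)
  ultimately show ?thesis using closure_subset[of T] by (auto simp: frontier_def)
qed

text \<open>If the intersection has codimension one, its relative interior lies in the open domain,
  so only its own facets can touch the boundary. Otherwise it is itself small enough. In both cases
  a set of codimension at least two remains. This makes boundary integrals additive over the
  cells.\<close>

lemma surface_null_cell_inter: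
  assumes TK: "T \<in> \<G>" "K \<in> \<G>" "T \<noteq> K"
  shows "T \<inter> K \<inter> frontier \<Omega> \<in> null_sets (hausdorff_measure (DIM('a) - 1))"
proof -
  let ?F = "T \<inter> K"
  have pF: "polytope ?F"
    by (rule face_of_polytope_polytope[OF cell_polytope[OF TK(1)] conjunct1[OF mesh_face[OF TK(1,2)]]])
  have borel: "?F \<inter> frontier \<Omega> \<in> sets (hausdorff_measure (DIM('a) - 1))"
    unfolding sets_hausdorff_measure using TK cell_closed by (intro borel_closed closed_Int frontier_closed)
  show ?thesis
  proof (cases "aff_dim ?F = DIM('a) - 1")
    case True
    have "rel_interior ?F \<subseteq> \<Omega>"
    proof
      fix x assume "x \<in> rel_interior ?F"
      then have "x \<in> interior (T \<union> K)"
        using rel_interior_common_facet[OF cell_convex[OF TK(1)] cell_interior[OF TK(1)] cell_convex[OF TK(2)]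
            cell_interior[OF TK(2)] True] by simp
      moreover have "interior (T \<union> K) \<subseteq> interior (closure \<Omega>)"
        using cell_subset TK by (intro interior_mono) blast
      ultimately show "x \<in> \<Omega>" using interior_closure_lipschitz_domain[OF lip] by blast
    qed
    moreover have "frontier \<Omega> \<inter> \<Omega> = {}" using lip by (auto simp: lipschitz_domain_def frontier_def interior_open)
    ultimately have "?F \<inter> frontier \<Omega> \<subseteq> rel_frontier ?F"
      using closure_subset[of ?F] by (auto simp: rel_frontier_def)
    also have "\<dots> = \<Union> {A. A facet_of ?F}"
      by (rule rel_frontier_of_polyhedron[OF polytope_imp_polyhedron[OF pF]])
    finally have sub: "?F \<inter> frontier \<Omega> \<subseteq> \<Union> {A. A facet_of ?F}" .
    have "\<Union> {A. A facet_of ?F} \<in> null_sets (hausdorff_measure (DIM('a) - 1))"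
    proof (rule null_sets.finite_Union)
      show "finite {A. A facet_of ?F}" by (rule finite_polytope_facets[OF pF])
      show "{A. A facet_of ?F} \<subseteq> null_sets (hausdorff_measure (DIM('a) - 1))"
      proof
        fix A assume "A \<in> {A. A facet_of ?F}"
        then have "A face_of ?F" "aff_dim A = aff_dim ?F - 1" by (auto simp: facet_of_def)
        moreover have "int (DIM('a) - 1) = int DIM('a) - 1" using DIM_positive[where 'a='a] by linarith
        ultimately have "aff_dim A \<le> int DIM('a) - 2" using True by linarith
        then show "A \<in> null_sets (hausdorff_measure (DIM('a) - 1))"
          by (rule hausdorff_null_set_polytope[OF face_of_polytope_polytope[OF pF \<open>A face_of ?F\<close>] _ dim3])
      qed
    qed
    then show ?thesis by (rule null_sets_subset[OF _ borel sub])
  next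
    case False
    moreover have "int (DIM('a) - 1) = int DIM('a) - 1" using DIM_positive[where 'a='a] by linarith
    ultimately have "aff_dim ?F \<le> int DIM('a) - 2" using aff_dim_cell_inter[OF TK] by linarith
    then have "?F \<in> null_sets (hausdorff_measure (DIM('a) - 1))"
      using pF dim3 by (intro hausdorff_null_set_polytope)
    then show ?thesis by (rule null_sets_subset[OF _ borel]) blast
  qed
qed

lemma cell_subset_closure_nbhd:
  assumes "T \<in> \<G>" "T \<inter> K \<noteq> {}" "K \<in> \<G>"
  shows "T \<subseteq> closure (nbhd \<G> K)"
proof -
  have "T = closure (interior T)"
    using assms(1) cell_convex cell_interior cell_closed convex_closure_interior by (metis closure_closed)
  also have "\<dots> \<subseteq> closure (nbhd \<G> K)"
    unfolding nbhd_def using assms closure_subset[of K] by (intro closure_mono interior_mono) blast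
  finally show ?thesis .
qed

text \<open>\<open>overlap_bound\<close> counts the cells in the closure of an open patch. All cells
  meeting K are among them, because a cell is the closure of its interior.\<close>

lemma card_neighbours:
  assumes "overlap_bound \<G> Col" "K \<in> \<G>"
  shows "real (card {T\<in>\<G>. T \<inter> K \<noteq> {}}) \<le> Col 1"
proof -
  have "card {T\<in>\<G>. T \<inter> K \<noteq> {}} \<le> card {T\<in>\<G>. T \<subseteq> closure (nbhd \<G> K)}"
    using cell_subset_closure_nbhd assms(2) finite_mesh by (intro card_mono) auto
  moreover have "real (card {T\<in>\<G>. T \<subseteq> closure (nbhd \<G> K)}) \<le> Col 1"
    using assms unfolding overlap_bound_def by (auto simp: patch_def dest!: spec[of _ "1::nat"])
  ultimately show ?thesis by linarith
qed

lemma overlap_nonneg: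
  assumes "overlap_bound \<G> Col" "m \<ge> 1"
  shows "0 \<le> Col m"
proof -
  obtain T where "T \<in> \<G>" using mesh_nonempty by blast
  then have "real (card {K\<in>\<G>. K \<subseteq> closure (patch \<G> m T)}) \<le> Col m"
    using assms unfolding overlap_bound_def by blast
  then show ?thesis by linarith
qed

lemma nbhd_subset: "nbhd \<G> S \<subseteq> \<Union>{T\<in>\<G>. T \<inter> closure S \<noteq> {}}"
  unfolding nbhd_def by (rule interior_subset)

lemma open_nbhd: "open (nbhd \<G> S)"
  unfolding nbhd_def by (rule open_interior)

lemma nbhd_subset_closure: "nbhd \<G> S \<subseteq> closure \<Omega>"
  using nbhd_subset Union_mesh by blast

text \<open>Lets a gradient that vanishes off the closed patch vanish almost everywhere off the open
  one.\<close>

lemma negligible_frontier_nbhd: "negligible (frontier (nbhd \<G> S))"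
proof (rule negligible_subset)
  let ?C = "{T\<in>\<G>. T \<inter> closure S \<noteq> {}}"
  show "negligible (\<Union> (frontier ` ?C))"
    using finite_mesh negligible_frontier_cell by (intro negligible_Union) auto
  have "frontier (nbhd \<G> S) \<subseteq> frontier (\<Union>?C)" unfolding nbhd_def by (rule frontier_interior_subset)
  also have "\<dots> \<subseteq> \<Union> (frontier ` ?C)" using finite_mesh by (intro frontier_Union_subset) auto
  finally show "frontier (nbhd \<G> S) \<subseteq> \<Union> (frontier ` ?C)" .
qed

end

section \<open>Finite element spaces\<close>

definition multi_affine :: "('a::euclidean_space \<Rightarrow> complex) set" where
  "multi_affine = {g. \<exists>c. \<forall>x. g x = (\<Sum>S\<in>Pow Basis. c S * of_real (\<Prod>b\<in>S. x \<bullet> b))}"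

lemma fun_subspace_multi_affine: "fun_subspace multi_affine"
  unfolding fun_subspace_def
proof (intro conjI ballI allI)
  show "(\<lambda>_. 0) \<in> multi_affine" unfolding multi_affine_def by (intro CollectI exI[of _ "\<lambda>_. 0"]) simp
  fix u v :: "'a \<Rightarrow> complex" and k assume "u \<in> multi_affine" "v \<in> multi_affine"
  then obtain c d where "\<forall>x. u x = (\<Sum>S\<in>Pow Basis. c S * of_real (\<Prod>b\<in>S. x \<bullet> b))"
    "\<forall>x. v x = (\<Sum>S\<in>Pow Basis. d S * of_real (\<Prod>b\<in>S. x \<bullet> b))" unfolding multi_affine_def by blast
  then have "\<forall>x. u x + k * v x = (\<Sum>S\<in>Pow Basis. (c S + k * d S) * of_real (\<Prod>b\<in>S. x \<bullet> b))"
    by (simp add: sum.distrib sum_distrib_left distrib_right mult.assoc)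
  then show "(\<lambda>x. u x + k * v x) \<in> multi_affine"
    unfolding multi_affine_def by (intro CollectI exI[of _ "\<lambda>S. c S + k * d S"])
qed

lemma monomial_multi_affine:
  assumes "R \<subseteq> Basis"
  shows "(\<lambda>x. of_real (\<Prod>b\<in>R. x \<bullet> b)) \<in> multi_affine"
  unfolding multi_affine_def
proof (intro CollectI exI allI)
  fix x :: 'a
  have "(\<Sum>S\<in>Pow Basis. (if S = R then 1 else 0) * complex_of_real (\<Prod>b\<in>S. x \<bullet> b)) =
      (\<Sum>S\<in>Pow Basis. if S = R then of_real (\<Prod>b\<in>S. x \<bullet> b) else 0)"
    by (intro sum.cong) auto
  also have "\<dots> = of_real (\<Prod>b\<in>R. x \<bullet> b)" using assms by (subst sum.delta) auto
  finally show "of_real (\<Prod>b\<in>R. x \<bullet> b) =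
    (\<Sum>S\<in>Pow Basis. (if S = R then 1 else 0) * complex_of_real (\<Prod>b\<in>S. x \<bullet> b))" by simp
qed

text \<open>Each coordinate of B is affine in a single coordinate of x, and different coordinates of
  B use different ones, so multiplying out never produces a square. Symmetries of the cube and the
  maps onto its grid cells both have this shape.\<close>

lemma multi_affine_compose:
  fixes B :: "'a::euclidean_space \<Rightarrow> 'a"
  assumes g: "g \<in> multi_affine" and \<sigma>: "inj_on \<sigma> Basis" "\<sigma> ` Basis \<subseteq> (Basis :: 'a set)"
    and B: "\<And>x b. b \<in> Basis \<Longrightarrow> B x \<bullet> b = \<alpha> b + \<beta> b * (x \<bullet> \<sigma> b)"
  shows "(\<lambda>x. g (B x)) \<in> multi_affine"
proof -
  obtain c where c: "\<And>x. g x = (\<Sum>S\<in>Pow Basis. c S * of_real (\<Prod>b\<in>S. x \<bullet> b))"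
    using g unfolding multi_affine_def by blast
  define d where "d S R = complex_of_real ((\<Prod>b\<in>R. \<beta> b) * (\<Prod>b\<in>S - R. \<alpha> b))" for S R
  have "complex_of_real (\<Prod>b\<in>S. B x \<bullet> b) = (\<Sum>R\<in>Pow S. d S R * of_real (\<Prod>b\<in>\<sigma> ` R. x \<bullet> b))"
    if S: "S \<subseteq> Basis" for S x
  proof -
    have "(\<Prod>b\<in>S. B x \<bullet> b) = (\<Prod>b\<in>S. \<beta> b * (x \<bullet> \<sigma> b) + \<alpha> b)"
      using S B by (intro prod.cong) auto
    also have "\<dots> = (\<Sum>R\<in>Pow S. (\<Prod>b\<in>R. \<beta> b * (x \<bullet> \<sigma> b)) * (\<Prod>b\<in>S - R. \<alpha> b))"
      using S finite_subset[OF S finite_Basis] by (intro prod_add)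
    also have "\<dots> = (\<Sum>R\<in>Pow S. ((\<Prod>b\<in>R. \<beta> b) * (\<Prod>b\<in>S - R. \<alpha> b)) * (\<Prod>b\<in>\<sigma> ` R. x \<bullet> b))"
    proof (intro sum.cong refl)
      fix R assume "R \<in> Pow S"
      then have "inj_on \<sigma> R" using S inj_on_subset[OF \<sigma>(1)] by blast
      then show "(\<Prod>b\<in>R. \<beta> b * (x \<bullet> \<sigma> b)) * (\<Prod>b\<in>S - R. \<alpha> b) =
          ((\<Prod>b\<in>R. \<beta> b) * (\<Prod>b\<in>S - R. \<alpha> b)) * (\<Prod>b\<in>\<sigma> ` R. x \<bullet> b)"
        by (simp add: prod.reindex prod.distrib)
    qed
    finally show ?thesis by (simp add: d_def)
  qed
  then have eq: "(\<lambda>x. g (B x)) =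
      (\<lambda>x. \<Sum>S\<in>Pow Basis. c S * (\<Sum>R\<in>Pow S. d S R * of_real (\<Prod>b\<in>\<sigma> ` R. x \<bullet> b)))"
    unfolding c by (auto simp: fun_eq_iff intro!: sum.cong)
  show ?thesis
    unfolding eq
  proof (intro fun_subspace_sum fun_subspace_multi_affine)
    fix S R assume "S \<in> Pow (Basis :: 'a set)" "R \<in> Pow S"
    then show "(\<lambda>x. complex_of_real (\<Prod>b\<in>\<sigma> ` R. x \<bullet> b)) \<in> multi_affine"
      using \<sigma>(2) by (intro monomial_multi_affine) blast
  qed
qed

lemma sum_Basis_inner:
  fixes S :: "'a::euclidean_space set"
  assumes "S \<subseteq> Basis" "b' \<in> Basis"
  shows "(\<Sum>b\<in>S. b) \<bullet> b' = (if b' \<in> S then 1 else 0)"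
proof -
  have "(\<Sum>b\<in>S. b) \<bullet> b' = (\<Sum>b\<in>S. if b = b' then 1 else 0)"
    unfolding inner_sum_left using assms by (intro sum.cong) (auto simp: inner_Basis)
  then show ?thesis using finite_subset[OF assms(1) finite_Basis] by simp
qed

text \<open>At the corner belonging to S the monomial of R is 1 if R is a subset of S and 0
  otherwise. This system is triangular, so the coefficients vanish by induction on S.\<close>

lemma multi_affine_zero:
  fixes g :: "'a::euclidean_space \<Rightarrow> complex"
  assumes "g \<in> multi_affine" "\<And>S. S \<subseteq> Basis \<Longrightarrow> g (\<Sum>b\<in>S. b) = 0"
  shows "g x = 0"
proof -
  obtain c where c: "\<And>x. g x = (\<Sum>S\<in>Pow Basis. c S * of_real (\<Prod>b\<in>S. x \<bullet> b))"
    using assms unfolding multi_affine_def by blast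
  have "c S = 0" if "S \<subseteq> Basis" for S
    using finite_subset[OF that finite_Basis] that
  proof (induction S rule: finite_psubset_induct)
    case (psubset S)
    note inner = sum_Basis_inner[OF psubset.prems]
    have "(\<Prod>b\<in>R. (\<Sum>b\<in>S. b) \<bullet> b) = (if R \<subseteq> S then 1 else 0)" if R: "R \<in> Pow Basis" for R
    proof (cases "R \<subseteq> S")
      case True
      have "(\<Sum>b\<in>S. b) \<bullet> b = 1" if "b \<in> R" for b
        using inner[of b] that True R by (simp add: subset_iff)
      then have "(\<Prod>b\<in>R. (\<Sum>b\<in>S. b) \<bullet> b) = 1" by (intro prod.neutral ballI)
      then show ?thesis using True by simp
    next
      case False
      then obtain b where "b \<in> R" "b \<notin> S" by blast
      moreover have "finite R" using R finite_subset finite_Basis by blast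
      moreover have "(\<Sum>b\<in>S. b) \<bullet> b = 0" using R inner[of b] calculation by auto
      ultimately have "(\<Prod>b\<in>R. (\<Sum>b\<in>S. b) \<bullet> b) = 0" by (intro prod_zero bexI[of _ b])
      then show ?thesis using False by simp
    qed
    then have "g (\<Sum>b\<in>S. b) = (\<Sum>R\<in>Pow Basis. if R \<subseteq> S then c R else 0)"
      unfolding c by (intro sum.cong) auto
    also have "\<dots> = (\<Sum>R\<in>Pow Basis. if R = S then c R else 0)"
      using psubset.IH psubset.prems by (intro sum.cong) auto
    also have "\<dots> = c S" using psubset.prems by (subst sum.delta) auto
    finally show "c S = 0" using assms(2) psubset.prems by simp
  qed
  then show ?thesis by (simp add: c)
qed

section \<open>Affine symmetries of the unit cube\<close>

lemma linear_inner_expand: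
  fixes L :: "'a::euclidean_space \<Rightarrow> 'a"
  assumes "linear L"
  shows "L x \<bullet> b = (\<Sum>i\<in>Basis. (x \<bullet> i) * (L i \<bullet> b))"
proof -
  have "L x = L (\<Sum>i\<in>Basis. (x \<bullet> i) *\<^sub>R i)" by (simp add: euclidean_representation)
  also have "\<dots> = (\<Sum>i\<in>Basis. (x \<bullet> i) *\<^sub>R L i)"
    using assms by (simp add: linear_sum linear_scale)
  finally show ?thesis by (simp add: inner_sum_left)
qed

text \<open>Over the cube, coordinate b of the image varies by exactly the l1-norm of row b, and it
  has to sweep out the unit interval.\<close>

lemma cube_map_row_sum:
  fixes L :: "'a::euclidean_space \<Rightarrow> 'a"
  assumes L: "linear L" and cube: "(\<lambda>x. a + L x) ` cbox 0 One = cbox 0 One" and b: "b \<in> Basis"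
  shows "(\<Sum>i\<in>Basis. \<bar>L i \<bullet> b\<bar>) = 1"
proof (rule antisym)
  have in01: "0 \<le> (a + L x) \<bullet> b \<and> (a + L x) \<bullet> b \<le> 1" if "x \<in> cbox 0 One" for x
    using imageI[OF that, of "\<lambda>x. a + L x"] b unfolding cube by (simp add: mem_box)
  \<comment> \<open>The corners \<open>x\<close> and \<open>y\<close> are those where coordinate b
    of the image is largest and smallest.\<close>
  define x where "x = (\<Sum>i\<in>Basis. (if L i \<bullet> b > 0 then 1 else 0) *\<^sub>R i)"
  define y where "y = (\<Sum>i\<in>Basis. (if L i \<bullet> b > 0 then 0 else 1) *\<^sub>R i)"
  have xy: "x \<bullet> i = (if L i \<bullet> b > 0 then 1 else 0)" "y \<bullet> i = (if L i \<bullet> b > 0 then 0 else 1)" if "i \<in> Basis" for i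
    using that unfolding x_def y_def by (simp_all only: inner_sum_left_Basis)
  have "x \<in> cbox 0 One" "y \<in> cbox 0 One" by (auto simp: mem_box xy)
  from in01[OF this(1)] in01[OF this(2)] have "L x \<bullet> b - L y \<bullet> b \<le> 1" by (simp add: inner_add_left)
  moreover have "L x \<bullet> b - L y \<bullet> b = (\<Sum>i\<in>Basis. \<bar>L i \<bullet> b\<bar>)"
    unfolding linear_inner_expand[OF L, of x b] linear_inner_expand[OF L, of y b] sum_subtractf[symmetric]
    by (intro sum.cong) (auto simp: xy)
  ultimately show "(\<Sum>i\<in>Basis. \<bar>L i \<bullet> b\<bar>) \<le> 1" by simp
  have "One \<in> (\<lambda>x. a + L x) ` cbox 0 One" "0 \<in> (\<lambda>x. a + L x) ` cbox 0 One"
    unfolding cube by (auto simp: mem_box)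
  then obtain x1 x0 where x1: "x1 \<in> cbox 0 One" "a + L x1 = One" and x0: "x0 \<in> cbox 0 One" "a + L x0 = 0"
    by (metis (no_types, lifting) imageE)
  have "1 = (a + L x1) \<bullet> b - (a + L x0) \<bullet> b" unfolding x1 x0 using b by simp
  also have "\<dots> = (\<Sum>i\<in>Basis. ((x1 - x0) \<bullet> i) * (L i \<bullet> b))"
    using linear_inner_expand[OF L, of "x1 - x0" b] by (simp add: linear_diff[OF L] inner_diff_left inner_add_left)
  also have "\<dots> \<le> (\<Sum>i\<in>Basis. \<bar>L i \<bullet> b\<bar>)"
  proof (intro sum_mono)
    fix i :: 'a assume "i \<in> Basis"
    then have "0 \<le> x1 \<bullet> i" "x1 \<bullet> i \<le> 1" "0 \<le> x0 \<bullet> i" "x0 \<bullet> i \<le> 1"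
      using x1(1) x0(1) by (simp_all add: mem_box)
    then have "\<bar>(x1 - x0) \<bullet> i\<bar> \<le> 1" by (simp add: inner_diff_left abs_le_iff)
    then have "\<bar>(x1 - x0) \<bullet> i\<bar> * \<bar>L i \<bullet> b\<bar> \<le> 1 * \<bar>L i \<bullet> b\<bar>" by (intro mult_right_mono) auto
    then show "((x1 - x0) \<bullet> i) * (L i \<bullet> b) \<le> \<bar>L i \<bullet> b\<bar>" by (simp add: abs_mult[symmetric])
  qed
  finally show "1 \<le> (\<Sum>i\<in>Basis. \<bar>L i \<bullet> b\<bar>)" .
qed

text \<open>Both the linear part and its inverse have rows of \<open>l\<^sup>1\<close>-norm \<open>1\<close>, which forces a signed
  permutation matrix.\<close>

lemma cube_symmetry:
  fixes L M :: "'a::euclidean_space \<Rightarrow> 'a"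
  assumes L: "linear L" "(\<lambda>x. a + L x) ` cbox 0 One = cbox 0 One"
    and M: "linear M" "(\<lambda>x. a' + M x) ` cbox 0 One = cbox 0 One" and inv: "\<And>x. L (M x) = x"
  shows "\<exists>\<sigma>. inj_on \<sigma> Basis \<and> \<sigma> ` Basis \<subseteq> Basis \<and>
    (\<forall>x. \<forall>b\<in>Basis. L x \<bullet> b = (L (\<sigma> b) \<bullet> b) * (x \<bullet> \<sigma> b))"
proof -
  note rowL = cube_map_row_sum[OF L] and rowM = cube_map_row_sum[OF M]
  have M1: "\<bar>M b \<bullet> i\<bar> \<le> 1" if "b \<in> Basis" "i \<in> Basis" for b i
    using member_le_sum[of b Basis "\<lambda>b. \<bar>M b \<bullet> i\<bar>"] rowM[OF that(2)] that by simp
  have full: "\<bar>M b \<bullet> i\<bar> = 1" if bi: "b \<in> Basis" "i \<in> Basis" "L i \<bullet> b \<noteq> 0" for b i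
  proof -
    \<comment> \<open>Row b of L has l1-norm 1, and its product with column b of M is 1 as well. As
      the entries of M have modulus at most 1, equality forces modulus 1 wherever the corresponding
      entry of L is nonzero.\<close>
    have "(\<Sum>i\<in>Basis. \<bar>L i \<bullet> b\<bar> * (1 - \<bar>M b \<bullet> i\<bar>)) \<le> (\<Sum>i\<in>Basis. \<bar>L i \<bullet> b\<bar> - (M b \<bullet> i) * (L i \<bullet> b))"
    proof (intro sum_mono)
      fix i :: 'a
      have "(M b \<bullet> i) * (L i \<bullet> b) \<le> \<bar>L i \<bullet> b\<bar> * \<bar>M b \<bullet> i\<bar>" by (metis abs_ge_self abs_mult mult.commute)
      then show "\<bar>L i \<bullet> b\<bar> * (1 - \<bar>M b \<bullet> i\<bar>) \<le> \<bar>L i \<bullet> b\<bar> - (M b \<bullet> i) * (L i \<bullet> b)"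
        by (simp add: right_diff_distrib)
    qed
    also have "\<dots> = 1 - L (M b) \<bullet> b"
      unfolding sum_subtractf rowL[OF bi(1)] linear_inner_expand[OF L(1), of "M b" b] ..
    also have "\<dots> = 0" using bi(1) by (simp add: inv)
    finally have "(\<Sum>i\<in>Basis. \<bar>L i \<bullet> b\<bar> * (1 - \<bar>M b \<bullet> i\<bar>)) \<le> 0" .
    moreover have nn: "0 \<le> \<bar>L i \<bullet> b\<bar> * (1 - \<bar>M b \<bullet> i\<bar>)" if "i \<in> Basis" for i
      using M1[OF bi(1) that] by simp
    ultimately have "(\<Sum>i\<in>Basis. \<bar>L i \<bullet> b\<bar> * (1 - \<bar>M b \<bullet> i\<bar>)) = 0" by (simp add: antisym sum_nonneg)
    then have "\<bar>L i \<bullet> b\<bar> * (1 - \<bar>M b \<bullet> i\<bar>) = 0"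
      using sum_nonneg_eq_0_iff[of Basis "\<lambda>i. \<bar>L i \<bullet> b\<bar> * (1 - \<bar>M b \<bullet> i\<bar>)"] nn bi(2) by simp
    then show ?thesis using bi(3) by simp
  qed
  \<comment> \<open>Row i of M has l1-norm 1 and thus room for only one entry of modulus 1. Hence
    column i of L has at most one nonzero entry.\<close>
  have single: "b = b'" if "b \<in> Basis" "b' \<in> Basis" "i \<in> Basis" "L i \<bullet> b \<noteq> 0" "L i \<bullet> b' \<noteq> 0" for b b' i
  proof (rule ccontr)
    assume "b \<noteq> b'"
    then have "\<bar>M b \<bullet> i\<bar> + \<bar>M b' \<bullet> i\<bar> \<le> (\<Sum>b\<in>Basis. \<bar>M b \<bullet> i\<bar>)"
      using sum_mono2[of Basis "{b, b'}" "\<lambda>b. \<bar>M b \<bullet> i\<bar>"] that by simp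
    then show False using full that rowM[OF that(3)] by fastforce
  qed
  have "\<exists>i\<in>Basis. L i \<bullet> b \<noteq> 0" if "b \<in> Basis" for b
    using rowL[OF that] sum.neutral[of Basis "\<lambda>i. \<bar>L i \<bullet> b\<bar>"] by fastforce
  then obtain \<sigma> where \<sigma>: "\<And>b. b \<in> Basis \<Longrightarrow> \<sigma> b \<in> Basis" "\<And>b. b \<in> Basis \<Longrightarrow> L (\<sigma> b) \<bullet> b \<noteq> 0"
    by metis
  have inj: "inj_on \<sigma> Basis" by (rule inj_onI) (metis \<sigma> single)
  have sub: "\<sigma> ` Basis \<subseteq> Basis" using \<sigma>(1) by blast
  have surj: "\<sigma> ` Basis = Basis" by (rule endo_inj_surj[OF finite_Basis sub inj])
  have "L x \<bullet> b = (L (\<sigma> b) \<bullet> b) * (x \<bullet> \<sigma> b)" if b: "b \<in> Basis" for x b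
  proof -
    have "(x \<bullet> i) * (L i \<bullet> b) = (if i = \<sigma> b then (x \<bullet> \<sigma> b) * (L (\<sigma> b) \<bullet> b) else 0)" if i: "i \<in> Basis" for i
    proof (cases "i = \<sigma> b")
      case False
      obtain b' where "b' \<in> Basis" "i = \<sigma> b'" using i surj by blast
      then have "L i \<bullet> b = 0" using single[OF b _ i] \<sigma>(2) False by blast
      then show ?thesis using False by simp
    qed simp
    then have "L x \<bullet> b = (\<Sum>i\<in>Basis. if i = \<sigma> b then (x \<bullet> \<sigma> b) * (L (\<sigma> b) \<bullet> b) else 0)"
      unfolding linear_inner_expand[OF L(1), of x b] by (intro sum.cong) auto
    then show ?thesis using \<sigma>(1)[OF b] by simp
  qed
  then show ?thesis using inj sub by blast
qed

text \<open>\<open>Q1_on\<close> allows any reference map, and two functions may come with different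
  ones, so even closure under sums is not evident. Two reference maps of T differ by an affine
  symmetry of the cube. It permutes and reflects coordinates, hence preserves
  \<open>multi_affine\<close>, and one fixed map will do.\<close>

lemma Q1_on_iff:
  fixes T :: "'a::euclidean_space set"
  assumes "ref_map p F T"
  shows "Q1_on T v \<longleftrightarrow> (\<exists>g\<in>multi_affine. \<forall>x\<in>cbox 0 One. v (p + F x) = g x)"
proof
  assume "\<exists>g\<in>multi_affine. \<forall>x\<in>cbox 0 One. v (p + F x) = g x"
  then show "Q1_on T v" using assms unfolding Q1_on_def multi_affine_def by fastforce
next
  assume "Q1_on T v"
  then obtain q G c where q: "ref_map q G T"
    and c: "\<forall>x\<in>cbox 0 One. v (q + G x) = (\<Sum>S\<in>Pow Basis. c S * of_real (\<Prod>b\<in>S. x \<bullet> b))"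
    unfolding Q1_on_def by blast
  define g where "g x = (\<Sum>S\<in>Pow Basis. c S * of_real (\<Prod>b\<in>S. x \<bullet> b))" for x :: 'a
  have g: "g \<in> multi_affine" unfolding multi_affine_def g_def by blast
  have F: "linear F" "inj F" "surj F" "T = (\<lambda>x. p + F x) ` cbox 0 One"
    using ref_map_bij[OF assms] assms by (auto simp: ref_map_def)
  have G: "linear G" "inj G" "surj G" "T = (\<lambda>x. q + G x) ` cbox 0 One"
    using ref_map_bij[OF q] q by (auto simp: ref_map_def)
  have iF: "linear (inv F)" "\<And>x. inv F (F x) = x" "\<And>x. F (inv F x) = x"
    using F by (auto simp: inj_linear_imp_inv_linear surj_f_inv_f)
  have iG: "linear (inv G)" "\<And>x. inv G (G x) = x" "\<And>x. G (inv G x) = x"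
    using G by (auto simp: inj_linear_imp_inv_linear surj_f_inv_f)
  have cube: "(\<lambda>x. inv G' (p' - q') + (inv G' \<circ> F') x) ` cbox 0 One = cbox 0 One"
    if "linear (inv G')" "\<And>x. inv G' (G' x) = x"
      "(\<lambda>x. p' + F' x) ` cbox 0 One = (\<lambda>x. q' + G' x) ` cbox 0 (One::'a)" for p' q' F' G'
  proof -
    have "(\<lambda>x. inv G' (p' - q') + (inv G' \<circ> F') x) ` cbox 0 One =
        (\<lambda>y. inv G' (y - q')) ` (\<lambda>x. p' + F' x) ` cbox 0 One"
      by (simp add: image_image linear_add[OF that(1)] linear_diff[OF that(1)] algebra_simps)
    also have "\<dots> = cbox 0 One" unfolding that(3) by (simp add: image_image that(2))
    finally show ?thesis .
  qed
  have eqT: "(\<lambda>x. p + F x) ` cbox 0 One = (\<lambda>x. q + G x) ` cbox 0 One" using F(4) G(4) by simp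
  have cube1: "(\<lambda>x. inv G (p - q) + (inv G \<circ> F) x) ` cbox 0 One = cbox 0 One"
    using cube[OF iG(1,2) eqT] .
  have cube2: "(\<lambda>x. inv F (q - p) + (inv F \<circ> G) x) ` cbox 0 One = cbox 0 One"
    using cube[OF iF(1,2) eqT[symmetric]] .
  \<comment> \<open>The transition from the coordinates of the map (p, F) to those of (q,
    G).\<close>
  define A where "A x = inv G (p - q) + (inv G \<circ> F) x" for x
  have lin: "linear (inv G \<circ> F)" "linear (inv F \<circ> G)"
    using linear_compose[OF F(1) iG(1)] linear_compose[OF G(1) iF(1)] .
  have inv: "(inv G \<circ> F) ((inv F \<circ> G) x) = x" for x by (simp add: iF iG)
  obtain \<sigma> where \<sigma>: "inj_on \<sigma> Basis" "\<sigma> ` Basis \<subseteq> Basis"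
    "\<forall>x. \<forall>b\<in>Basis. (inv G \<circ> F) x \<bullet> b = ((inv G \<circ> F) (\<sigma> b) \<bullet> b) * (x \<bullet> \<sigma> b)"
    using cube_symmetry[OF lin(1) cube1 lin(2) cube2 inv] by (elim exE conjE)
  have gA: "(\<lambda>x. g (A x)) \<in> multi_affine"
  proof (rule multi_affine_compose[OF g \<sigma>(1,2), where \<alpha> = "\<lambda>b. inv G (p - q) \<bullet> b" and
        \<beta> = "\<lambda>b. (inv G \<circ> F) (\<sigma> b) \<bullet> b"])
    fix x b :: 'a assume "b \<in> Basis"
    then show "A x \<bullet> b = inv G (p - q) \<bullet> b + ((inv G \<circ> F) (\<sigma> b) \<bullet> b) * (x \<bullet> \<sigma> b)"
      unfolding A_def inner_add_left by (intro arg_cong2[where f = "(+)"] refl bspec[OF spec[OF \<sigma>(3)]])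
  qed
  have "v (p + F x) = g (A x)" if x: "x \<in> cbox 0 One" for x
  proof -
    have "A x \<in> cbox 0 One" using imageI[OF x, of A] cube1 by (simp add: A_def)
    moreover have "q + G (A x) = p + F x"
      by (simp add: A_def linear_add[OF G(1)] iG(3))
    ultimately show ?thesis using bspec[OF c, of "A x"] by (simp add: g_def)
  qed
  then have "\<forall>x\<in>cbox 0 One. v (p + F x) = g (A x)" by blast
  then show "\<exists>g\<in>multi_affine. \<forall>x\<in>cbox 0 One. v (p + F x) = g x" by (rule bexI[OF _ gA])
qed

section \<open>Finite element functions and uniform refinement\<close>

lemma fun_subspace_S1:
  assumes "\<And>T. T \<in> \<G> \<Longrightarrow> \<exists>p F. ref_map p F T"
  shows "fun_subspace (S1 \<Omega> \<G>)"
  unfolding fun_subspace_def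
proof (intro conjI ballI allI)
  show "(\<lambda>_. 0) \<in> S1 \<Omega> \<G>"
    unfolding S1_def
  proof (intro CollectI conjI ballI)
    fix T assume "T \<in> \<G>"
    then obtain p F where r: "ref_map p F T" using assms by blast
    show "Q1_on T (\<lambda>_. 0)"
      unfolding Q1_on_iff[OF r] by (rule bexI[OF _ fun_subspace_zero[OF fun_subspace_multi_affine]]) simp
  qed simp
  fix u v c assume uv: "u \<in> S1 \<Omega> \<G>" "v \<in> S1 \<Omega> \<G>"
  show "(\<lambda>x. u x + c * v x) \<in> S1 \<Omega> \<G>"
    unfolding S1_def
  proof (intro CollectI conjI ballI)
    show "continuous_on (closure \<Omega>) (\<lambda>x. u x + c * v x)"
      using uv unfolding S1_def by (intro continuous_intros) auto
    fix T assume T: "T \<in> \<G>"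
    then obtain p F where r: "ref_map p F T" using assms by blast
    have "Q1_on T u" "Q1_on T v" using uv T unfolding S1_def by auto
    then obtain g h where "g \<in> multi_affine" "h \<in> multi_affine"
      "\<forall>x\<in>cbox 0 One. u (p + F x) = g x" "\<forall>x\<in>cbox 0 One. v (p + F x) = h x"
      unfolding Q1_on_iff[OF r] by blast
    then show "Q1_on T (\<lambda>x. u x + c * v x)"
      unfolding Q1_on_iff[OF r]
      by (intro bexI[of _ "\<lambda>x. g x + c * h x"] fun_subspace_lin[OF fun_subspace_multi_affine]) auto
  qed
qed

definition grid_point :: "nat \<Rightarrow> ('a::euclidean_space \<Rightarrow> nat) \<Rightarrow> 'a" where
  "grid_point n k = (\<Sum>b\<in>Basis. (real (k b) / real n) *\<^sub>R b)"

lemma grid_point_inner: "b \<in> Basis \<Longrightarrow> grid_point n k \<bullet> b = real (k b) / real n"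
  unfolding grid_point_def by (rule inner_sum_left_Basis)

definition refined_cell :: "nat \<Rightarrow> 'a::euclidean_space \<Rightarrow> ('a \<Rightarrow> 'a) \<Rightarrow> ('a \<Rightarrow> nat) \<Rightarrow> 'a set" where
  "refined_cell n p F k = (\<lambda>x. p + F x) ` cbox (grid_point n k) (grid_point n (\<lambda>b. k b + 1))"

lemma uniform_refinement_eq:
  "uniform_refinement n \<G> =
    {refined_cell n p F k | p F k T. T \<in> \<G> \<and> ref_map p F T \<and> (\<forall>b\<in>Basis. k b < n)}"
  unfolding uniform_refinement_def refined_cell_def grid_point_def ..

lemma refined_cell_ref_map:
  assumes "ref_map p F T" "n \<ge> 1"
  shows "ref_map (p + F (grid_point n k)) (\<lambda>x. F ((1 / real n) *\<^sub>R x)) (refined_cell n p F k)"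
proof -
  have F: "linear F" "inj F" using ref_map_bij[OF assms(1)] by auto
  have n: "real n > 0" using assms(2) by simp
  have lin: "linear (\<lambda>x. F ((1 / real n) *\<^sub>R x))"
    by (rule linear_compose[OF linear_scale_self F(1), unfolded o_def])
  have inj: "inj (\<lambda>x. F ((1 / real n) *\<^sub>R x))"
    using n by (intro injI) (simp add: inj_eq[OF F(2)])
  have "(\<lambda>x. grid_point n k + (1 / real n) *\<^sub>R x) ` cbox 0 One =
      cbox (grid_point n k) (grid_point n (\<lambda>b. k b + 1))"
  proof (intro equalityI subsetI)
    fix y assume "y \<in> (\<lambda>x. grid_point n k + (1 / real n) *\<^sub>R x) ` cbox 0 One"
    then show "y \<in> cbox (grid_point n k) (grid_point n (\<lambda>b. k b + 1))"
      using n by (auto simp: mem_box grid_point_inner inner_add_left add_divide_distrib divide_right_mono)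
  next
    fix y assume y: "y \<in> cbox (grid_point n k) (grid_point n (\<lambda>b. k b + 1))"
    define x where "x = real n *\<^sub>R (y - grid_point n k)"
    have "y = grid_point n k + (1 / real n) *\<^sub>R x" using n by (simp add: x_def)
    moreover have "x \<in> cbox 0 One"
      using y n by (auto simp: mem_box x_def inner_diff_left grid_point_inner field_simps)
    ultimately show "y \<in> (\<lambda>x. grid_point n k + (1 / real n) *\<^sub>R x) ` cbox 0 One" by blast
  qed
  from this[symmetric] have "refined_cell n p F k =
      (\<lambda>x. p + F (grid_point n k) + F ((1 / real n) *\<^sub>R x)) ` cbox 0 One"
    unfolding refined_cell_def by (simp add: image_image linear_add[OF F(1)] add.assoc)
  then show ?thesis using lin inj by (simp add: ref_map_def)
qed

text \<open>The coordinates of a refined cell are shifted and scaled coordinates of the coarse one,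
  so the partial degrees do not grow. This puts the coarse space inside the fine one.\<close>

lemma Q1_on_refined_cell:
  fixes T :: "'a::euclidean_space set"
  assumes r: "ref_map p F T" and n: "n \<ge> 1" and k: "\<forall>b\<in>Basis. k b < n" and Q: "Q1_on T v"
  shows "Q1_on (refined_cell n p F k) v"
proof -
  obtain g where g: "g \<in> multi_affine" "\<forall>x\<in>cbox 0 One. v (p + F x) = g x" using Q Q1_on_iff[OF r] by blast
  define B where "B x = grid_point n k + (1 / real n) *\<^sub>R x" for x
  have gB: "(\<lambda>x. g (B x)) \<in> multi_affine"
    by (rule multi_affine_compose[OF g(1), where \<sigma> = "\<lambda>b. b" and \<alpha> = "\<lambda>b. real (k b) / real n"
          and \<beta> = "\<lambda>_. 1 / real n"])
       (auto simp: B_def grid_point_inner inner_add_left)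
  have Bx: "B x \<in> cbox 0 One" if x: "x \<in> cbox 0 One" for x
  proof -
    have "real (k b) + x \<bullet> b \<le> real n" "0 \<le> x \<bullet> b" if b: "b \<in> Basis" for b
    proof -
      have "k b + 1 \<le> n" using k b by (simp add: Suc_le_eq)
      then have "real (k b) + 1 \<le> real n" by linarith
      moreover have "x \<bullet> b \<le> 1" "0 \<le> x \<bullet> b" using x b by (auto simp: mem_box)
      ultimately show "real (k b) + x \<bullet> b \<le> real n" "0 \<le> x \<bullet> b" by linarith+
    qed
    then show ?thesis
      using n by (auto simp: mem_box B_def inner_add_left grid_point_inner add_divide_distrib[symmetric] divide_le_eq)
  qed
  have eq: "p + F (grid_point n k) + F ((1 / real n) *\<^sub>R x) = p + F (B x)" for x
    by (simp add: B_def linear_add[OF ref_map_bij(1)[OF r]] add.assoc)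
  have "\<forall>x\<in>cbox 0 One. v (p + F (grid_point n k) + F ((1 / real n) *\<^sub>R x)) = g (B x)"
    unfolding eq using g(2) Bx by blast
  then show ?thesis
    unfolding Q1_on_iff[OF refined_cell_ref_map[OF r n]] by (rule bexI[OF _ gB])
qed

lemma fe_space_subset_refinement:
  assumes "n \<ge> 1"
  shows "fe_space \<Omega> \<Gamma>D tr \<G> \<subseteq> fe_space \<Omega> \<Gamma>D tr (uniform_refinement n \<G>)"
proof -
  have "S1 \<Omega> \<G> \<subseteq> S1 \<Omega> (uniform_refinement n \<G>)"
    unfolding S1_def uniform_refinement_eq using Q1_on_refined_cell[OF _ assms] by blast
  then show ?thesis unfolding fe_space_def by blast
qed

text \<open>The grid points of all coarse cells determine a fine function. This finite set takes the
  place of a dimension argument wherever a Galerkin problem has to be solved.\<close>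

lemma refinement_nodes:
  assumes "finite \<G>" "\<And>T. T \<in> \<G> \<Longrightarrow> \<exists>p F. ref_map p F T" "\<Union>\<G> = closure \<Omega>" "n \<ge> 1"
  obtains P where "finite P"
    "\<And>v x. v \<in> S1 \<Omega> (uniform_refinement n \<G>) \<Longrightarrow> \<forall>p\<in>P. v p = 0 \<Longrightarrow> x \<in> closure \<Omega> \<Longrightarrow> v x = 0"
proof -
  obtain p F where r: "\<And>T. T \<in> \<G> \<Longrightarrow> ref_map (p T) (F T) T" using assms(2) by metis
  \<comment> \<open>The index functions are extensional: only their values on \<open>Basis\<close>
    matter, and the set of nodes has to be finite.\<close>
  define P where "P = (\<Union>T\<in>\<G>. (\<lambda>k. p T + F T (grid_point n k)) ` (Basis \<rightarrow>\<^sub>E {..n}))"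
  have "finite P" unfolding P_def using assms(1) by (intro finite_UN_I finite_imageI finite_PiE) auto
  moreover have "v x = 0"
    if v: "v \<in> S1 \<Omega> (uniform_refinement n \<G>)" "\<forall>p\<in>P. v p = 0" and x: "x \<in> closure \<Omega>" for v x
  proof -
    obtain T where T: "T \<in> \<G>" "x \<in> T" using x assms(3) by blast
    then obtain y where y: "y \<in> cbox 0 One" "x = p T + F T y" using r[OF T(1)] unfolding ref_map_def by blast
    have "\<forall>b\<in>Basis. \<exists>i<n. real i \<le> y \<bullet> b * real n \<and> y \<bullet> b * real n \<le> real i + 1"
      using y(1) assms(4) by (intro ballI unit_interval_cell) (simp_all add: mem_box)
    then obtain k where k: "\<And>b. b \<in> Basis \<Longrightarrow> k b < n" "\<And>b. b \<in> Basis \<Longrightarrow> real (k b) \<le> y \<bullet> b * real n"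
      "\<And>b. b \<in> Basis \<Longrightarrow> y \<bullet> b * real n \<le> real (k b) + 1" by metis
    let ?K = "refined_cell n (p T) (F T) k"
    note rK = refined_cell_ref_map[OF r[OF T(1)] assms(4), of k]
    have "?K \<in> uniform_refinement n \<G>" unfolding uniform_refinement_eq using T(1) r k(1) by blast
    then have "Q1_on ?K v" using v(1) unfolding S1_def by blast
    then obtain g where g: "g \<in> multi_affine"
      "\<forall>z\<in>cbox 0 One. v (p T + F T (grid_point n k) + F T ((1 / real n) *\<^sub>R z)) = g z"
      unfolding Q1_on_iff[OF rK] by blast
    have FT: "linear (F T)" using ref_map_bij(1)[OF r[OF T(1)]] .
    have g0: "g z = 0" for z
    proof (rule multi_affine_zero[OF g(1)])
      fix S :: "'a set" assume S: "S \<subseteq> Basis"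
      \<comment> \<open>The corner S of the refined cell is again a grid point;
        \<open>restrict\<close> makes its index extensional, as membership in \<open>P\<close>
        demands.\<close>
      define k' where "k' = restrict (\<lambda>b. k b + (if b \<in> S then 1 else 0)) Basis"
      note inner = sum_Basis_inner[OF S]
      have "grid_point n k + (1 / real n) *\<^sub>R (\<Sum>b\<in>S. b) = grid_point n k'"
        by (rule euclidean_eqI) (simp add: inner_add_left grid_point_inner inner k'_def add_divide_distrib)
      then have "p T + F T (grid_point n k) + F T ((1 / real n) *\<^sub>R (\<Sum>b\<in>S. b)) = p T + F T (grid_point n k')"
        by (simp add: add.assoc linear_add[OF FT, symmetric])
      moreover have "k' \<in> Basis \<rightarrow>\<^sub>E {..n}" using k(1) by (fastforce simp: k'_def Suc_le_eq)
      then have "p T + F T (grid_point n k') \<in> P" unfolding P_def using T(1) by blast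
      moreover have "(\<Sum>b\<in>S. b) \<in> cbox 0 One" by (simp add: mem_box inner)
      ultimately show "g (\<Sum>b\<in>S. b) = 0" using g(2) v(2) by metis
    qed
    have "y \<in> cbox (grid_point n k) (grid_point n (\<lambda>b. k b + 1))"
      using k(2,3) assms(4) by (auto simp: mem_box grid_point_inner field_simps)
    then have "x \<in> ?K" unfolding refined_cell_def y(2) by blast
    then obtain z where "z \<in> cbox 0 One" "x = p T + F T (grid_point n k) + F T ((1 / real n) *\<^sub>R z)"
      using rK unfolding ref_map_def by blast
    then show ?thesis using g(2) g0 by metis
  qed
  ultimately show ?thesis by (rule that)
qed

section \<open>The Helmholtz form\<close>

lemma sesquilinear_on_add:
  "sesquilinear_on W B \<Longrightarrow> sesquilinear_on W B' \<Longrightarrow> sesquilinear_on W (\<lambda>u v. B u v + B' u v)"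
  unfolding sesquilinear_on_def by (simp add: algebra_simps)

lemma sesquilinear_on_scale: "sesquilinear_on W B \<Longrightarrow> sesquilinear_on W (\<lambda>u v. k * B u v)"
  unfolding sesquilinear_on_def by (simp add: algebra_simps)

lemma sesquilinear_on_sum:
  "(\<And>i. i \<in> J \<Longrightarrow> sesquilinear_on W (B i)) \<Longrightarrow> sesquilinear_on W (\<lambda>u v. \<Sum>i\<in>J. B i u v)"
proof (induction J rule: infinite_finite_induct)
  case (insert j J)
  then show ?case using sesquilinear_on_add[of W "B j" "\<lambda>u v. \<Sum>i\<in>J. B i u v"] by simp
qed (simp_all add: sesquilinear_on_def)

text \<open>Meant for the weak gradient and the trace, which are linear only almost
  everywhere.\<close>

lemma sesquilinear_on_L2_map:
  assumes \<Phi>: "\<And>u. u \<in> W \<Longrightarrow> \<Phi> u \<in> L2 M" and W: "fun_subspace W"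
    and lin: "\<And>u v c. u \<in> W \<Longrightarrow> v \<in> W \<Longrightarrow> AE x in M. \<Phi> (\<lambda>x. u x + c * v x) x = \<Phi> u x + c * \<Phi> v x"
  shows "sesquilinear_on W (\<lambda>u v. L2_inner M (\<Phi> u) (\<Phi> v))"
  unfolding sesquilinear_on_def
proof (intro ballI allI conjI)
  fix u v w c assume uvw: "u \<in> W" "v \<in> W" "w \<in> W"
  have L: "\<Phi> u \<in> L2 M" "\<Phi> v \<in> L2 M" "\<Phi> w \<in> L2 M" "\<Phi> (\<lambda>x. u x + c * v x) \<in> L2 M"
    using \<Phi> uvw fun_subspace_lin[OF W uvw(1,2)] by simp_all
  have L': "(\<lambda>x. \<Phi> u x + c * \<Phi> v x) \<in> L2 M" by (rule fun_subspace_lin[OF fun_subspace_L2 L(1,2)])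
  have m: "f \<in> borel_measurable M" if "f \<in> L2 M" for f using that by (simp add: L2_def)
  have "L2_inner M (\<Phi> (\<lambda>x. u x + c * v x)) (\<Phi> w) = L2_inner M (\<lambda>x. \<Phi> u x + c * \<Phi> v x) (\<Phi> w)"
    by (rule L2_inner_cong_AE[OF lin[OF uvw(1,2)] AE_I2[OF refl] m[OF L(4)] m[OF L'] m[OF L(3)] m[OF L(3)]])
  then show "L2_inner M (\<Phi> (\<lambda>x. u x + c * v x)) (\<Phi> w) =
      L2_inner M (\<Phi> u) (\<Phi> w) + c * L2_inner M (\<Phi> v) (\<Phi> w)"
    using sesquilinear_on_left[OF sesquilinear_on_L2_inner L(1,2,3)] by simp
  have "L2_inner M (\<Phi> w) (\<Phi> (\<lambda>x. u x + c * v x)) = L2_inner M (\<Phi> w) (\<lambda>x. \<Phi> u x + c * \<Phi> v x)"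
    by (rule L2_inner_cong_AE[OF AE_I2[OF refl] lin[OF uvw(1,2)] m[OF L(3)] m[OF L(3)] m[OF L(4)] m[OF L']])
  then show "L2_inner M (\<Phi> w) (\<Phi> (\<lambda>x. u x + c * v x)) =
      L2_inner M (\<Phi> w) (\<Phi> u) + cnj c * L2_inner M (\<Phi> w) (\<Phi> v)"
    using sesquilinear_on_right[OF sesquilinear_on_L2_inner L(1,2,3)] by simp
qed

lemma L2_inner_null:
  assumes "AE x in M. f x = 0"
  shows "L2_inner M f g = 0" "L2_inner M g f = 0"
  unfolding L2_inner_def using assms by (auto intro!: integral_eq_zero_AE elim: eventually_mono)

text \<open>The pieces are disjoint and exhaustive only up to null sets. One version serves both
  Lebesgue measure on the cells and Hausdorff measure on their boundary parts.\<close>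

lemma integral_restrict_partition:
  fixes f :: "'a \<Rightarrow> 'b::{banach, second_countable_topology}"
  assumes "finite J" "A \<inter> space M \<in> sets M" "\<And>j. j \<in> J \<Longrightarrow> B j \<inter> space M \<in> sets M"
    and "integrable (restrict_space M A) f" "\<And>j. j \<in> J \<Longrightarrow> integrable (restrict_space M (B j)) f"
    and part: "AE x in M. indicator A x = (\<Sum>j\<in>J. indicator (B j) x :: real)"
  shows "(\<integral>x. f x \<partial>restrict_space M A) = (\<Sum>j\<in>J. \<integral>x. f x \<partial>restrict_space M (B j))"
proof -
  have int: "integrable M (\<lambda>x. indicator (B j) x *\<^sub>R f x)" if "j \<in> J" for j
    using assms(3,5)[OF that] by (simp add: integrable_restrict_space)
  have "(\<integral>x. f x \<partial>restrict_space M A) = (\<integral>x. indicator A x *\<^sub>R f x \<partial>M)"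
    by (rule integral_restrict_space[OF assms(2)])
  also have "\<dots> = (\<integral>x. (\<Sum>j\<in>J. indicator (B j) x *\<^sub>R f x) \<partial>M)"
  proof (rule integral_cong_AE)
    have "integrable M (\<lambda>x. indicator A x *\<^sub>R f x)" using assms(2,4) by (simp add: integrable_restrict_space)
    then show "(\<lambda>x. indicator A x *\<^sub>R f x) \<in> borel_measurable M" by (rule borel_measurable_integrable)
    show "(\<lambda>x. \<Sum>j\<in>J. indicator (B j) x *\<^sub>R f x) \<in> borel_measurable M"
      using int by (intro borel_measurable_sum borel_measurable_integrable)
    show "AE x in M. indicator A x *\<^sub>R f x = (\<Sum>j\<in>J. indicator (B j) x *\<^sub>R f x)"
      using part by eventually_elim (simp add: scaleR_sum_left)
  qed
  also have "\<dots> = (\<Sum>j\<in>J. \<integral>x. indicator (B j) x *\<^sub>R f x \<partial>M)" by (rule Bochner_Integration.integral_sum[OF int])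
  also have "\<dots> = (\<Sum>j\<in>J. \<integral>x. f x \<partial>restrict_space M (B j))"
    using assms(3) by (intro sum.cong refl) (simp add: integral_restrict_space)
  finally show ?thesis .
qed

section \<open>The space, the form and the seminorm of the Helmholtz problem\<close>

locale helmholtz =
  fixes \<Omega> \<Gamma>D \<Gamma>R :: "'a::euclidean_space set" and tr :: "('a \<Rightarrow> complex) \<Rightarrow> 'a \<Rightarrow> complex" and \<kappa> :: real
  assumes lipschitz: "lipschitz_domain \<Omega>"
    and boundary: "frontier \<Omega> = \<Gamma>D \<union> \<Gamma>R" "\<Gamma>D \<inter> \<Gamma>R = {}" "closed \<Gamma>D"
    and trace: "trace_operator \<Omega> tr" and \<kappa>: "\<kappa> > 0"
begin

abbreviation "V \<equiv> V_space \<Omega> \<Gamma>D tr"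
abbreviation "form \<equiv> a_form \<Omega> \<Gamma>R tr \<kappa>"
abbreviation "N \<equiv> V_norm \<Omega> \<kappa>"
abbreviation "null_fun v \<equiv> eq_on_dom \<Omega> v (\<lambda>_. 0)"

lemma domain: "open \<Omega>" "bounded \<Omega>" "\<Omega> \<in> sets lebesgue"
  using lipschitz by (auto simp: lipschitz_domain_def lborelD)

lemma frontier_null: "negligible (frontier \<Omega>)"
  by (rule negligible_frontier_lipschitz_domain[OF lipschitz])

lemma closure_minus_domain: "closure \<Omega> - \<Omega> \<subseteq> frontier \<Omega>"
  using domain(1) by (simp add: frontier_def interior_open)

lemma borel_boundary: "\<Gamma>D \<in> sets borel" "\<Gamma>R \<in> sets borel" "frontier \<Omega> \<in> sets borel"
proof -
  show 1: "\<Gamma>D \<in> sets borel" "frontier \<Omega> \<in> sets borel" using boundary(3) by auto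
  have "\<Gamma>R = frontier \<Omega> - \<Gamma>D" using boundary by blast
  then show "\<Gamma>R \<in> sets borel" using 1 by simp
qed

lemma L2_subdomain:
  assumes "f \<in> L2 (lebesgue_on \<Omega>)" "\<omega> \<in> sets lebesgue" "\<omega> \<subseteq> closure \<Omega>"
  shows "f \<in> L2 (lebesgue_on \<omega>)"
  by (rule L2_lebesgue_almost_subset[OF assms(1) domain(3) assms(2)])
     (rule negligible_subset[OF frontier_null], use assms(3) closure_minus_domain in blast)

lemma AE_subdomain:
  assumes "AE x in lebesgue_on \<Omega>. P x" "\<omega> \<in> sets lebesgue" "\<omega> \<subseteq> closure \<Omega>"
  shows "AE x in lebesgue_on \<omega>. P x"
proof -
  have "AE x in lebesgue. x \<in> \<Omega> \<longrightarrow> P x" using assms(1) domain(3) by (simp add: AE_restrict_space_iff)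
  moreover have "AE x in lebesgue. x \<notin> frontier \<Omega>"
    using frontier_null by (simp add: negligible_iff_null_sets AE_not_in)
  ultimately have "AE x in lebesgue. x \<in> \<omega> \<longrightarrow> P x"
    by eventually_elim (use assms(3) closure_minus_domain in blast)
  then show ?thesis using assms(2) by (simp add: AE_restrict_space_iff)
qed

lemma AE_surface_iff:
  fixes A :: "'a set"
  assumes "A \<in> sets borel"
  shows "(AE x in surface A. P x) \<longleftrightarrow> (AE x in hausdorff_measure (DIM('a) - 1). x \<in> A \<longrightarrow> P x)"
  unfolding surface_def
  by (rule AE_restrict_space_iff) (use assms in \<open>simp add: sets_hausdorff_measure space_hausdorff_measure\<close>)

lemma AE_surface_subset:
  assumes "AE x in surface (frontier \<Omega>). P x" "A \<subseteq> frontier \<Omega>" "A \<in> sets borel"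
  shows "AE x in surface A. P x"
proof -
  have "AE x in hausdorff_measure (DIM('a) - 1). x \<in> frontier \<Omega> \<longrightarrow> P x"
    using assms(1) by (simp only: AE_surface_iff[OF borel_boundary(3)])
  then have "AE x in hausdorff_measure (DIM('a) - 1). x \<in> A \<longrightarrow> P x"
    by eventually_elim (use assms(2) in blast)
  then show ?thesis by (simp only: AE_surface_iff[OF assms(3)])
qed

lemma trace_L2:
  assumes "v \<in> W12 \<Omega>" "A \<subseteq> frontier \<Omega>" "A \<in> sets borel"
  shows "tr v \<in> L2 (surface A)"
proof -
  have "tr v \<in> L2 (surface (frontier \<Omega>))" using trace assms(1) unfolding trace_operator_def by blast
  then show ?thesis
    unfolding surface_def using assms(2,3) borel_boundary
    by (elim L2_restrict_subset) (simp_all add: sets_hausdorff_measure space_hausdorff_measure)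
qed

lemma trace_lin:
  assumes "u \<in> W12 \<Omega>" "v \<in> W12 \<Omega>" "A \<subseteq> frontier \<Omega>" "A \<in> sets borel"
  shows "AE x in surface A. tr (\<lambda>y. u y + c * v y) x = tr u x + c * tr v x"
proof -
  have "\<forall>u\<in>W12 \<Omega>. \<forall>v\<in>W12 \<Omega>. \<forall>c::complex. AE x in surface (frontier \<Omega>).
      tr (\<lambda>y. u y + c * v y) x = tr u x + c * tr v x"
    using trace unfolding trace_operator_def by (elim conjE)
  then show ?thesis using AE_surface_subset[OF _ assms(3,4)] assms(1,2) by simp
qed

lemma W12: "fun_subspace (W12 \<Omega>)"
  by (rule fun_subspace_W12[OF domain(2,3)])

lemma V_W12: "v \<in> V \<Longrightarrow> v \<in> W12 \<Omega>"
  by (simp add: V_space_def)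

lemma V: "fun_subspace V"
  unfolding fun_subspace_def
proof (intro conjI ballI allI)
  have sub: "\<Gamma>D \<subseteq> frontier \<Omega>" using boundary by blast
  have V_iff: "v \<in> V \<longleftrightarrow> v \<in> W12 \<Omega> \<and> (AE x in surface \<Gamma>D. tr v x = 0)" for v by (simp add: V_space_def)
  have z: "(\<lambda>_. 0) \<in> W12 \<Omega>" by (rule fun_subspace_zero[OF W12])
  \<comment> \<open>Linearity with u = v = 0 and c = -1 shows that the trace of 0 equals its
    difference with itself.\<close>
  have "AE x in surface \<Gamma>D. tr (\<lambda>y. 0) x = tr (\<lambda>_. 0) x + (-1) * tr (\<lambda>_. 0) x"
    using trace_lin[OF z z sub borel_boundary(1), of "-1"] by simp
  then show "(\<lambda>_. 0) \<in> V" using z by (simp add: V_iff)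
  fix u v c assume uv: "u \<in> V" "v \<in> V"
  have w: "(\<lambda>x. u x + c * v x) \<in> W12 \<Omega>"
    by (rule fun_subspace_lin[OF W12 V_W12[OF uv(1)] V_W12[OF uv(2)]])
  have "AE x in surface \<Gamma>D. tr u x = 0" "AE x in surface \<Gamma>D. tr v x = 0" using uv by (simp_all add: V_iff)
  with trace_lin[OF V_W12[OF uv(1)] V_W12[OF uv(2)] sub borel_boundary(1), of c]
  have "AE x in surface \<Gamma>D. tr (\<lambda>x. u x + c * v x) x = 0" by eventually_elim simp
  then show "(\<lambda>x. u x + c * v x) \<in> V" using w by (simp only: V_iff)
qed

lemma sesquilinear_mass:
  assumes "\<omega> \<in> sets lebesgue" "\<omega> \<subseteq> closure \<Omega>"
  shows "sesquilinear_on (W12 \<Omega>) (L2_inner (lebesgue_on \<omega>))"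
  by (rule sesquilinear_on_subset[OF sesquilinear_on_L2_inner subsetI]) (rule L2_subdomain[OF W12_L2 assms])

lemma sesquilinear_grad_inner:
  assumes "\<omega> \<in> sets lebesgue" "\<omega> \<subseteq> closure \<Omega>"
  shows "sesquilinear_on (W12 \<Omega>) (grad_inner \<Omega> \<omega>)"
proof -
  have "sesquilinear_on (W12 \<Omega>) (\<lambda>u v. \<Sum>b\<in>Basis. L2_inner (lebesgue_on \<omega>) (wgrad \<Omega> u b) (wgrad \<Omega> v b))"
  proof (rule sesquilinear_on_sum, rule sesquilinear_on_L2_map[OF _ W12])
    fix b :: 'a assume b: "b \<in> Basis"
    show "wgrad \<Omega> u b \<in> L2 (lebesgue_on \<omega>)" if "u \<in> W12 \<Omega>" for u
      by (rule L2_subdomain[OF wgrad_L2[OF that b] assms])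
    show "AE x in lebesgue_on \<omega>. wgrad \<Omega> (\<lambda>x. u x + c * v x) b x = wgrad \<Omega> u b x + c * wgrad \<Omega> v b x"
      if "u \<in> W12 \<Omega>" "v \<in> W12 \<Omega>" for u v c
      by (rule AE_subdomain[OF wgrad_lin[OF domain(1,2) that b] assms])
  qed
  then show ?thesis unfolding grad_inner_def[abs_def] .
qed

lemma sesquilinear_trace:
  assumes "A \<subseteq> frontier \<Omega>" "A \<in> sets borel"
  shows "sesquilinear_on (W12 \<Omega>) (\<lambda>v w. L2_inner (surface A) (tr v) (tr w))"
  by (rule sesquilinear_on_L2_map[OF trace_L2[OF _ assms] W12 trace_lin[OF _ _ assms]])

lemma boundary_part: "\<Gamma>R \<inter> frontier \<omega> \<subseteq> frontier \<Omega>" "\<Gamma>R \<inter> frontier \<omega> \<in> sets borel"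
  using boundary borel_boundary by auto

lemma sesquilinear_form:
  assumes "\<omega> \<in> sets lebesgue" "\<omega> \<subseteq> closure \<Omega>"
  shows "sesquilinear_on (W12 \<Omega>) (form \<omega>)"
proof -
  have "sesquilinear_on (W12 \<Omega>) (\<lambda>v w. grad_inner \<Omega> \<omega> v w +
      ((- of_real (\<kappa>\<^sup>2)) * L2_inner (lebesgue_on \<omega>) v w +
      (- \<i> * of_real \<kappa>) * L2_inner (surface (\<Gamma>R \<inter> frontier \<omega>)) (tr v) (tr w)))"
    by (intro sesquilinear_on_add sesquilinear_on_scale sesquilinear_mass sesquilinear_grad_inner
        sesquilinear_trace boundary_part assms)
  moreover have "form \<omega> = (\<lambda>v w. grad_inner \<Omega> \<omega> v w +
      ((- of_real (\<kappa>\<^sup>2)) * L2_inner (lebesgue_on \<omega>) v w +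
      (- \<i> * of_real \<kappa>) * L2_inner (surface (\<Gamma>R \<inter> frontier \<omega>)) (tr v) (tr w)))"
    by (simp add: a_form_def fun_eq_iff)
  ultimately show ?thesis by simp
qed

section \<open>Functions that vanish almost everywhere\<close>

lemma null_fun_wgrad:
  assumes "v \<in> W12 \<Omega>" "null_fun v" "b \<in> Basis"
  shows "AE x in lebesgue_on \<Omega>. wgrad \<Omega> v b x = 0"
proof -
  have "AE x in lebesgue_on \<Omega>. x \<in> \<Omega> \<longrightarrow> v x = 0"
    using assms(2) unfolding eq_on_dom_def by eventually_elim simp
  from weak_partial_zero_on[OF domain(1,2,1) order_refl assms(3) wgrad_L2[OF assms(1,3)]
      wgrad_weak_partial[OF assms(1,3)] W12_L2[OF assms(1)] this]
  have "AE x in lebesgue_on \<Omega>. x \<in> \<Omega> \<longrightarrow> wgrad \<Omega> v b x = 0" .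
  then show ?thesis using AE_space by eventually_elim (simp add: space_restrict_space)
qed

lemma null_fun_grad_norm:
  assumes "v \<in> W12 \<Omega>" "null_fun v"
  shows "grad_norm \<Omega> \<Omega> v = 0"
proof -
  have "L2_norm (lebesgue_on \<Omega>) (wgrad \<Omega> v b) = 0" if "b \<in> Basis" for b
    using null_fun_wgrad[OF assms that] L2_norm_zero_iff[OF wgrad_L2[OF assms(1) that]] by simp
  then show ?thesis by (simp add: grad_norm_def)
qed

text \<open>Boundedness of the trace operator is what makes the trace independent of the
  representative.\<close>

lemma null_fun_trace:
  assumes "v \<in> W12 \<Omega>" "null_fun v"
  shows "AE x in surface (frontier \<Omega>). tr v x = 0"
proof -
  have "\<exists>K. \<forall>v\<in>W12 \<Omega>. L2_norm (surface (frontier \<Omega>)) (tr v) \<le>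
        K * sqrt ((L2_norm (lebesgue_on \<Omega>) v)\<^sup>2 + (grad_norm \<Omega> \<Omega> v)\<^sup>2)"
    using trace unfolding trace_operator_def by (elim conjE)
  then obtain K where K: "L2_norm (surface (frontier \<Omega>)) (tr v) \<le>
        K * sqrt ((L2_norm (lebesgue_on \<Omega>) v)\<^sup>2 + (grad_norm \<Omega> \<Omega> v)\<^sup>2)" using assms(1) by blast
  have "L2_norm (lebesgue_on \<Omega>) v = 0"
    using L2_norm_zero_iff[OF W12_L2[OF assms(1)]] assms(2) unfolding eq_on_dom_def by simp
  then have "L2_norm (surface (frontier \<Omega>)) (tr v) = 0"
    using K null_fun_grad_norm[OF assms] L2_norm_nonneg[of "surface (frontier \<Omega>)" "tr v"] by simp
  then show ?thesis using L2_norm_zero_iff[OF trace_L2[OF assms(1) order_refl borel_boundary(3)]] by simp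
qed

lemma null_fun_form:
  assumes "v \<in> W12 \<Omega>" "null_fun v" "\<omega> \<in> sets lebesgue" "\<omega> \<subseteq> closure \<Omega>"
  shows "form \<omega> w v = 0"
proof -
  have "grad_inner \<Omega> \<omega> w v = 0"
    unfolding grad_inner_def
    by (intro sum.neutral ballI L2_inner_null AE_subdomain[OF null_fun_wgrad[OF assms(1,2)] assms(3,4)])
  moreover have "L2_inner (lebesgue_on \<omega>) w v = 0"
    by (intro L2_inner_null AE_subdomain[OF _ assms(3,4)]) (use assms(2) in \<open>simp add: eq_on_dom_def\<close>)
  moreover have "L2_inner (surface (\<Gamma>R \<inter> frontier \<omega>)) (tr w) (tr v) = 0"
    by (intro L2_inner_null AE_surface_subset[OF null_fun_trace[OF assms(1,2)]] boundary_part)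
  ultimately show ?thesis by (simp add: a_form_def)
qed

text \<open>The inner product behind \<open>V_norm\<close>: the source of its triangle inequality
  and of the orthogonal projection that attains the minimum over the coarse space.\<close>

definition energy :: "('a \<Rightarrow> complex) \<Rightarrow> ('a \<Rightarrow> complex) \<Rightarrow> complex" where
  "energy v w = of_real (\<kappa>\<^sup>2) * L2_inner (lebesgue_on \<Omega>) v w + grad_inner \<Omega> \<Omega> v w"

lemma grad_inner_self: "grad_inner \<Omega> \<omega> v v = of_real ((grad_norm \<Omega> \<omega> v)\<^sup>2)"
proof -
  have "(grad_norm \<Omega> \<omega> v)\<^sup>2 = (\<Sum>b\<in>Basis. (L2_norm (lebesgue_on \<omega>) (wgrad \<Omega> v b))\<^sup>2)"
    unfolding grad_norm_def by (rule real_sqrt_pow2) (simp add: sum_nonneg)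
  then show ?thesis by (simp only: grad_inner_def L2_inner_self of_real_sum)
qed

lemma N_square: "(N v)\<^sup>2 = \<kappa>\<^sup>2 * (L2_norm (lebesgue_on \<Omega>) v)\<^sup>2 + (grad_norm \<Omega> \<Omega> v)\<^sup>2"
  unfolding V_norm_def by (rule real_sqrt_pow2) simp

lemma N_nonneg: "0 \<le> N v"
  by (simp add: V_norm_def)

lemma energy_self: "energy v v = of_real ((N v)\<^sup>2)"
  by (simp only: energy_def N_square L2_inner_self grad_inner_self of_real_add of_real_mult)

lemma N_eq: "N v = sqrt (Re (energy v v))"
  unfolding energy_self Re_complex_of_real by (rule real_sqrt_unique[symmetric]) (simp_all add: N_nonneg)

lemma sesquilinear_energy: "sesquilinear_on (W12 \<Omega>) energy"
  unfolding energy_def[abs_def]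
  by (rule sesquilinear_on_add[OF sesquilinear_on_scale[OF sesquilinear_mass[OF domain(3) closure_subset]]
        sesquilinear_grad_inner[OF domain(3) closure_subset]])

lemma energy_commute: "energy v u = cnj (energy u v)"
proof -
  have "L2_inner (lebesgue_on \<Omega>) v u = cnj (L2_inner (lebesgue_on \<Omega>) u v)" by (rule L2_inner_commute)
  moreover have "grad_inner \<Omega> \<Omega> v u = cnj (grad_inner \<Omega> \<Omega> u v)"
    unfolding grad_inner_def cnj_sum by (intro sum.cong refl L2_inner_commute)
  ultimately show ?thesis by (simp add: energy_def)
qed

lemma seminorm_N: "seminorm_on V N"
proof -
  have pos: "0 \<le> Re (energy u u)" for u by (simp only: energy_self Re_complex_of_real zero_le_power2)
  have "V \<subseteq> W12 \<Omega>" using V_W12 by blast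
  from seminorm_on_form[OF V sesquilinear_on_subset[OF sesquilinear_energy this] energy_commute pos]
  show ?thesis by (simp only: N_eq[symmetric])
qed

lemma N_zero_iff:
  assumes "v \<in> W12 \<Omega>"
  shows "N v = 0 \<longleftrightarrow> null_fun v"
proof
  assume "N v = 0"
  then have "\<kappa>\<^sup>2 * (L2_norm (lebesgue_on \<Omega>) v)\<^sup>2 + (grad_norm \<Omega> \<Omega> v)\<^sup>2 = 0" by (simp add: V_norm_def)
  then have "\<kappa>\<^sup>2 * (L2_norm (lebesgue_on \<Omega>) v)\<^sup>2 = 0"
    by (simp add: add_nonneg_eq_0_iff)
  then show "null_fun v"
    using \<kappa> L2_norm_zero_iff[OF W12_L2[OF assms]] by (simp add: eq_on_dom_def)
next
  assume n: "null_fun v"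
  then have "L2_norm (lebesgue_on \<Omega>) v = 0"
    using L2_norm_zero_iff[OF W12_L2[OF assms]] by (simp add: eq_on_dom_def)
  then show "N v = 0" using null_fun_grad_norm[OF assms n] by (simp add: V_norm_def)
qed

lemma null_fun_diff: "eq_on_dom \<Omega> u v \<longleftrightarrow> null_fun (\<lambda>x. u x - v x)"
  by (simp add: eq_on_dom_def)

lemma N_cong:
  assumes "u \<in> V" "v \<in> V" "eq_on_dom \<Omega> u v"
  shows "N u = N v"
proof -
  have le: "N u \<le> N v" if uv: "u \<in> V" "v \<in> V" "null_fun (\<lambda>x. u x - v x)" for u v
  proof -
    have d: "(\<lambda>x. u x - v x) \<in> V" by (rule fun_subspace_diff[OF V uv(1,2)])
    show ?thesis using seminorm_on_add[OF seminorm_N uv(2) d] N_zero_iff[OF V_W12[OF d]] uv(3) by simp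
  qed
  have "null_fun (\<lambda>x. u x - v x)" "null_fun (\<lambda>x. v x - u x)"
    using assms(3) unfolding eq_on_dom_def by (eventually_elim, simp)+
  then show ?thesis using le assms(1,2) by (simp add: order_antisym)
qed

lemma grad_norm_le_N: "grad_norm \<Omega> \<Omega> v \<le> N v"
  unfolding V_norm_def by (rule real_le_rsqrt) simp

text \<open>On the diagonal the boundary integral is real, so the boundary term is purely imaginary
  and drops out.\<close>

lemma Re_form_self:
  "Re (form \<omega> v v) = (grad_norm \<Omega> \<omega> v)\<^sup>2 - \<kappa>\<^sup>2 * (L2_norm (lebesgue_on \<omega>) v)\<^sup>2"
proof -
  have "form \<omega> v v = of_real ((grad_norm \<Omega> \<omega> v)\<^sup>2 - \<kappa>\<^sup>2 * (L2_norm (lebesgue_on \<omega>) v)\<^sup>2)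
      - \<i> * of_real (\<kappa> * (L2_norm (surface (\<Gamma>R \<inter> frontier \<omega>)) (tr v))\<^sup>2)"
    unfolding a_form_def grad_inner_self L2_inner_self by (simp only: of_real_diff of_real_mult mult.assoc)
  then show ?thesis by (simp only: minus_complex.sel Re_complex_of_real Re_i_times Im_complex_of_real minus_zero diff_0_right)
qed

end

section \<open>Quasi-interpolation\<close>

lemma L2_norm_square: "(L2_norm M f)\<^sup>2 = (\<integral>x. (cmod (f x))\<^sup>2 \<partial>M)"
  by (simp add: L2_norm_def)

lemma L2_norm_cong_AE:
  assumes "AE x in M. f x = g x" "f \<in> L2 M" "g \<in> L2 M"
  shows "L2_norm M f = L2_norm M g"
proof -
  have m: "f \<in> borel_measurable M" "g \<in> borel_measurable M" using assms(2,3) by (simp_all add: L2_def)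
  have "(\<integral>x. (cmod (f x))\<^sup>2 \<partial>M) = (\<integral>x. (cmod (g x))\<^sup>2 \<partial>M)"
  proof (rule integral_cong_AE)
    show "AE x in M. (cmod (f x))\<^sup>2 = (cmod (g x))\<^sup>2" using assms(1) by eventually_elim simp
  qed (use m in measurable)
  then show ?thesis by (simp add: L2_norm_def)
qed

locale multiscale = helmholtz \<Omega> \<Gamma>D \<Gamma>R tr \<kappa> + conforming_mesh \<Omega> \<G> \<rho> \<theta>
  for \<Omega> \<Gamma>D \<Gamma>R :: "'a::euclidean_space set" and tr \<kappa> \<G> \<rho> \<theta> +
  fixes n :: nat and I :: "('a \<Rightarrow> complex) \<Rightarrow> 'a \<Rightarrow> complex" and Col :: "nat \<Rightarrow> real" and Ca CIH CIHV :: real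
  assumes n: "n \<ge> 1" and overlap: "overlap_bound \<G> Col"
    and interpolation: "quasi_interpolation \<Omega> \<Gamma>D tr \<G> CIH I"
    and form_bound: "\<And>v w. v \<in> V \<Longrightarrow> w \<in> V \<Longrightarrow> cmod (form \<Omega> v w) \<le> Ca * N v * N w"
    and I_stable: "\<And>v. v \<in> V \<Longrightarrow> N (I v) \<le> CIHV * N v"
    and resolution: "CIH * sqrt (Col 1) * mesh_size \<G> * \<kappa> \<le> 1 / sqrt 2"
    and constants: "CIH > 0" "CIHV > 0" "Ca > 0"
begin

abbreviation "VH \<equiv> fe_space \<Omega> \<Gamma>D tr \<G>"
abbreviation "Vh \<equiv> fe_space \<Omega> \<Gamma>D tr (uniform_refinement n \<G>)"
abbreviation "Wh \<equiv> W_fine \<Omega> \<Gamma>D tr (uniform_refinement n \<G>) I"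

lemma fun_subspace_fe_space:
  assumes "\<And>T. T \<in> \<T> \<Longrightarrow> \<exists>p F. ref_map p F T"
  shows "fun_subspace (fe_space \<Omega> \<Gamma>D tr \<T>)"
  using fun_subspace_S1[OF assms, of \<T> \<Omega>] V unfolding fun_subspace_def fe_space_def by simp

lemma VH: "fun_subspace VH"
  by (rule fun_subspace_fe_space) (meson cell_ref)

lemma refinement_ref_map:
  assumes "K \<in> uniform_refinement n \<G>"
  shows "\<exists>p F. ref_map p F K"
proof -
  obtain p F k T where "K = refined_cell n p F k" "ref_map p F T"
    using assms unfolding uniform_refinement_eq by blast
  then show ?thesis using refined_cell_ref_map[OF _ n] by blast
qed

lemma Vh: "fun_subspace Vh"
  by (rule fun_subspace_fe_space[OF refinement_ref_map])

lemma VH_Vh: "v \<in> VH \<Longrightarrow> v \<in> Vh"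
  using fe_space_subset_refinement[OF n] by blast

lemma Vh_V: "v \<in> Vh \<Longrightarrow> v \<in> V"
  by (simp add: fe_space_def)

lemma I_in: "v \<in> V \<Longrightarrow> I v \<in> VH"
  using interpolation unfolding quasi_interpolation_def by (elim conjE) (drule bspec)

lemma I_lin:
  assumes "u \<in> V" "v \<in> V"
  shows "eq_on_dom \<Omega> (I (\<lambda>x. u x + c * v x)) (\<lambda>x. I u x + c * I v x)"
proof -
  have "\<forall>u\<in>V. \<forall>v\<in>V. \<forall>c::complex. eq_on_dom \<Omega> (I (\<lambda>x. u x + c * v x)) (\<lambda>x. I u x + c * I v x)"
    using interpolation unfolding quasi_interpolation_def by (elim conjE)
  then show ?thesis using assms by simp
qed

text \<open>The axioms of the interpolation do not say that it respects equality almost everywhere.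
  Stability does, since it sends null functions to null functions. Surjectivity provides u with v =
  I u almost everywhere, and then I v = I (I u) = I u = v almost everywhere.\<close>

lemma I_proj:
  assumes v: "v \<in> VH"
  shows "eq_on_dom \<Omega> v (I v)"
proof -
  have "\<forall>v\<in>VH. \<exists>u\<in>V. eq_on_dom \<Omega> (I u) v"
    using interpolation unfolding quasi_interpolation_def by (elim conjE)
  moreover have "\<forall>v\<in>V. eq_on_dom \<Omega> (I (I v)) (I v)"
    using interpolation unfolding quasi_interpolation_def by (elim conjE)
  ultimately obtain u where u: "u \<in> V" "eq_on_dom \<Omega> (I u) v" "eq_on_dom \<Omega> (I (I u)) (I u)" using v by blast
  have vV: "v \<in> V" and IuV: "I u \<in> V" using v I_in[OF u(1)] VH_Vh Vh_V by blast+
  let ?d = "\<lambda>x. v x + (-1) * I u x"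
  have d: "?d \<in> V" by (rule fun_subspace_lin[OF V vV IuV])
  have "null_fun ?d" using u(2) unfolding eq_on_dom_def by eventually_elim simp
  then have "N ?d = 0" using N_zero_iff[OF V_W12[OF d]] by simp
  then have "N (I ?d) = 0" using I_stable[OF d] N_nonneg[of "I ?d"] by simp
  moreover have IdW: "I ?d \<in> W12 \<Omega>" using I_in[OF d] VH_Vh Vh_V V_W12 by blast
  ultimately have "null_fun (I ?d)" using N_zero_iff by blast
  then show ?thesis
    using I_lin[OF vV IuV, of "-1"] u(2,3) unfolding eq_on_dom_def by eventually_elim simp
qed

lemma IV: "v \<in> V \<Longrightarrow> I v \<in> V" and VHV: "v \<in> VH \<Longrightarrow> v \<in> V"
  using I_in VH_Vh Vh_V by blast+

lemma cell_lebesgue: "T \<in> \<G> \<Longrightarrow> T \<in> sets lebesgue"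
  using cell_compact lmeasurable_compact by blast

lemma nbhd_lebesgue: "nbhd \<G> S \<in> sets lebesgue"
  using open_nbhd by (simp add: lborelD)

section \<open>Sums over cells and over patches\<close>

lemma AE_single_cell: "AE x in lebesgue. \<forall>T\<in>\<G>. \<forall>K\<in>\<G>. x \<in> T \<longrightarrow> x \<in> K \<longrightarrow> T = K"
proof -
  have "AE x in lebesgue. \<forall>P\<in>{P\<in>\<G> \<times> \<G>. fst P \<noteq> snd P}. x \<notin> fst P \<inter> snd P"
  proof (rule AE_finite_allI)
    show "finite {P\<in>\<G> \<times> \<G>. fst P \<noteq> snd P}" using finite_mesh by simp
    fix P assume "P \<in> {P\<in>\<G> \<times> \<G>. fst P \<noteq> snd P}"
    then have "negligible (fst P \<inter> snd P)" using negligible_cell_inter by (auto simp: mem_Times_iff)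
    then show "AE x in lebesgue. x \<notin> fst P \<inter> snd P" unfolding negligible_iff_null_sets by (rule AE_not_in)
  qed
  then show ?thesis by eventually_elim auto
qed

lemma sum_indicator_single:
  assumes "finite J" "\<And>T K. T \<in> J \<Longrightarrow> K \<in> J \<Longrightarrow> x \<in> B T \<Longrightarrow> x \<in> B K \<Longrightarrow> T = K"
    "x \<in> A \<longleftrightarrow> (\<exists>T\<in>J. x \<in> B T)"
  shows "indicator A x = (\<Sum>T\<in>J. indicator (B T) x :: real)"
proof (cases "x \<in> A")
  case True
  then obtain T where T: "T \<in> J" "x \<in> B T" using assms(3) by blast
  have "(\<Sum>K\<in>J. indicator (B K) x :: real) = (\<Sum>K\<in>J. if K = T then 1 else 0)"
    using assms(2) T by (intro sum.cong) (auto simp: indicator_def)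
  then show ?thesis using True T assms(1) by simp
next
  case False
  then have "(\<Sum>K\<in>J. indicator (B K) x :: real) = 0"
    using assms(3) by (intro sum.neutral) (auto simp: indicator_def)
  then show ?thesis using False by simp
qed

lemma AE_partition: "AE x in lebesgue. indicator \<Omega> x = (\<Sum>T\<in>\<G>. indicator T x :: real)"
proof -
  have "AE x in lebesgue. x \<notin> frontier \<Omega>"
    using frontier_null by (simp add: negligible_iff_null_sets AE_not_in)
  with AE_single_cell show ?thesis
  proof eventually_elim
    case (elim x)
    have "x \<in> \<Omega> \<longleftrightarrow> (\<exists>T\<in>\<G>. x \<in> T)"
      using elim(2) Union_mesh closure_minus_domain closure_subset[of \<Omega>] by blast
    then show ?case using elim(1) by (intro sum_indicator_single finite_mesh) blast+
  qed
qed

lemma integral_cells: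
  fixes f :: "'a \<Rightarrow> 'b::{banach, second_countable_topology}"
  assumes "integrable (lebesgue_on \<Omega>) f" "\<And>T. T \<in> \<G> \<Longrightarrow> integrable (lebesgue_on T) f"
  shows "(\<integral>x. f x \<partial>lebesgue_on \<Omega>) = (\<Sum>T\<in>\<G>. \<integral>x. f x \<partial>lebesgue_on T)"
  by (rule integral_restrict_partition[OF finite_mesh _ _ assms AE_partition])
     (simp_all add: domain cell_lebesgue)

lemma L2_integrable_square: "f \<in> L2 M \<Longrightarrow> integrable M (\<lambda>x. (cmod (f x))\<^sup>2)"
  by (simp add: L2_def)

lemma L2_cell: "f \<in> L2 (lebesgue_on \<Omega>) \<Longrightarrow> T \<in> \<G> \<Longrightarrow> f \<in> L2 (lebesgue_on T)"
  by (rule L2_subdomain[OF _ cell_lebesgue cell_subset])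

lemma L2_nbhd: "f \<in> L2 (lebesgue_on \<Omega>) \<Longrightarrow> f \<in> L2 (lebesgue_on (nbhd \<G> S))"
  by (rule L2_subdomain[OF _ nbhd_lebesgue nbhd_subset_closure])

lemma L2_norm_cells:
  assumes "f \<in> L2 (lebesgue_on \<Omega>)"
  shows "(L2_norm (lebesgue_on \<Omega>) f)\<^sup>2 = (\<Sum>T\<in>\<G>. (L2_norm (lebesgue_on T) f)\<^sup>2)"
  unfolding L2_norm_square
  by (rule integral_cells) (use L2_integrable_square[OF assms] L2_integrable_square[OF L2_cell[OF assms]] in auto)

lemma L2_norm_nbhd_le:
  assumes f: "f \<in> L2 (lebesgue_on \<Omega>)" and T: "T \<in> \<G>"
  shows "(L2_norm (lebesgue_on (nbhd \<G> T)) f)\<^sup>2 \<le>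
    (\<Sum>K\<in>{K\<in>\<G>. K \<inter> T \<noteq> {}}. (L2_norm (lebesgue_on K) f)\<^sup>2)"
proof -
  let ?C = "{K\<in>\<G>. K \<inter> T \<noteq> {}}" and ?f = "\<lambda>x. (cmod (f x))\<^sup>2"
  have clT: "closure T = T" using cell_closed[OF T] by simp
  have int: "integrable lebesgue (\<lambda>x. indicator K x *\<^sub>R ?f x)" if "K \<in> \<G>" for K
    using L2_integrable_square[OF L2_cell[OF f that]] cell_lebesgue[OF that] by (simp add: integrable_restrict_space)
  have int': "integrable lebesgue (\<lambda>x. indicator (nbhd \<G> T) x *\<^sub>R ?f x)"
    using L2_integrable_square[OF L2_nbhd[OF f]] nbhd_lebesgue by (simp add: integrable_restrict_space)
  have "(\<integral>x. indicator (nbhd \<G> T) x *\<^sub>R ?f x \<partial>lebesgue) \<le> (\<integral>x. (\<Sum>K\<in>?C. indicator K x *\<^sub>R ?f x) \<partial>lebesgue)"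
  proof (rule integral_mono[OF int' Bochner_Integration.integrable_sum])
    fix x
    show "indicator (nbhd \<G> T) x *\<^sub>R ?f x \<le> (\<Sum>K\<in>?C. indicator K x *\<^sub>R ?f x)"
    proof (cases "x \<in> nbhd \<G> T")
      case True
      then obtain K where K: "K \<in> ?C" "x \<in> K" using nbhd_subset[of T] unfolding clT by blast
      have "indicator K x *\<^sub>R ?f x \<le> (\<Sum>K\<in>?C. indicator K x *\<^sub>R ?f x)"
        by (rule member_le_sum[OF K(1)]) (use finite_mesh in auto)
      then show ?thesis using True K by simp
    qed (simp add: sum_nonneg)
  qed (use int in auto)
  also have "\<dots> = (\<Sum>K\<in>?C. \<integral>x. indicator K x *\<^sub>R ?f x \<partial>lebesgue)"
    using int by (intro Bochner_Integration.integral_sum) auto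
  also have "\<dots> = (\<Sum>K\<in>?C. \<integral>x. ?f x \<partial>lebesgue_on K)"
    using cell_lebesgue by (intro sum.cong refl) (simp add: integral_restrict_space)
  finally show ?thesis unfolding L2_norm_square using nbhd_lebesgue by (simp add: integral_restrict_space)
qed

text \<open>Exchanging the sums counts each cell once for every cell that meets it, hence at most
  \<open>Col 1\<close> times.\<close>

lemma L2_norm_nbhds_le:
  assumes f: "f \<in> L2 (lebesgue_on \<Omega>)"
  shows "(\<Sum>T\<in>\<G>. (L2_norm (lebesgue_on (nbhd \<G> T)) f)\<^sup>2) \<le> Col 1 * (L2_norm (lebesgue_on \<Omega>) f)\<^sup>2"
proof -
  have "(\<Sum>T\<in>\<G>. (L2_norm (lebesgue_on (nbhd \<G> T)) f)\<^sup>2) \<le>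
      (\<Sum>T\<in>\<G>. \<Sum>K\<in>{K\<in>\<G>. K \<inter> T \<noteq> {}}. (L2_norm (lebesgue_on K) f)\<^sup>2)"
    using L2_norm_nbhd_le[OF f] by (rule sum_mono)
  also have "\<dots> = (\<Sum>K\<in>\<G>. \<Sum>T\<in>{T\<in>\<G>. K \<inter> T \<noteq> {}}. (L2_norm (lebesgue_on K) f)\<^sup>2)"
    by (rule sum.swap_restrict[OF finite_mesh finite_mesh])
  also have "\<dots> = (\<Sum>K\<in>\<G>. real (card {T\<in>\<G>. T \<inter> K \<noteq> {}}) * (L2_norm (lebesgue_on K) f)\<^sup>2)"
    by (simp add: Int_commute)
  also have "\<dots> \<le> (\<Sum>K\<in>\<G>. Col 1 * (L2_norm (lebesgue_on K) f)\<^sup>2)"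
    using card_neighbours[OF overlap] by (intro sum_mono mult_right_mono) auto
  also have "\<dots> = Col 1 * (L2_norm (lebesgue_on \<Omega>) f)\<^sup>2"
    unfolding L2_norm_cells[OF f] by (simp add: sum_distrib_left)
  finally show ?thesis .
qed

lemma grad_norm_square: "(grad_norm \<Omega> \<omega> v)\<^sup>2 = (\<Sum>b\<in>Basis. (L2_norm (lebesgue_on \<omega>) (wgrad \<Omega> v b))\<^sup>2)"
  unfolding grad_norm_def by (rule real_sqrt_pow2) (simp add: sum_nonneg)

lemma grad_norm_nonneg: "0 \<le> grad_norm \<Omega> \<omega> v"
  by (simp add: grad_norm_def sum_nonneg)

lemma grad_norm_nbhds_le:
  assumes v: "v \<in> W12 \<Omega>"
  shows "(\<Sum>T\<in>\<G>. (grad_norm \<Omega> (nbhd \<G> T) v)\<^sup>2) \<le> Col 1 * (grad_norm \<Omega> \<Omega> v)\<^sup>2"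
  unfolding grad_norm_square sum_distrib_left
  by (subst sum.swap) (intro sum_mono L2_norm_nbhds_le wgrad_L2[OF v])

lemma grad_norm_cells:
  assumes v: "v \<in> W12 \<Omega>"
  shows "(grad_norm \<Omega> \<Omega> v)\<^sup>2 = (\<Sum>T\<in>\<G>. (grad_norm \<Omega> T v)\<^sup>2)"
  unfolding grad_norm_square
  by (subst sum.swap) (intro sum.cong refl L2_norm_cells wgrad_L2[OF v])

lemma interpolation_local:
  assumes "T \<in> \<G>" "v \<in> V"
  shows "L2_norm (lebesgue_on T) (\<lambda>x. v x - I v x) \<le> mesh_size \<G> * (CIH * grad_norm \<Omega> (nbhd \<G> T) v)"
    and "grad_norm \<Omega> T (I v) \<le> CIH * grad_norm \<Omega> (nbhd \<G> T) v"
proof -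
  have "\<forall>T\<in>\<G>. \<forall>v\<in>V. L2_norm (lebesgue_on T) (\<lambda>x. v x - I v x) / mesh_size \<G> + grad_norm \<Omega> T (I v)
          \<le> CIH * grad_norm \<Omega> (nbhd \<G> T) v"
    using interpolation unfolding quasi_interpolation_def by (elim conjE)
  then have *: "L2_norm (lebesgue_on T) (\<lambda>x. v x - I v x) / mesh_size \<G> + grad_norm \<Omega> T (I v)
          \<le> CIH * grad_norm \<Omega> (nbhd \<G> T) v" using assms by blast
  have "0 \<le> L2_norm (lebesgue_on T) (\<lambda>x. v x - I v x) / mesh_size \<G>"
    using mesh_size_pos L2_norm_nonneg[of "lebesgue_on T" "\<lambda>x. v x - I v x"] by simp
  then show "grad_norm \<Omega> T (I v) \<le> CIH * grad_norm \<Omega> (nbhd \<G> T) v" using * by linarith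
  have "L2_norm (lebesgue_on T) (\<lambda>x. v x - I v x) / mesh_size \<G> \<le> CIH * grad_norm \<Omega> (nbhd \<G> T) v"
    using * grad_norm_nonneg[of T "I v"] by linarith
  then show "L2_norm (lebesgue_on T) (\<lambda>x. v x - I v x) \<le> mesh_size \<G> * (CIH * grad_norm \<Omega> (nbhd \<G> T) v)"
    using mesh_size_pos by (simp add: pos_divide_le_eq mult.commute)
qed

text \<open>The common passage from local to global interpolation estimates. Squares are added, so
  the overlap constant enters under a root.\<close>

lemma sum_square_bound:
  assumes v: "v \<in> V" and le: "\<And>T. T \<in> \<G> \<Longrightarrow> 0 \<le> f T \<and> f T \<le> c * grad_norm \<Omega> (nbhd \<G> T) v"
    and F: "F\<^sup>2 = (\<Sum>T\<in>\<G>. (f T)\<^sup>2)" and c: "0 \<le> c"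
  shows "F \<le> c * sqrt (Col 1) * grad_norm \<Omega> \<Omega> v"
proof -
  have "F\<^sup>2 \<le> (\<Sum>T\<in>\<G>. c\<^sup>2 * (grad_norm \<Omega> (nbhd \<G> T) v)\<^sup>2)"
    unfolding F power_mult_distrib[symmetric] using le by (intro sum_mono power_mono) auto
  also have "\<dots> \<le> c\<^sup>2 * (Col 1 * (grad_norm \<Omega> \<Omega> v)\<^sup>2)"
    unfolding sum_distrib_left[symmetric] by (intro mult_left_mono grad_norm_nbhds_le V_W12[OF v]) auto
  also have "\<dots> = (c * sqrt (Col 1) * grad_norm \<Omega> \<Omega> v)\<^sup>2"
    using overlap_nonneg[OF overlap, of 1] by (simp add: power_mult_distrib)
  finally show ?thesis
    using c overlap_nonneg[OF overlap, of 1] grad_norm_nonneg by (elim power2_le_imp_le) auto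
qed

lemma interpolation_L2:
  assumes v: "v \<in> V"
  shows "L2_norm (lebesgue_on \<Omega>) (\<lambda>x. v x - I v x) \<le> mesh_size \<G> * CIH * sqrt (Col 1) * grad_norm \<Omega> \<Omega> v"
proof (rule sum_square_bound[OF v])
  have "I v \<in> V" using I_in[OF v] VH_Vh Vh_V by blast
  then have "(\<lambda>x. v x - I v x) \<in> L2 (lebesgue_on \<Omega>)"
    using fun_subspace_diff[OF V v] V_W12 W12_L2 by blast
  then show "(L2_norm (lebesgue_on \<Omega>) (\<lambda>x. v x - I v x))\<^sup>2 =
      (\<Sum>T\<in>\<G>. (L2_norm (lebesgue_on T) (\<lambda>x. v x - I v x))\<^sup>2)" by (rule L2_norm_cells)
qed (use interpolation_local(1)[OF _ v] mesh_size_pos constants in \<open>auto simp: L2_norm_nonneg mult.assoc\<close>)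

lemma interpolation_grad:
  assumes v: "v \<in> V"
  shows "grad_norm \<Omega> \<Omega> (I v) \<le> CIH * sqrt (Col 1) * grad_norm \<Omega> \<Omega> v"
proof (rule sum_square_bound[OF v])
  have "I v \<in> W12 \<Omega>" using I_in[OF v] VH_Vh Vh_V V_W12 by blast
  then show "(grad_norm \<Omega> \<Omega> (I v))\<^sup>2 = (\<Sum>T\<in>\<G>. (grad_norm \<Omega> T (I v))\<^sup>2)" by (rule grad_norm_cells)
qed (use interpolation_local(2)[OF _ v] constants in \<open>auto simp: grad_norm_nonneg\<close>)

section \<open>Coercivity on the kernel of the interpolation\<close>

lemma Wh_Vh: "w \<in> Wh \<Longrightarrow> w \<in> Vh" and Wh_V: "w \<in> Wh \<Longrightarrow> w \<in> V"
  and Wh_I: "w \<in> Wh \<Longrightarrow> null_fun (I w)"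
  by (auto simp: W_fine_def Vh_V)

text \<open>The origin of the resolution condition: as I w vanishes, w is its own interpolation
  error. So \<kappa> times its norm is at most
  \<open>CIH * sqrt (Col 1) * mesh_size \<G> * \<kappa>\<close> times that of its gradient.\<close>

lemma Wh_mass_le:
  assumes w: "w \<in> Wh"
  shows "\<kappa>\<^sup>2 * (L2_norm (lebesgue_on \<Omega>) w)\<^sup>2 \<le> (grad_norm \<Omega> \<Omega> w)\<^sup>2 / 2"
proof -
  have wV: "w \<in> V" and IwV: "I w \<in> V" using Wh_V[OF w] I_in VH_Vh Vh_V by blast+
  have "L2_norm (lebesgue_on \<Omega>) w = L2_norm (lebesgue_on \<Omega>) (\<lambda>x. w x - I w x)"
  proof (rule L2_norm_cong_AE)
    show "AE x in lebesgue_on \<Omega>. w x = w x - I w x"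
      using Wh_I[OF w] unfolding eq_on_dom_def by eventually_elim simp
    show "w \<in> L2 (lebesgue_on \<Omega>)" by (rule W12_L2[OF V_W12[OF wV]])
    show "(\<lambda>x. w x - I w x) \<in> L2 (lebesgue_on \<Omega>)"
      by (rule W12_L2[OF V_W12[OF fun_subspace_diff[OF V wV IwV]]])
  qed
  then have "\<kappa> * L2_norm (lebesgue_on \<Omega>) w \<le> \<kappa> * (mesh_size \<G> * CIH * sqrt (Col 1) * grad_norm \<Omega> \<Omega> w)"
    using interpolation_L2[OF wV] \<kappa> by simp
  also have "\<dots> = (CIH * sqrt (Col 1) * mesh_size \<G> * \<kappa>) * grad_norm \<Omega> \<Omega> w" by simp
  also have "\<dots> \<le> 1 / sqrt 2 * grad_norm \<Omega> \<Omega> w"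
    by (rule mult_right_mono[OF resolution grad_norm_nonneg])
  finally have "(\<kappa> * L2_norm (lebesgue_on \<Omega>) w)\<^sup>2 \<le> (1 / sqrt 2 * grad_norm \<Omega> \<Omega> w)\<^sup>2"
    using \<kappa> L2_norm_nonneg[of "lebesgue_on \<Omega>" w] by (intro power_mono) auto
  then show ?thesis by (simp add: power_mult_distrib power_divide)
qed

text \<open>The origin of sqrt (3 / 2) in the oversampling conditions: the mass term adds at most
  half of the squared gradient norm.\<close>

lemma Wh_N_le:
  assumes w: "w \<in> Wh"
  shows "N w \<le> sqrt (3 / 2) * grad_norm \<Omega> \<Omega> w"
proof -
  have "(N w)\<^sup>2 \<le> 3 / 2 * (grad_norm \<Omega> \<Omega> w)\<^sup>2" using Wh_mass_le[OF w] by (simp add: N_square)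
  also have "\<dots> = (sqrt (3 / 2) * grad_norm \<Omega> \<Omega> w)\<^sup>2" by (simp add: power_mult_distrib)
  finally show ?thesis by (rule power2_le_imp_le) (simp add: grad_norm_nonneg)
qed

lemma L2_norm_support:
  assumes f: "f \<in> L2 (lebesgue_on \<Omega>)" and \<omega>: "\<omega> \<in> sets lebesgue" "\<omega> \<subseteq> closure \<Omega>"
    and zero: "AE x in lebesgue_on \<Omega>. x \<notin> \<omega> \<longrightarrow> f x = 0"
  shows "L2_norm (lebesgue_on \<omega>) f = L2_norm (lebesgue_on \<Omega>) f"
proof -
  let ?f = "\<lambda>x. (cmod (f x))\<^sup>2"
  have "integrable lebesgue (\<lambda>x. indicator \<Omega> x *\<^sub>R ?f x)" "integrable lebesgue (\<lambda>x. indicator \<omega> x *\<^sub>R ?f x)"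
    using L2_integrable_square[OF f] L2_integrable_square[OF L2_subdomain[OF f \<omega>]] domain(3) \<omega>
    by (simp_all add: integrable_restrict_space)
  note m = borel_measurable_integrable[OF this(1)] borel_measurable_integrable[OF this(2)]
  have "AE x in lebesgue. x \<in> \<Omega> \<longrightarrow> x \<notin> \<omega> \<longrightarrow> f x = 0"
    using zero domain(3) by (simp add: AE_restrict_space_iff)
  moreover have "AE x in lebesgue. x \<notin> frontier \<Omega>"
    using frontier_null by (simp add: negligible_iff_null_sets AE_not_in)
  ultimately have "AE x in lebesgue. indicator \<omega> x *\<^sub>R ?f x = indicator \<Omega> x *\<^sub>R ?f x"
  proof eventually_elim
    case (elim x)
    have "x \<in> \<omega> \<Longrightarrow> x \<in> \<Omega>" using elim(2) \<omega>(2) closure_minus_domain by blast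
    then show ?case using elim(1) by (auto simp: indicator_def)
  qed
  then have "(\<integral>x. indicator \<omega> x *\<^sub>R ?f x \<partial>lebesgue) = (\<integral>x. indicator \<Omega> x *\<^sub>R ?f x \<partial>lebesgue)"
    using m by (intro integral_cong_AE)
  then show ?thesis using \<omega> domain(3) by (simp add: L2_norm_def integral_restrict_space)
qed

text \<open>A kernel function supported in \<omega> has all its gradient and mass there, so the real
  part of the local form equals the global one and is at least half of the squared gradient norm.
  The general \<omega> covers the patches of the local correctors as well as \<Omega>
  itself.\<close>

lemma Wh_coercive:
  assumes w: "w \<in> Wh" and \<omega>: "open \<omega>" "\<omega> \<subseteq> closure \<Omega>" "negligible (frontier \<omega>)"
    and zero: "\<forall>x\<in>\<Omega> - \<omega>. w x = 0" and form0: "form \<omega> w w = 0"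
  shows "null_fun w"
proof -
  have wW: "w \<in> W12 \<Omega>" using Wh_V[OF w] V_W12 by blast
  have \<omega>l: "\<omega> \<in> sets lebesgue" using \<omega>(1) by (simp add: lborelD)
  have U: "open (\<Omega> - closure \<omega>)" using domain(1) by (simp add: open_Diff)
  have "AE x in lebesgue_on \<Omega>. x \<in> \<Omega> - closure \<omega> \<longrightarrow> w x = 0"
    using zero closure_subset[of \<omega>] by (intro AE_I2) blast
  \<comment> \<open>Locality makes the gradient vanish off the closure of \<omega>; that
    \<open>frontier \<omega>\<close> is a null set bridges the gap to \<omega>.\<close>
  note grad0 = weak_partial_zero_on[OF domain(1,2) U Diff_subset _ wgrad_L2[OF wW]
      wgrad_weak_partial[OF wW] W12_L2[OF wW] this]
  have nf: "AE x in lebesgue_on \<Omega>. x \<notin> frontier \<omega>"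
  proof -
    have "AE x in lebesgue. x \<notin> frontier \<omega>" using \<omega>(3) by (simp add: negligible_iff_null_sets AE_not_in)
    then have "AE x in lebesgue. x \<in> \<Omega> \<longrightarrow> x \<notin> frontier \<omega>" by eventually_elim simp
    then show ?thesis using domain(3) by (simp add: AE_restrict_space_iff)
  qed
  have "L2_norm (lebesgue_on \<omega>) (wgrad \<Omega> w b) = L2_norm (lebesgue_on \<Omega>) (wgrad \<Omega> w b)" if b: "b \<in> Basis" for b
  proof (rule L2_norm_support[OF wgrad_L2[OF wW b] \<omega>l \<omega>(2)])
    show "AE x in lebesgue_on \<Omega>. x \<notin> \<omega> \<longrightarrow> wgrad \<Omega> w b x = 0"
      using grad0[OF b b b] nf AE_space
    proof eventually_elim
      case (elim x)
      then show ?case using \<omega>(1) by (auto simp: frontier_def interior_open space_restrict_space)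
    qed
  qed
  then have g: "grad_norm \<Omega> \<omega> w = grad_norm \<Omega> \<Omega> w" by (simp add: grad_norm_def)
  have "L2_norm (lebesgue_on \<omega>) w = L2_norm (lebesgue_on \<Omega>) w"
    by (rule L2_norm_support[OF W12_L2[OF wW] \<omega>l \<omega>(2)], rule AE_I2) (use zero in \<open>auto simp: space_restrict_space\<close>)
  then have "(grad_norm \<Omega> \<Omega> w)\<^sup>2 - \<kappa>\<^sup>2 * (L2_norm (lebesgue_on \<Omega>) w)\<^sup>2 = 0"
    using Re_form_self[of \<omega> w] form0 g by simp
  then have "(grad_norm \<Omega> \<Omega> w)\<^sup>2 \<le> 0" using Wh_mass_le[OF w] by linarith
  then have "grad_norm \<Omega> \<Omega> w = 0" by simp
  then have "N w = 0" using Wh_N_le[OF w] N_nonneg[of w] by simp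
  then show ?thesis using N_zero_iff[OF wW] by simp
qed

text \<open>Outside the null sets shared by two cells, a point of \<Gamma>R lies in exactly one
  cell, and on the frontier of that cell.\<close>

lemma AE_surface_partition:
  "AE x in hausdorff_measure (DIM('a) - 1). indicator \<Gamma>R x = (\<Sum>T\<in>\<G>. indicator (\<Gamma>R \<inter> frontier T) x :: real)"
proof -
  have "AE x in hausdorff_measure (DIM('a) - 1). \<forall>P\<in>{P\<in>\<G> \<times> \<G>. fst P \<noteq> snd P}. x \<notin> fst P \<inter> snd P \<inter> frontier \<Omega>"
  proof (rule AE_finite_allI)
    show "finite {P\<in>\<G> \<times> \<G>. fst P \<noteq> snd P}" using finite_mesh by simp
    fix P assume "P \<in> {P\<in>\<G> \<times> \<G>. fst P \<noteq> snd P}"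
    then have "fst P \<inter> snd P \<inter> frontier \<Omega> \<in> null_sets (hausdorff_measure (DIM('a) - 1))"
      using surface_null_cell_inter by (auto simp: mem_Times_iff)
    then show "AE x in hausdorff_measure (DIM('a) - 1). x \<notin> fst P \<inter> snd P \<inter> frontier \<Omega>" by (rule AE_not_in)
  qed
  then show ?thesis
  proof eventually_elim
    case (elim x)
    have fr: "frontier T \<subseteq> T" if "T \<in> \<G>" for T using cell_closed[OF that] by (simp add: frontier_subset_closed)
    have "T = K" if "T \<in> \<G>" "K \<in> \<G>" "x \<in> \<Gamma>R \<inter> frontier T" "x \<in> \<Gamma>R \<inter> frontier K" for T K
    proof (rule ccontr)
      assume "T \<noteq> K"
      then have "x \<notin> T \<inter> K \<inter> frontier \<Omega>" using elim that(1,2) by force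
      then show False using that fr boundary(1) by blast
    qed
    moreover have "x \<in> \<Gamma>R \<longleftrightarrow> (\<exists>T\<in>\<G>. x \<in> \<Gamma>R \<inter> frontier T)"
    proof
      assume x: "x \<in> \<Gamma>R"
      then have "x \<in> frontier \<Omega>" using boundary by blast
      moreover from this obtain T where "T \<in> \<G>" "x \<in> T" using Union_mesh by (auto simp: frontier_def)
      ultimately show "\<exists>T\<in>\<G>. x \<in> \<Gamma>R \<inter> frontier T" using frontier_cell x by blast
    qed blast
    ultimately show ?case by (intro sum_indicator_single finite_mesh) blast+
  qed
qed

text \<open>Needed to add up the ideal corrector problems: their right-hand sides are the cell
  forms, whose sum has to be the full form.\<close>

lemma form_cells:
  assumes v: "v \<in> W12 \<Omega>" "w \<in> W12 \<Omega>"
  shows "form \<Omega> v w = (\<Sum>T\<in>\<G>. form T v w)"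
proof -
  have L2: "L2_inner (lebesgue_on \<Omega>) f g = (\<Sum>T\<in>\<G>. L2_inner (lebesgue_on T) f g)"
    if "f \<in> L2 (lebesgue_on \<Omega>)" "g \<in> L2 (lebesgue_on \<Omega>)" for f g
    unfolding L2_inner_def
    by (rule integral_cells[OF L2_integrable_product[OF that] L2_integrable_product[OF L2_cell[OF that(1)] L2_cell[OF that(2)]]])
  have grad: "grad_inner \<Omega> \<Omega> v w = (\<Sum>T\<in>\<G>. grad_inner \<Omega> T v w)"
  proof -
    have "grad_inner \<Omega> \<Omega> v w = (\<Sum>b\<in>Basis. \<Sum>T\<in>\<G>. L2_inner (lebesgue_on T) (wgrad \<Omega> v b) (wgrad \<Omega> w b))"
      unfolding grad_inner_def by (intro sum.cong refl L2 wgrad_L2 v)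
    also have "\<dots> = (\<Sum>T\<in>\<G>. grad_inner \<Omega> T v w)" unfolding grad_inner_def by (rule sum.swap)
    finally show ?thesis .
  qed
  have R: "\<Gamma>R \<inter> frontier \<Omega> = \<Gamma>R" "\<Gamma>R \<subseteq> frontier \<Omega>" using boundary(1) by auto
  have surf: "L2_inner (surface \<Gamma>R) (tr v) (tr w) = (\<Sum>T\<in>\<G>. L2_inner (surface (\<Gamma>R \<inter> frontier T)) (tr v) (tr w))"
    unfolding L2_inner_def surface_def
  proof (rule integral_restrict_partition[OF finite_mesh _ _ _ _ AE_surface_partition])
    show "\<Gamma>R \<inter> space (hausdorff_measure (DIM('a) - 1)) \<in> sets (hausdorff_measure (DIM('a) - 1))"
      "(\<Gamma>R \<inter> frontier T) \<inter> space (hausdorff_measure (DIM('a) - 1)) \<in> sets (hausdorff_measure (DIM('a) - 1))" for T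
      using borel_boundary boundary_part(2) by (simp_all add: sets_hausdorff_measure space_hausdorff_measure)
    show "integrable (restrict_space (hausdorff_measure (DIM('a) - 1)) \<Gamma>R) (\<lambda>x. tr v x * cnj (tr w x))"
      using L2_integrable_product[OF trace_L2[OF v(1) R(2) borel_boundary(2)] trace_L2[OF v(2) R(2) borel_boundary(2)]]
      by (simp add: surface_def)
    show "integrable (restrict_space (hausdorff_measure (DIM('a) - 1)) (\<Gamma>R \<inter> frontier T)) (\<lambda>x. tr v x * cnj (tr w x))" for T
      using L2_integrable_product[OF trace_L2[OF v(1) boundary_part[of T]] trace_L2[OF v(2) boundary_part[of T]]]
      by (simp add: surface_def)
  qed
  have "(\<Sum>T\<in>\<G>. form T v w) = (\<Sum>T\<in>\<G>. grad_inner \<Omega> T v w)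
      - of_real (\<kappa>\<^sup>2) * (\<Sum>T\<in>\<G>. L2_inner (lebesgue_on T) v w)
      - \<i> * of_real \<kappa> * (\<Sum>T\<in>\<G>. L2_inner (surface (\<Gamma>R \<inter> frontier T)) (tr v) (tr w))"
    unfolding a_form_def by (simp only: sum_subtractf sum_distrib_left)
  then show ?thesis
    unfolding a_form_def R(1) grad L2[OF W12_L2[OF v(1)] W12_L2[OF v(2)]] surf by simp
qed

end

section \<open>Correctors and the Petrov-Galerkin method\<close>

text \<open>Since ln \<beta> is negative, the hypothesis on m bounds m ln \<beta> by - ln X,
  whatever the sign of ln X. The case X = 0 stands apart, as \<open>ln\<close> has only a default
  value there.\<close>

lemma power_le_inverse_if_ln_bound:
  fixes \<beta> X :: real
  assumes "0 < \<beta>" "\<beta> < 1" "real m \<ge> \<bar>ln X\<bar> / \<bar>ln \<beta>\<bar>" "0 \<le> X"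
  shows "X * \<beta> ^ m \<le> 1"
proof (cases "X = 0")
  case False
  then have X: "X > 0" using assms(4) by simp
  have "ln \<beta> < 0" using assms by simp
  then have p: "0 < - ln \<beta>" and "\<bar>ln \<beta>\<bar> = - ln \<beta>" by simp_all
  then have "\<bar>ln X\<bar> / - ln \<beta> \<le> real m" using assms(3) by (simp only:)
  then have "\<bar>ln X\<bar> \<le> real m * - ln \<beta>" by (simp only: pos_divide_le_eq[OF p])
  then have "ln X + real m * ln \<beta> \<le> 0" by (simp add: abs_le_iff)
  then have "ln (X * \<beta> ^ m) \<le> 0" using X assms(1) by (simp add: ln_mult ln_realpow)
  then show ?thesis using X assms(1) by simp
qed simp

context multiscale
begin

section \<open>Linearity of the correctors and consequences of the projection property\<close>

lemma Wh: "fun_subspace Wh"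
  unfolding fun_subspace_def
proof (intro conjI ballI allI)
  have z: "(\<lambda>_. 0) \<in> Vh" "(\<lambda>_. 0) \<in> V" by (rule fun_subspace_zero[OF Vh], rule fun_subspace_zero[OF V])
  have "null_fun (I (\<lambda>_. 0))"
    using I_lin[OF z(2,2), of "-1"] by (simp add: eq_on_dom_def)
  then show "(\<lambda>_. 0) \<in> Wh" using z by (simp add: W_fine_def)
  fix u v c assume uv: "u \<in> Wh" "v \<in> Wh"
  have w: "(\<lambda>x. u x + c * v x) \<in> Vh" by (rule fun_subspace_lin[OF Vh Wh_Vh[OF uv(1)] Wh_Vh[OF uv(2)]])
  have "null_fun (I (\<lambda>x. u x + c * v x))"
    using I_lin[OF Wh_V[OF uv(1)] Wh_V[OF uv(2)], of c] Wh_I[OF uv(1)] Wh_I[OF uv(2)]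
    unfolding eq_on_dom_def by eventually_elim simp
  then show "(\<lambda>x. u x + c * v x) \<in> Wh" using w by (simp only: W_fine_def mem_Collect_eq simp_thms)
qed

lemma Wh_on: "fun_subspace (W_fine_on \<Omega> \<Gamma>D tr (uniform_refinement n \<G>) I \<omega>)"
  using fun_subspace_zero[OF Wh] fun_subspace_lin[OF Wh] unfolding fun_subspace_def W_fine_on_def by simp

text \<open>Correctors are known only through the problems that they solve. Both sides solve the
  same one, so the form vanishes on their difference, which is null by coercivity on the patch. This
  extends orthogonality from the generators of the test space to corrected versions of all coarse
  functions.\<close>

lemma corrector_linear:
  assumes lc: "local_correctors \<Omega> \<Gamma>D \<Gamma>R tr \<kappa> \<G> (uniform_refinement n \<G>) I m CT" and m: "m \<ge> 1" and T: "T \<in> \<G>"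
    and \<Lambda>: "\<And>z. z \<in> J \<Longrightarrow> \<Lambda> z \<in> VH" and v: "v \<in> VH"
    and eq: "eq_on_dom \<Omega> v (\<lambda>x. \<Sum>z\<in>J. c z * \<Lambda> z x)"
  shows "eq_on_dom \<Omega> (CT T v) (\<lambda>x. \<Sum>z\<in>J. c z * CT T (\<Lambda> z) x)"
proof -
  define \<omega> where "\<omega> = patch \<G> m T"
  define W where "W = W_fine_on \<Omega> \<Gamma>D tr (uniform_refinement n \<G>) I \<omega>"
  \<comment> \<open>For m at least 1 the patch is a value of \<open>nbhd\<close>, hence open with a
    null boundary; for m = 0 it would be the closed cell.\<close>
  obtain S where \<omega>S: "\<omega> = nbhd \<G> S"
    using m unfolding \<omega>_def patch_def by (cases m) auto
  have \<omega>: "open \<omega>" "\<omega> \<subseteq> closure \<Omega>" "negligible (frontier \<omega>)" "\<omega> \<in> sets lebesgue"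
    unfolding \<omega>S by (rule open_nbhd nbhd_subset_closure negligible_frontier_nbhd nbhd_lebesgue)+
  have W: "fun_subspace W" unfolding W_def by (rule Wh_on)
  have W_Wh: "w \<in> W \<Longrightarrow> w \<in> Wh" for w by (simp add: W_def W_fine_on_def)
  have W_W12: "w \<in> W \<Longrightarrow> w \<in> W12 \<Omega>" for w using W_Wh Wh_V V_W12 by blast
  have VHW12: "u \<in> VH \<Longrightarrow> u \<in> W12 \<Omega>" for u using VH_Vh Vh_V V_W12 by blast
  have "\<forall>v\<in>VH. CT T v \<in> W \<and> (\<forall>w\<in>W. form \<omega> w (CT T v) = form T w v)"
    using lc T unfolding local_correctors_def W_def \<omega>_def by blast
  then have C: "CT T u \<in> W" "\<And>w. w \<in> W \<Longrightarrow> form \<omega> w (CT T u) = form T w u" if "u \<in> VH" for u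
    using that by blast+
  define s where "s = (\<lambda>x. \<Sum>z\<in>J. c z * \<Lambda> z x)"
  define Cs where "Cs = (\<lambda>x. \<Sum>z\<in>J. c z * CT T (\<Lambda> z) x)"
  have s: "s \<in> W12 \<Omega>" unfolding s_def by (rule fun_subspace_sum[OF W12]) (rule VHW12[OF \<Lambda>])
  have Cs: "Cs \<in> W" unfolding Cs_def by (rule fun_subspace_sum[OF W]) (rule C(1)[OF \<Lambda>])
  define d where "d = (\<lambda>x. CT T v x - Cs x)"
  have d: "d \<in> W" unfolding d_def by (rule fun_subspace_diff[OF W C(1)[OF v] Cs])
  note sq = sesquilinear_form[OF \<omega>(4,2)] and sqT = sesquilinear_form[OF cell_lebesgue[OF T] cell_subset[OF T]]
  have "form \<omega> d d = form \<omega> d (CT T v) - form \<omega> d Cs"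
    using sesquilinear_on_diff_right[OF sq W_W12[OF C(1)[OF v]] W_W12[OF Cs] W_W12[OF d]] by (simp only: d_def[symmetric])
  also have "form \<omega> d Cs = (\<Sum>z\<in>J. cnj (c z) * form \<omega> d (CT T (\<Lambda> z)))"
    unfolding Cs_def by (rule sesquilinear_on_sum_right[OF sq W12 _ W_W12[OF d]]) (rule W_W12[OF C(1)[OF \<Lambda>]])
  also have "\<dots> = (\<Sum>z\<in>J. cnj (c z) * form T d (\<Lambda> z))"
    using C(2)[OF \<Lambda> d] by simp
  also have "\<dots> = form T d s"
    unfolding s_def by (rule sesquilinear_on_sum_right[OF sqT W12 _ W_W12[OF d], symmetric]) (rule VHW12[OF \<Lambda>])
  also have "form \<omega> d (CT T v) - form T d s = form T d (\<lambda>x. v x - s x)"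
    using sesquilinear_on_diff_right[OF sqT VHW12[OF v] s W_W12[OF d]] C(2)[OF v d] by simp
  also have "\<dots> = 0"
    by (rule null_fun_form[OF fun_subspace_diff[OF W12 VHW12[OF v] s] _ cell_lebesgue[OF T] cell_subset[OF T]])
       (use eq in \<open>simp add: null_fun_diff[of v] s_def\<close>)
  finally have "null_fun d"
    using d by (intro Wh_coercive[OF W_Wh[OF d] \<omega>(1-3)]) (simp add: W_def W_fine_on_def)
  then show ?thesis by (simp add: null_fun_diff[of "CT T v"] d_def Cs_def)
qed

lemma kernel_projection:
  assumes v: "v \<in> Vh"
  shows "(\<lambda>x. v x - I v x) \<in> Wh"
proof -
  have vV: "v \<in> V" using v Vh_V by blast
  have "null_fun (I (\<lambda>x. v x - I v x))"
    using I_lin[OF vV IV[OF vV], of "-1"] I_proj[OF I_in[OF vV]]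
    unfolding eq_on_dom_def by eventually_elim simp
  then show ?thesis using fun_subspace_diff[OF Vh v VH_Vh[OF I_in[OF vV]]] by (simp only: W_fine_def mem_Collect_eq simp_thms)
qed

text \<open>The interpolation fixes v and annihilates w, so up to null functions v is the
  interpolant of v - w.\<close>

lemma kernel_split:
  assumes v: "v \<in> VH" and w: "w \<in> Wh"
  shows "N v \<le> CIHV * N (\<lambda>x. v x - w x)"
proof -
  have d: "(\<lambda>x. v x - w x) \<in> V" by (rule fun_subspace_diff[OF V VHV[OF v] Wh_V[OF w]])
  have "eq_on_dom \<Omega> v (I (\<lambda>x. v x - w x))"
    using I_lin[OF VHV[OF v] Wh_V[OF w], of "-1"] I_proj[OF v] Wh_I[OF w]
    unfolding eq_on_dom_def by eventually_elim simp
  then show ?thesis using N_cong[OF VHV[OF v] IV[OF d]] I_stable[OF d] by simp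
qed

section \<open>Best approximation in the coarse space\<close>

lemma nodal_set: "\<exists>P. finite P \<and> (\<forall>w\<in>Vh. (\<forall>p\<in>P. w p = 0) \<longrightarrow> N w = 0)"
proof -
  obtain P where P: "finite P"
    "\<And>v x. v \<in> S1 \<Omega> (uniform_refinement n \<G>) \<Longrightarrow> \<forall>p\<in>P. v p = 0 \<Longrightarrow> x \<in> closure \<Omega> \<Longrightarrow> v x = 0"
    using refinement_nodes[OF finite_mesh _ Union_mesh n] by (metis cell_ref)
  have "N w = 0" if w: "w \<in> Vh" "\<forall>p\<in>P. w p = 0" for w
  proof -
    have "w \<in> S1 \<Omega> (uniform_refinement n \<G>)" using w(1) by (simp add: fe_space_def)
    then have "w x = 0" if "x \<in> \<Omega>" for x using P(2)[OF _ w(2)] that closure_subset by blast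
    then have "null_fun w" unfolding eq_on_dom_def by (intro AE_I2) (simp add: space_restrict_space)
    then show ?thesis using N_zero_iff[OF V_W12[OF Vh_V[OF w(1)]]] by simp
  qed
  with P(1) show ?thesis by (intro exI[of _ P]) simp
qed

text \<open>The normal equations for the energy product are solvable by elimination of nodes, and
  Pythagoras shows that their solution is a minimizer.\<close>

lemma best_approximation:
  assumes u: "u \<in> Vh"
  shows "\<exists>z\<in>VH. \<forall>v\<in>VH. N (\<lambda>x. u x - z x) \<le> N (\<lambda>x. u x - v x)"
proof -
  obtain P where P: "finite P" "\<forall>w\<in>Vh. (\<forall>p\<in>P. w p = 0) \<longrightarrow> N w = 0"
    using nodal_set by (elim exE conjE)
  have VHW: "v \<in> VH \<Longrightarrow> v \<in> W12 \<Omega>" for v using VHV V_W12 by blast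
  have uW: "u \<in> W12 \<Omega>" using u Vh_V V_W12 by blast
  have sq: "sesquilinear_on VH energy" by (rule sesquilinear_on_subset[OF sesquilinear_energy]) (use VHW in blast)
  have null: "energy v w = 0 \<and> energy w v = 0" if "v \<in> W12 \<Omega>" "w \<in> W12 \<Omega>" "energy w w = 0" for v w
  proof -
    have "N w = 0" using that(3) N_eq[of w] by simp
    then have nw: "null_fun w" using N_zero_iff[OF that(2)] by simp
    have "AE x in lebesgue_on \<Omega>. w x = 0" using nw by (simp add: eq_on_dom_def)
    moreover have "grad_inner \<Omega> \<Omega> v w = 0"
      unfolding grad_inner_def by (intro sum.neutral ballI L2_inner_null null_fun_wgrad[OF that(2) nw])
    ultimately have "energy v w = 0" by (simp add: energy_def L2_inner_null)
    then show ?thesis using energy_commute[of w v] by simp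
  qed
  have "\<exists>z\<in>VH. \<forall>w\<in>VH. energy z w = energy u w"
  proof (rule galerkin_solvable[OF P(1) VH sq])
    fix w assume w: "w \<in> VH" "\<forall>p\<in>P. w p = 0"
    have "N w = 0" using P(2)[rule_format, OF VH_Vh[OF w(1)]] w(2) by simp
    then show "energy w w = 0" by (simp add: energy_self)
  next
    show "energy w v = 0 \<and> energy v w = 0" if "w \<in> VH" "v \<in> VH" "energy w w = 0" for w v
      using null[OF VHW[OF that(2)] VHW[OF that(1)] that(3)] by simp
    show "energy u w = 0" if "w \<in> VH" "energy w w = 0" for w
      using null[OF uW VHW[OF that(1)] that(2)] by simp
    show "energy u (\<lambda>x. v x + c * w x) = energy u v + cnj c * energy u w" if "v \<in> VH" "w \<in> VH" for v w c
      by (rule sesquilinear_on_right[OF sesquilinear_energy VHW[OF that(1)] VHW[OF that(2)] uW])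
  qed
  then obtain z where z: "z \<in> VH" "\<And>w. w \<in> VH \<Longrightarrow> energy z w = energy u w" by blast
  have "N (\<lambda>x. u x - z x) \<le> N (\<lambda>x. u x - v x)" if v: "v \<in> VH" for v
  proof -
    define e where "e = (\<lambda>x. u x - z x)"
    define d where "d = (\<lambda>x. z x - v x)"
    have d: "d \<in> VH" unfolding d_def by (rule fun_subspace_diff[OF VH z(1) v])
    have e: "e \<in> W12 \<Omega>" unfolding e_def by (rule fun_subspace_diff[OF W12 uW VHW[OF z(1)]])
    have ed: "energy e d = 0"
      unfolding e_def using sesquilinear_on_diff_left[OF sesquilinear_energy uW VHW[OF z(1)] VHW[OF d]] z(2)[OF d] by simp
    have de: "energy d e = 0" using energy_commute[of d e] ed by simp
    have s: "(\<lambda>x. e x + d x) \<in> W12 \<Omega>" by (rule fun_subspace_add[OF W12 e VHW[OF d]])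
    have "energy (\<lambda>x. e x + d x) (\<lambda>x. e x + d x) = energy e e + energy d d"
      using sesquilinear_on_add_left[OF sesquilinear_energy e VHW[OF d] s]
        sesquilinear_on_add_right[OF sesquilinear_energy e VHW[OF d] e]
        sesquilinear_on_add_right[OF sesquilinear_energy e VHW[OF d] VHW[OF d]] ed de by simp
    then have "(N (\<lambda>x. e x + d x))\<^sup>2 = (N e)\<^sup>2 + (N d)\<^sup>2"
      unfolding energy_self of_real_add[symmetric] of_real_eq_iff .
    then have "(N e)\<^sup>2 \<le> (N (\<lambda>x. e x + d x))\<^sup>2" by simp
    then have "N e \<le> N (\<lambda>x. e x + d x)" by (rule power2_le_imp_le) (rule N_nonneg)
    then show ?thesis by (simp add: e_def d_def)
  qed
  then show ?thesis using z(1) by blast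
qed

text \<open>The error operator 1 - I annihilates the coarse space, so it takes the same value at u
  and at u - v.\<close>

lemma interpolation_quasi_best:
  assumes u: "u \<in> V" and v: "v \<in> VH"
  shows "N (\<lambda>x. u x - I u x) \<le> (1 + CIHV) * N (\<lambda>x. u x - v x)"
proof -
  let ?d = "\<lambda>x. u x - v x"
  have d: "?d \<in> V" by (rule fun_subspace_diff[OF V u VHV[OF v]])
  have "eq_on_dom \<Omega> (\<lambda>x. u x - I u x) (\<lambda>x. ?d x - I ?d x)"
    using I_lin[OF u VHV[OF v], of "-1"] I_proj[OF v] unfolding eq_on_dom_def by eventually_elim simp
  then have "N (\<lambda>x. u x - I u x) = N (\<lambda>x. ?d x - I ?d x)"
    by (rule N_cong[OF fun_subspace_diff[OF V u IV[OF u]] fun_subspace_diff[OF V d IV[OF d]]])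
  also have "\<dots> \<le> N ?d + N (I ?d)" by (rule seminorm_on_diff[OF seminorm_N d IV[OF d]])
  also have "\<dots> \<le> (1 + CIHV) * N ?d" using I_stable[OF d] by (simp add: distrib_right)
  finally show ?thesis .
qed

text \<open>Translates the extended-real inf-sup value into witnesses. With c strictly below
  \<alpha> there is a w that exceeds c even if no w attains the supremum.\<close>

lemma inf_sup_witness:
  assumes "ereal \<alpha> \<le> inf_sup \<Omega> \<Gamma>R tr \<kappa> X" "X \<subseteq> V" "v \<in> X" "N v \<noteq> 0" "c < \<alpha>"
  shows "\<exists>w\<in>X. N w \<noteq> 0 \<and> c * (N v * N w) \<le> Re (form \<Omega> v w)"
proof -
  have nz: "N w \<noteq> 0 \<longleftrightarrow> \<not> null_fun w" if "w \<in> X" for w using N_zero_iff V_W12 assms(2) that by blast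
  have "ereal \<alpha> \<le> (SUP w\<in>{w\<in>X. \<not> null_fun w}. ereal (Re (form \<Omega> v w) / (N v * N w)))"
    using assms(1) unfolding inf_sup_def by (rule order_trans) (rule INF_lower, use assms(3,4) nz in simp)
  moreover have "ereal c < ereal \<alpha>" using assms(5) by simp
  ultimately have "ereal c < (SUP w\<in>{w\<in>X. \<not> null_fun w}. ereal (Re (form \<Omega> v w) / (N v * N w)))"
    by (rule less_le_trans[rotated])
  then obtain w where w: "w \<in> X" "\<not> null_fun w" "ereal c < ereal (Re (form \<Omega> v w) / (N v * N w))"
    unfolding less_SUP_iff by blast
  have "N w \<noteq> 0" using w nz by blast
  then have "N v * N w > 0" using assms(4) N_nonneg[of v] N_nonneg[of w] by (simp add: order_less_le)
  then have "c * (N v * N w) \<le> Re (form \<Omega> v w)" using w(3) by (simp add: pos_less_divide_eq)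
  then show ?thesis using w(1) \<open>N w \<noteq> 0\<close> by blast
qed

text \<open>The abstract estimate applied to the correctors. \<open>F\<close> stands for the load
  functional; it serves to identify the two discrete problems on the test space.\<close>

lemma quasi_optimal:
  assumes \<Lambda>: "nodal_basis \<Omega> \<Gamma>D tr \<G> \<Lambda>"
    and lc: "local_correctors \<Omega> \<Gamma>D \<Gamma>R tr \<kappa> \<G> (uniform_refinement n \<G>) I m CT" and m: "m \<ge> 1"
    and ic: "ideal_correctors \<Omega> \<Gamma>D \<Gamma>R tr \<kappa> \<G> (uniform_refinement n \<G>) I CTinf"
    and decay: "\<And>v. v \<in> VH \<Longrightarrow> grad_norm \<Omega> \<Omega> (\<lambda>x. corrector_sum \<G> CTinf v x - corrector_sum \<G> CT v x)
          \<le> \<delta> * grad_norm \<Omega> \<Omega> v" and \<delta>: "0 \<le> \<delta>"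
    and inf_sup: "ereal \<alpha> \<le> inf_sup \<Omega> \<Gamma>R tr \<kappa> Vh" and \<alpha>: "\<alpha> > 0"
    and small: "Ca * (sqrt (3 / 2) * \<delta> * (CIH * sqrt (Col 1))) * CIHV \<le> \<alpha> / 2"
    and uH: "uH \<in> VH" "\<And>v. v \<in> test_space \<Gamma>D \<G> \<Lambda> (corrector_sum \<G> CT) \<Longrightarrow> form \<Omega> uH v = F v"
    and uh: "uh \<in> Vh" "\<And>v. v \<in> Vh \<Longrightarrow> form \<Omega> uh v = F v"
  shows "N (\<lambda>x. uh x - uH x) \<le> 2 * N (\<lambda>x. uh x - I uh x)"
proof -
  let ?Cm = "corrector_sum \<G> CT" and ?Ci = "corrector_sum \<G> CTinf"
  obtain P where P: "finite P" "\<forall>w\<in>Vh. (\<forall>p\<in>P. w p = 0) \<longrightarrow> N w = 0"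
    using nodal_set by (elim exE conjE)
  have sqV: "sesquilinear_on V (form \<Omega>)"
    by (rule sesquilinear_on_subset[OF sesquilinear_form[OF domain(3) closure_subset]]) (use V_W12 in blast)
  have CTm: "CT T v \<in> Wh" if "T \<in> \<G>" "v \<in> VH" for T v
    using lc that unfolding local_correctors_def W_fine_on_def by blast
  have "\<forall>T\<in>\<G>. \<forall>v\<in>V. CTinf T v \<in> Wh \<and> (\<forall>w\<in>Wh. form \<Omega> w (CTinf T v) = form T w v)"
    using ic unfolding ideal_correctors_def .
  then have CTi: "CTinf T v \<in> Wh" "\<And>w. w \<in> Wh \<Longrightarrow> form \<Omega> w (CTinf T v) = form T w v" if "T \<in> \<G>" "v \<in> VH" for T v
    using that VHV by blast+
  have Cm: "?Cm v \<in> Wh" if "v \<in> VH" for v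
    using fun_subspace_sum[OF Wh, of \<G> "\<lambda>T. CT T v" "\<lambda>_. 1"] CTm that by (simp add: corrector_sum_def)
  have Ci: "?Ci v \<in> Wh" if "v \<in> VH" for v
    using fun_subspace_sum[OF Wh, of \<G> "\<lambda>T. CTinf T v" "\<lambda>_. 1"] CTi(1) that by (simp add: corrector_sum_def)
  have Ci_eq: "form \<Omega> w (?Ci v) = form \<Omega> w v" if v: "v \<in> VH" and w: "w \<in> Wh" for v w
  proof -
    have "form \<Omega> w (?Ci v) = (\<Sum>T\<in>\<G>. form \<Omega> w (CTinf T v))"
      using sesquilinear_on_sum_right[OF sqV V, of \<G> "\<lambda>T. CTinf T v" w "\<lambda>_. 1"] CTi(1)[OF _ v] Wh_V w
      by (simp add: corrector_sum_def)
    also have "\<dots> = (\<Sum>T\<in>\<G>. form T w v)" using CTi(2)[OF _ v w] by simp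
    also have "\<dots> = form \<Omega> w v" using form_cells V_W12 Wh_V[OF w] VHV[OF v] by simp
    finally show ?thesis .
  qed
  \<comment> \<open>The three factors are the norm equivalence on the kernel, the decay of the
    truncation error and the stability of the interpolation in the gradient norm.\<close>
  let ?\<eta> = "sqrt (3 / 2) * \<delta> * (CIH * sqrt (Col 1))"
  have \<eta>: "?\<eta> \<ge> 0" using \<delta> constants overlap_nonneg[OF overlap, of 1] by simp
  have diff: "N (\<lambda>x. ?Ci (I v) x - ?Cm (I v) x) \<le> ?\<eta> * N v" if v: "v \<in> Vh" for v
  proof -
    have vV: "v \<in> V" and Iv: "I v \<in> VH" using v Vh_V I_in by blast+
    have "(\<lambda>x. ?Ci (I v) x - ?Cm (I v) x) \<in> Wh" by (rule fun_subspace_diff[OF Wh Ci[OF Iv] Cm[OF Iv]])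
    then have "N (\<lambda>x. ?Ci (I v) x - ?Cm (I v) x) \<le>
        sqrt (3 / 2) * grad_norm \<Omega> \<Omega> (\<lambda>x. ?Ci (I v) x - ?Cm (I v) x)" by (rule Wh_N_le)
    also have "\<dots> \<le> sqrt (3 / 2) * (\<delta> * grad_norm \<Omega> \<Omega> (I v))"
      by (intro mult_left_mono decay Iv) simp
    also have "\<dots> \<le> sqrt (3 / 2) * (\<delta> * (CIH * sqrt (Col 1) * grad_norm \<Omega> \<Omega> v))"
      by (intro mult_left_mono interpolation_grad vV \<delta>) simp
    also have "\<dots> = ?\<eta> * grad_norm \<Omega> \<Omega> v" by simp
    also have "\<dots> \<le> ?\<eta> * N v" by (rule mult_left_mono[OF grad_norm_le_N \<eta>])
    finally show ?thesis .
  qed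
  have orth: "form \<Omega> (\<lambda>x. uh x - uH x) (\<lambda>x. v x - ?Cm v x) = 0" if v: "v \<in> VH" for v
  proof -
    let ?J = "vertices \<G> - \<Gamma>D"
    have "\<forall>v\<in>VH. \<exists>c. eq_on_dom \<Omega> v (\<lambda>x. \<Sum>z\<in>?J. c z * \<Lambda> z x)"
      using \<Lambda> unfolding nodal_basis_def by (elim conjE)
    then obtain c where c: "eq_on_dom \<Omega> v (\<lambda>x. \<Sum>z\<in>?J. c z * \<Lambda> z x)" using v by blast
    have \<Lambda>VH: "\<Lambda> z \<in> VH" if "z \<in> ?J" for z using \<Lambda> that unfolding nodal_basis_def by blast
    \<comment> \<open>The corrected v itself need not belong to the test space. The combination
      \<open>t\<close> of the generators does, and it differs from the corrected v by a null
      function.\<close>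
    define t where "t = (\<lambda>x. \<Sum>z\<in>?J. c z * (\<Lambda> z x - ?Cm (\<Lambda> z) x))"
    have t: "t \<in> Vh" unfolding t_def
    proof (rule fun_subspace_sum[OF Vh])
      fix z assume "z \<in> ?J"
      then show "(\<lambda>x. \<Lambda> z x - ?Cm (\<Lambda> z) x) \<in> Vh"
        by (intro fun_subspace_diff[OF Vh] VH_Vh Wh_Vh Cm \<Lambda>VH)
    qed
    have "t \<in> test_space \<Gamma>D \<G> \<Lambda> ?Cm" unfolding test_space_def t_def by blast
    then have ft: "form \<Omega> uh t = form \<Omega> uH t" using uH(2) uh(2) t by simp
    have "AE x in lebesgue_on \<Omega>. \<forall>T\<in>\<G>. CT T v x = (\<Sum>z\<in>?J. c z * CT T (\<Lambda> z) x)"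
      using corrector_linear[OF lc m _ \<Lambda>VH v c] finite_mesh
      unfolding eq_on_dom_def by (intro AE_finite_allI)
    then have "AE x in lebesgue_on \<Omega>. v x - ?Cm v x - t x = 0"
      using c unfolding eq_on_dom_def
    proof eventually_elim
      case (elim x)
      have "?Cm v x = (\<Sum>T\<in>\<G>. \<Sum>z\<in>?J. c z * CT T (\<Lambda> z) x)" using elim(1) by (simp add: corrector_sum_def)
      also have "\<dots> = (\<Sum>z\<in>?J. c z * ?Cm (\<Lambda> z) x)"
        unfolding corrector_sum_def sum_distrib_left by (rule sum.swap)
      finally show ?case using elim(2) by (simp add: t_def right_diff_distrib sum_subtractf)
    qed
    then have nf: "null_fun (\<lambda>x. (v x - ?Cm v x) - t x)" by (simp add: eq_on_dom_def)
    have sV: "(\<lambda>x. v x - ?Cm v x) \<in> V" by (rule fun_subspace_diff[OF V VHV[OF v] Wh_V[OF Cm[OF v]]])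
    have eV: "(\<lambda>x. uh x - uH x) \<in> V" by (rule fun_subspace_diff[OF V Vh_V[OF uh(1)] VHV[OF uH(1)]])
    have "form \<Omega> (\<lambda>x. uh x - uH x) (\<lambda>x. (v x - ?Cm v x) - t x) = 0"
      by (rule null_fun_form[OF V_W12[OF fun_subspace_diff[OF V sV Vh_V[OF t]]] nf domain(3) closure_subset])
    then have "form \<Omega> (\<lambda>x. uh x - uH x) (\<lambda>x. v x - ?Cm v x) = form \<Omega> (\<lambda>x. uh x - uH x) t"
      using sesquilinear_on_diff_right[OF sqV sV Vh_V[OF t] eV] by simp
    also have "\<dots> = 0"
      using sesquilinear_on_diff_left[OF sqV Vh_V[OF uh(1)] VHV[OF uH(1)] Vh_V[OF t]] ft by simp
    finally show ?thesis .
  qed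
  have coercive: "N w = 0" if w: "w \<in> Wh" "form \<Omega> w w = 0" for w
  proof -
    have "null_fun w"
      by (rule Wh_coercive[OF w(1) domain(1) closure_subset frontier_null _ w(2)]) simp
    then show ?thesis using N_zero_iff[OF V_W12[OF Wh_V[OF w(1)]]] by simp
  qed
  have VhV: "Vh \<subseteq> V" and VHVh: "VH \<subseteq> Vh" and WhVh: "Wh \<subseteq> Vh" using Vh_V VH_Vh Wh_Vh by blast+
  show ?thesis
  proof (rule petrov_galerkin_quasi_optimal[where V = V and Vh = Vh and VH = VH and a = "form \<Omega>" and Ca = Ca
        and N = N and I = I and CI = CIHV and W = Wh and \<alpha> = \<alpha> and P = P and Cinf = ?Ci and Cm = ?Cm and \<eta> = ?\<eta>])
    show "I v \<in> VH" if "v \<in> Vh" for v by (rule I_in[OF Vh_V[OF that]])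
    show "N w = 0" if "w \<in> Vh" "\<forall>p\<in>P. w p = 0" for w using P(2) that by simp
  qed (fact V Vh VhV VH VHVh sqV form_bound less_imp_le[OF constants(3)] seminorm_N Wh WhVh kernel_projection
      kernel_split less_imp_le[OF constants(2)] coercive inf_sup_witness[OF inf_sup VhV] \<alpha> P(1) Ci Ci_eq Cm
      diff small \<eta> uH(1) uh(1) orth)+
qed

end

text \<open>C is fixed before \<kappa>, the meshes, m and the data: this order of quantifiers
  expresses that the hidden constants do not depend on them.\<close>

theorem theorem3:
  fixes \<Omega> \<Gamma>D \<Gamma>R :: "'a::euclidean_space set"
    and tr :: "('a \<Rightarrow> complex) \<Rightarrow> ('a \<Rightarrow> complex)"
    and \<gamma> :: "real \<Rightarrow> real"
    and Col :: "nat \<Rightarrow> real"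
    and \<rho> \<theta> Ca CIH CIHV CC C2 \<beta> CFEM CPG :: real
  assumes dim: "DIM('a) \<in> {1, 2, 3}"
    and domain: "lipschitz_domain \<Omega>" "polyhedral \<Omega>"
    and boundary: "frontier \<Omega> = \<Gamma>D \<union> \<Gamma>R" "\<Gamma>D \<inter> \<Gamma>R = {}" "closed \<Gamma>D"
    and trace: "trace_operator \<Omega> tr"
    and gamma: "\<forall>\<kappa>>0. \<gamma> \<kappa> > 0" "\<exists>c k. \<forall>\<kappa>>0. \<gamma> \<kappa> \<le> c * (1 + \<kappa>) ^ k"
    and Col: "\<exists>c k. \<forall>m. Col m \<le> c * (1 + real m) ^ k"
    and constants_pos: "\<rho> > 0" "\<theta> > 0" "Ca > 0" "CIH > 0" "CIHV > 0" "CC > 0" "C2 > 0"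
      "0 < \<beta>" "\<beta> < 1" "CFEM > 0"
    and CPG: "CPG = 2 * CIHV * CC * CFEM"
  shows "\<exists>C>0. \<forall>\<kappa> \<G> n I \<Lambda> CT CTinf m f g uH uh.
    (let V = V_space \<Omega> \<Gamma>D tr;
         a = a_form \<Omega> \<Gamma>R tr \<kappa> \<Omega>;
         nrm = V_norm \<Omega> \<kappa>;
         H = mesh_size \<G>;
         \<G>h = uniform_refinement n \<G>;
         VH = fe_space \<Omega> \<Gamma>D tr \<G>;
         Vh = fe_space \<Omega> \<Gamma>D tr \<G>h;
         Cm = (\<lambda>k. corrector_sum \<G> (CT k));
         Cinf = corrector_sum \<G> CTinf
     in
       \<kappa> > 0 \<longrightarrow>
       (\<forall>v\<in>V. \<forall>w\<in>V. cmod (a v w) \<le> Ca * nrm v * nrm w) \<longrightarrow>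
       ereal (1 / \<gamma> \<kappa>) \<le> inf_sup \<Omega> \<Gamma>R tr \<kappa> V \<longrightarrow>
       mesh \<Omega> \<rho> \<theta> \<G> \<longrightarrow> n \<ge> 1 \<longrightarrow> overlap_bound \<G> Col \<longrightarrow>
       nodal_basis \<Omega> \<Gamma>D tr \<G> \<Lambda> \<longrightarrow>
       quasi_interpolation \<Omega> \<Gamma>D tr \<G> CIH I \<longrightarrow>
       (\<forall>v\<in>V. nrm (I v) \<le> CIHV * nrm v) \<longrightarrow>
       (\<forall>k\<ge>1. local_correctors \<Omega> \<Gamma>D \<Gamma>R tr \<kappa> \<G> \<G>h I k (CT k)) \<longrightarrow>
       ideal_correctors \<Omega> \<Gamma>D \<Gamma>R tr \<kappa> \<G> \<G>h I CTinf \<longrightarrow>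
       (\<forall>v\<in>VH. nrm (Cinf v) \<le> CC * nrm v) \<longrightarrow>
       (\<forall>v\<in>VH. \<forall>k\<ge>1. grad_norm \<Omega> \<Omega> (\<lambda>x. Cinf v x - Cm k v x)
          \<le> C2 * sqrt (Col k) * \<beta> ^ k * grad_norm \<Omega> \<Omega> v) \<longrightarrow>
       CIH * sqrt (Col 1) * H * \<kappa> \<le> 1 / sqrt 2 \<longrightarrow>
       ereal (1 / (CFEM * \<gamma> \<kappa>)) \<le> inf_sup \<Omega> \<Gamma>R tr \<kappa> Vh \<longrightarrow>
       m \<ge> (1::nat) \<longrightarrow>
       real m \<ge> \<bar>ln (sqrt 6 * Ca * sqrt (Col 1) * CIH * CIHV * C2 * sqrt (Col m) * CFEM * \<gamma> \<kappa>)\<bar>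
                   / \<bar>ln \<beta>\<bar> \<longrightarrow>
       real m \<ge> \<bar>ln (2 * C2 * sqrt (Col m) * Ca\<^sup>2 * CPG * \<gamma> \<kappa> * sqrt (3 / 2))\<bar> / \<bar>ln \<beta>\<bar> \<longrightarrow>
       f \<in> L2 (lebesgue_on \<Omega>) \<longrightarrow> g \<in> L2 (surface \<Gamma>R) \<longrightarrow>
       uH \<in> VH \<longrightarrow> (\<forall>v\<in>test_space \<Gamma>D \<G> \<Lambda> (Cm m). a uH v = load \<Omega> \<Gamma>R tr f g v) \<longrightarrow>
       uh \<in> Vh \<longrightarrow> (\<forall>v\<in>Vh. a uh v = load \<Omega> \<Gamma>R tr f g v) \<longrightarrow>
       nrm (\<lambda>x. uh x - uH x) \<le> C * nrm (\<lambda>x. uh x - I uh x) \<and>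
       (\<exists>vmin\<in>VH. (\<forall>v\<in>VH. nrm (\<lambda>x. uh x - vmin x) \<le> nrm (\<lambda>x. uh x - v x)) \<and>
          nrm (\<lambda>x. uh x - I uh x) \<le> C * nrm (\<lambda>x. uh x - vmin x) \<and>
          nrm (\<lambda>x. uh x - vmin x) \<le> C * nrm (\<lambda>x. uh x - I uh x)))"
\<comment> \<open>One constant for all three estimates, which need 2 for the error, 1 +
  \<open>CIHV\<close> for the interpolant and 1 for the minimum.\<close>
proof (intro exI[of _ "2 + CIHV"] conjI allI, goal_cases)
  case 1
  show ?case using constants_pos by simp
next
  case (2 \<kappa> \<G> n I \<Lambda> CT CTinf m f g uH uh)
  show ?case
    unfolding Let_def
  proof (intro impI, goal_cases)
    case h: 1
    note \<kappa> = h(1) and bound = h(2) and mesh = h(4) and n = h(5) and overlap = h(6) and \<Lambda> = h(7)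
      and interpolation = h(8) and stable = h(9) and lc = h(10) and ic = h(11) and decay = h(13)
      and resolution = h(14) and inf_sup = h(15) and m = h(16) and oversampling = h(17)
      and uH = h(21,22) and uh = h(23,24)
    have dim3: "DIM('a) \<le> 3" using dim by auto
    have fb: "cmod (a_form \<Omega> \<Gamma>R tr \<kappa> \<Omega> v w) \<le> Ca * V_norm \<Omega> \<kappa> v * V_norm \<Omega> \<kappa> w"
      if "v \<in> V_space \<Omega> \<Gamma>D tr" "w \<in> V_space \<Omega> \<Gamma>D tr" for v w using bound that by blast
    have st: "V_norm \<Omega> \<kappa> (I v) \<le> CIHV * V_norm \<Omega> \<kappa> v" if "v \<in> V_space \<Omega> \<Gamma>D tr" for v
      using stable that by blast
    interpret multiscale \<Omega> \<Gamma>D \<Gamma>R tr \<kappa> \<G> \<rho> \<theta> n I Col Ca CIH CIHV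
      by unfold_locales (fact domain(1) boundary trace \<kappa> mesh dim3 n overlap interpolation fb st resolution
          constants_pos)+
    define \<delta> where "\<delta> = C2 * sqrt (Col m) * \<beta> ^ m"
    have \<gamma>: "\<gamma> \<kappa> > 0" using gamma(1) \<kappa> by blast
    have Col0: "0 \<le> Col m" "0 \<le> Col 1" using overlap_nonneg[OF overlap] m by auto
    have \<delta>: "0 \<le> \<delta>" using constants_pos Col0 by (simp add: \<delta>_def)
    let ?X = "sqrt 6 * Ca * sqrt (Col 1) * CIH * CIHV * C2 * sqrt (Col m) * CFEM * \<gamma> \<kappa>"
    have X: "?X * \<beta> ^ m \<le> 1"
      using power_le_inverse_if_ln_bound[OF constants_pos(8,9) oversampling] constants_pos Col0 \<gamma> by simp
    \<comment> \<open>The 2 matches the half that the abstract estimate demands of \<alpha> = 1 /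
      (CFEM \<gamma>); the root is the norm equivalence on the kernel.\<close>
    have s6: "sqrt 6 = 2 * sqrt (3 / 2)"
    proof -
      have "sqrt 6 = sqrt (2\<^sup>2 * (3 / 2))" by simp
      then show ?thesis unfolding real_sqrt_mult by simp
    qed
    have "2 * (CFEM * \<gamma> \<kappa>) * (Ca * (sqrt (3 / 2) * \<delta> * (CIH * sqrt (Col 1))) * CIHV) = ?X * \<beta> ^ m"
      unfolding \<delta>_def s6 by (simp add: mult.assoc mult.left_commute mult.commute)
    then have "2 * (CFEM * \<gamma> \<kappa>) * (Ca * (sqrt (3 / 2) * \<delta> * (CIH * sqrt (Col 1))) * CIHV) \<le> 1" using X by (simp only:)
    moreover have "0 < CFEM * \<gamma> \<kappa>" using constants_pos(10) \<gamma> by simp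
    ultimately have small: "Ca * (sqrt (3 / 2) * \<delta> * (CIH * sqrt (Col 1))) * CIHV \<le> 1 / (CFEM * \<gamma> \<kappa>) / 2"
      by (simp add: pos_le_divide_eq mult.commute)
    have main: "N (\<lambda>x. uh x - uH x) \<le> 2 * N (\<lambda>x. uh x - I uh x)"
    proof (rule quasi_optimal[where F = "load \<Omega> \<Gamma>R tr f g", OF \<Lambda> _ m ic _ \<delta> inf_sup _ small uH(1) _ uh(1)])
      show "local_correctors \<Omega> \<Gamma>D \<Gamma>R tr \<kappa> \<G> (uniform_refinement n \<G>) I m (CT m)" using lc m by blast
      show "grad_norm \<Omega> \<Omega> (\<lambda>x. corrector_sum \<G> CTinf v x - corrector_sum \<G> (CT m) v x) \<le> \<delta> * grad_norm \<Omega> \<Omega> v"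
        if "v \<in> VH" for v using decay that m unfolding \<delta>_def by blast
      show "1 / (CFEM * \<gamma> \<kappa>) > 0" using constants_pos \<gamma> by simp
    qed (use uH(2) uh(2) in blast)+
    obtain z where z: "z \<in> VH" "\<forall>v\<in>VH. N (\<lambda>x. uh x - z x) \<le> N (\<lambda>x. uh x - v x)"
      using best_approximation[OF uh(1)] by blast
    have uhV: "uh \<in> V" using Vh_V uh(1) by blast
    have grow: "x \<le> (2 + CIHV) * N v" if "x \<le> k * N v" "k \<le> 2 + CIHV" for x k v
      using that mult_right_mono[OF that(2) N_nonneg[of v]] by linarith
    \<comment> \<open>The interpolant of \<open>uh\<close> is one of the competitors in the
      minimum.\<close>
    have "N (\<lambda>x. uh x - z x) \<le> 1 * N (\<lambda>x. uh x - I uh x)" using z(2) I_in[OF uhV] by simp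
    then show ?case
      using grow[OF main] grow[OF interpolation_quasi_best[OF uhV z(1)]] grow[of _ 1] constants_pos(5) z
      by (intro conjI bexI[OF _ z(1)]) auto
  qed
qed

end
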